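(* Assume that hypothesis (H) (spelled out in the context) holds for $(\omega_0,A_0)\in(\mathbb{R}\setminus\{0\})\times\mathbb{R}$ and the $L_0$-periodic wave $\phi=\phi_{(\omega_0,A_0)}$. Let $$s(\phi)=\left(2\omega_0(\omega_0-1)+2A_0+1\right)\int_0^{L_0}\phi\,dx+\omega_0\int_{0}^{L_0}\phi\,\mathcal{M}\phi\, dx+\left(2A_0(\omega_0+1)-\omega_0+1\right)L_0 .$$ If $\omega_0-1-2A_0\neq0$ and $s(\phi)>0$, then the periodic wave $\phi$ is orbitally stable in $X$ by the periodic flow of $u_t+u_x+uu_x+(\mathcal{M}u)_t=0$.
   Context: Fix a period $L_0>0$. Functions are real-valued and $L_0$-periodic; $\widehat g(\kappa)$, $\kappa\in\mathbb{Z}$, are Fourier coefficients, $H^s_{per}([0,L_0])$ is the periodic Sobolev space, and $\langle\cdot,\cdot\rangle$ is the $L^2_{per}([0,L_0])$ inner product (extended to the corresponding duality pairing/quadratic form where needed). $\mathcal{M}$ is the Fourier multiplier $\widehat{\mathcal{M}g}(\kappa)=\theta(\kappa)\widehat g(\kappa)$, where $\theta$ is real, even and continuous on $\mathbb{R}$ and $\upsilon_1|\kappa|^{m_1}\le\theta(\kappa)\le\upsilon_2|\kappa|^{m_1}$ for all $\kappa\in\mathbb{Z}$, for some constants $\upsilon_1,\upsilon_2>0$ and $m_1>1/3$. Put $X=H_{per}^{m_1/2}([0,L_0])$. Hypothesis (H): $(\omega_0,A_0)\in(\mathbb{R}\setminus\{0\})\times\mathbb{R}$ is fixed; $\phi=\phi_{(\omega_0,A_0)}\in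 X$ is an even $L_0$-periodic solution, in the sense of distributions, of $$\omega_0\mathcal{M}\phi+(\omega_0-1)\phi-\tfrac12\phi^2+A_0=0;$$ and the self-adjoint operator $\mathcal{L}_0=\omega_0\mathcal{M}+(\omega_0-1)-\phi$ on $L^2_{per}([0,L_0])$ (domain $H^{m_1}_{per}([0,L_0])$) has only one negative eigenvalue, which is simple, and zero is a simple eigenvalue of $\mathcal{L}_0$ with eigenfunction $\phi'$. Standing assumption on the flow: the $L_0$-periodic Cauchy problem for $u_t+u_x+uu_x+(\mathcal{M}u)_t=0$, $u(\cdot,0)=u_0$, is globally well-posed in $X$ (solutions are continuous in time with values in $X$), and the following quantities are conserved along solutions: $P(u)=\frac12\int_0^{L_0}(u\mathcal{M}u-\frac13u^3)dx$, $F(u)=\frac12\int_0^{L_0}(u\mathcal{M}u+u^2)dx$, $M(u)=\int_0^{L_0}u\,dx$. Orbital stability: let $\rho(u,v)=\inf_{y\in\mathbb{R}}\|u-v(\cdot+y)\|_X$. The wave $\phi$ is orbitally stable in $X$ if for every $\varepsilon>0$ there is $\delta>0$ such that for every $u_0\in X$ with $\|u_0-\phi\|_X<\delta$ the solution $u(t)$ with initial data $u_0$ exists globally and satisfies $\rho(u(t),\phi)<\varepsilon$ for all $t\ge0$. *)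

theory Defs
  imports "HOL-Analysis.Analysis"
begin

text \<open>
  An element of a periodic space is given by an everywhere defined, everywhere periodic
  representative; identities between such elements are stated almost everywhere.
\<close>

definition periodic :: "real \<Rightarrow> (real \<Rightarrow> real) \<Rightarrow> bool" where
  "periodic L g \<longleftrightarrow> (\<forall>x. g (x + L) = g x)"

definition L2_per :: "real \<Rightarrow> (real \<Rightarrow> real) set" where
  "L2_per L = {g. periodic L g \<and> g \<in> borel_measurable lborel \<and>
     set_integrable lborel {0..L} (\<lambda>x. (g x)\<^sup>2)}"

abbreviation per_integral :: "real \<Rightarrow> (real \<Rightarrow> real) \<Rightarrow> real" where
  "per_integral L g \<equiv> set_lebesgue_integral lborel {0..L} g"

definition fourier_coeff :: "real \<Rightarrow> (real \<Rightarrow> real) \<Rightarrow> int \<Rightarrow> complex" where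
  "fourier_coeff L g \<kappa> =
     set_lebesgue_integral lborel {0..L}
       (\<lambda>x. complex_of_real (g x) * cis (- (2 * pi * real_of_int \<kappa> * x / L))) / complex_of_real L"

text \<open>
  Only orders \<open>s \<ge> 0\<close> are needed, for which the periodic Sobolev space is a subspace of
  \<open>L2_per L\<close>. The factor \<open>L\<close> makes the norm for \<open>s = 0\<close> the \<open>L\<^sup>2\<close> norm over one period.
\<close>

definition H_per :: "real \<Rightarrow> real \<Rightarrow> (real \<Rightarrow> real) set" where
  "H_per L s = {g \<in> L2_per L.
     (\<lambda>\<kappa>::int. (1 + (real_of_int \<kappa>)\<^sup>2) powr s * (cmod (fourier_coeff L g \<kappa>))\<^sup>2) summable_on UNIV}"

definition H_norm :: "real \<Rightarrow> real \<Rightarrow> (real \<Rightarrow> real) \<Rightarrow> real" where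
  "H_norm L s g = sqrt (L *
     (\<Sum>\<^sub>\<infinity>\<kappa>::int. (1 + (real_of_int \<kappa>)\<^sup>2) powr s * (cmod (fourier_coeff L g \<kappa>))\<^sup>2))"

definition admissible_symbol :: "(real \<Rightarrow> real) \<Rightarrow> real \<Rightarrow> bool" where
  "admissible_symbol \<theta> m1 \<longleftrightarrow>
     (\<forall>\<xi>. \<theta> (- \<xi>) = \<theta> \<xi>) \<and> continuous_on UNIV \<theta> \<and> m1 > 1/3 \<and>
     (\<exists>\<upsilon>1>0. \<exists>\<upsilon>2>0. \<forall>\<kappa>::int.
        \<upsilon>1 * \<bar>real_of_int \<kappa>\<bar> powr m1 \<le> \<theta> (real_of_int \<kappa>) \<and>
        \<theta> (real_of_int \<kappa>) \<le> \<upsilon>2 * \<bar>real_of_int \<kappa>\<bar> powr m1)"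

text \<open>
  \<open>is_multiplier \<theta> L g h\<close> says that \<open>\<M>g\<close> is the square integrable function \<open>h\<close>.
  For \<open>g\<close> in \<open>H_per L m1\<close> such an \<open>h\<close> exists by Riesz-Fischer and is unique almost everywhere.
\<close>

definition is_multiplier :: "(real \<Rightarrow> real) \<Rightarrow> real \<Rightarrow> (real \<Rightarrow> real) \<Rightarrow> (real \<Rightarrow> real) \<Rightarrow> bool" where
  "is_multiplier \<theta> L g h \<longleftrightarrow> h \<in> L2_per L \<and>
     (\<forall>\<kappa>. fourier_coeff L h \<kappa> = complex_of_real (\<theta> (real_of_int \<kappa>)) * fourier_coeff L g \<kappa>)"

text \<open>
  The duality pairing \<open>\<langle>\<M>u, v\<rangle>\<close>, that is \<open>\<integral> v \<M>u dx\<close> over one period. It converges absolutely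
  for \<open>u, v\<close> in \<open>H_per L (m1/2)\<close>, where \<open>\<M>u\<close> is in general only a distribution; the sum is
  real because \<open>u, v\<close> are real-valued and \<open>\<theta>\<close> is even.
\<close>

definition M_pair :: "(real \<Rightarrow> real) \<Rightarrow> real \<Rightarrow> (real \<Rightarrow> real) \<Rightarrow> (real \<Rightarrow> real) \<Rightarrow> real" where
  "M_pair \<theta> L u v = L * Re (\<Sum>\<^sub>\<infinity>\<kappa>::int. complex_of_real (\<theta> (real_of_int \<kappa>)) *
     fourier_coeff L u \<kappa> * cnj (fourier_coeff L v \<kappa>))"

definition test_fun :: "real \<Rightarrow> (real \<Rightarrow> real) \<Rightarrow> bool" where
  "test_fun L \<psi> \<longleftrightarrow> periodic L \<psi> \<and> (\<forall>n. ((deriv ^^ n) \<psi>) differentiable_on UNIV)"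

definition weak_deriv :: "real \<Rightarrow> (real \<Rightarrow> real) \<Rightarrow> (real \<Rightarrow> real) \<Rightarrow> bool" where
  "weak_deriv L g d \<longleftrightarrow> d \<in> L2_per L \<and>
     (\<forall>\<psi>. test_fun L \<psi> \<longrightarrow>
        per_integral L (\<lambda>x. d x * \<psi> x) = - per_integral L (\<lambda>x. g x * deriv \<psi> x))"

text \<open>
  \<open>\<omega>\<^sub>0 \<M>\<phi> + (\<omega>\<^sub>0 - 1) \<phi> - \<phi>\<^sup>2/2 + A\<^sub>0 = 0\<close> tested against smooth periodic functions.
\<close>

definition wave_solution ::
    "(real \<Rightarrow> real) \<Rightarrow> real \<Rightarrow> real \<Rightarrow> real \<Rightarrow> (real \<Rightarrow> real) \<Rightarrow> bool" where
  "wave_solution \<theta> L \<omega>0 A0 \<phi> \<longleftrightarrow>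
     (\<forall>\<psi>. test_fun L \<psi> \<longrightarrow>
        \<omega>0 * M_pair \<theta> L \<phi> \<psi> + (\<omega>0 - 1) * per_integral L (\<lambda>x. \<phi> x * \<psi> x)
          - 1/2 * per_integral L (\<lambda>x. (\<phi> x)\<^sup>2 * \<psi> x) + A0 * per_integral L \<psi> = 0)"

text \<open>
  The eigenspace (including the zero function) for \<open>\<mu>\<close> of
  \<open>\<L>\<^sub>0 = \<omega>\<^sub>0 \<M> + (\<omega>\<^sub>0 - 1) - \<phi>\<close> with domain \<open>H_per L m1\<close>. Real eigenfunctions
  suffice, as the operator is real; that it is self-adjoint is a consequence of the wave equation
  (solutions are bounded), so it is not a separate assumption.
\<close>

definition L0_eigenspace ::
    "(real \<Rightarrow> real) \<Rightarrow> real \<Rightarrow> real \<Rightarrow> real \<Rightarrow> (real \<Rightarrow> real) \<Rightarrow> real \<Rightarrow> (real \<Rightarrow> real) set" where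
  "L0_eigenspace \<theta> m1 L \<omega>0 \<phi> \<mu> = {g \<in> H_per L m1.
     \<exists>h. is_multiplier \<theta> L g h \<and>
       (AE x in lborel. \<omega>0 * h x + (\<omega>0 - 1) * g x - \<phi> x * g x = \<mu> * g x)}"

definition L0_eigenfunction ::
    "(real \<Rightarrow> real) \<Rightarrow> real \<Rightarrow> real \<Rightarrow> real \<Rightarrow> (real \<Rightarrow> real) \<Rightarrow> real \<Rightarrow> (real \<Rightarrow> real) \<Rightarrow> bool" where
  "L0_eigenfunction \<theta> m1 L \<omega>0 \<phi> \<mu> g \<longleftrightarrow>
     g \<in> L0_eigenspace \<theta> m1 L \<omega>0 \<phi> \<mu> \<and> \<not> (AE x in lborel. g x = 0)"

definition L0_eigenvalue ::
    "(real \<Rightarrow> real) \<Rightarrow> real \<Rightarrow> real \<Rightarrow> real \<Rightarrow> (real \<Rightarrow> real) \<Rightarrow> real \<Rightarrow> bool" where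
  "L0_eigenvalue \<theta> m1 L \<omega>0 \<phi> \<mu> \<longleftrightarrow> (\<exists>g. L0_eigenfunction \<theta> m1 L \<omega>0 \<phi> \<mu> g)"

definition L0_simple_with ::
    "(real \<Rightarrow> real) \<Rightarrow> real \<Rightarrow> real \<Rightarrow> real \<Rightarrow> (real \<Rightarrow> real) \<Rightarrow> real \<Rightarrow> (real \<Rightarrow> real) \<Rightarrow> bool" where
  "L0_simple_with \<theta> m1 L \<omega>0 \<phi> \<mu> \<eta> \<longleftrightarrow>
     L0_eigenfunction \<theta> m1 L \<omega>0 \<phi> \<mu> \<eta> \<and>
     (\<forall>g \<in> L0_eigenspace \<theta> m1 L \<omega>0 \<phi> \<mu>. \<exists>c. AE x in lborel. g x = c * \<eta> x)"

text \<open>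
  As \<open>\<phi>\<close> is only given up to null sets, the eigenfunction \<open>\<phi>'\<close> is its weak derivative.
\<close>

definition hypothesis_H ::
    "(real \<Rightarrow> real) \<Rightarrow> real \<Rightarrow> real \<Rightarrow> real \<Rightarrow> real \<Rightarrow> (real \<Rightarrow> real) \<Rightarrow> bool" where
  "hypothesis_H \<theta> m1 L \<omega>0 A0 \<phi> \<longleftrightarrow>
     \<omega>0 \<noteq> 0 \<and> \<phi> \<in> H_per L (m1/2) \<and> (\<forall>x. \<phi> (- x) = \<phi> x) \<and>
     wave_solution \<theta> L \<omega>0 A0 \<phi> \<and>
     (\<exists>!\<mu>. \<mu> < 0 \<and> L0_eigenvalue \<theta> m1 L \<omega>0 \<phi> \<mu>) \<and>
     (\<forall>\<mu><0. L0_eigenvalue \<theta> m1 L \<omega>0 \<phi> \<mu> \<longrightarrow> (\<exists>\<eta>. L0_simple_with \<theta> m1 L \<omega>0 \<phi> \<mu> \<eta>)) \<and>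
     (\<exists>d. weak_deriv L \<phi> d \<and> L0_simple_with \<theta> m1 L \<omega>0 \<phi> 0 d)"

text \<open>
  A global solution of \<open>u\<^sub>t + u\<^sub>x + u u\<^sub>x + (\<M>u)\<^sub>t = 0\<close> with data \<open>u0\<close>: continuous in time with
  values in \<open>X = H_per L (m1/2)\<close>, the equation being tested against smooth periodic functions
  of \<open>x\<close> in the form \<open>d/dt \<langle>u + \<M>u, \<psi>\<rangle> = \<langle>u + u\<^sup>2/2, \<psi>'\<rangle>\<close>.
\<close>

definition global_solution ::
    "(real \<Rightarrow> real) \<Rightarrow> real \<Rightarrow> real \<Rightarrow> (real \<Rightarrow> real) \<Rightarrow> (real \<Rightarrow> real \<Rightarrow> real) \<Rightarrow> bool" where
  "global_solution \<theta> m1 L u0 u \<longleftrightarrow>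
     (\<forall>t\<ge>0. u t \<in> H_per L (m1/2)) \<and>
     (\<forall>t\<ge>0. ((\<lambda>s. H_norm L (m1/2) (\<lambda>x. u s x - u t x)) \<longlongrightarrow> 0) (at t within {0..})) \<and>
     (AE x in lborel. u 0 x = u0 x) \<and>
     (\<forall>\<psi>. test_fun L \<psi> \<longrightarrow> (\<forall>t\<ge>0.
        ((\<lambda>s. per_integral L (\<lambda>x. u s x * \<psi> x) + M_pair \<theta> L (u s) \<psi>) has_real_derivative
           per_integral L (\<lambda>x. (u t x + (u t x)\<^sup>2 / 2) * deriv \<psi> x)) (at t within {0..})))"

text \<open>Well-posedness in the sense of Hadamard: existence, uniqueness, continuous dependence.\<close>

definition globally_well_posed :: "(real \<Rightarrow> real) \<Rightarrow> real \<Rightarrow> real \<Rightarrow> bool" where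
  "globally_well_posed \<theta> m1 L \<longleftrightarrow>
     (\<forall>u0 \<in> H_per L (m1/2).
        (\<exists>u. global_solution \<theta> m1 L u0 u) \<and>
        (\<forall>u v. global_solution \<theta> m1 L u0 u \<and> global_solution \<theta> m1 L u0 v \<longrightarrow>
           (\<forall>t\<ge>0. AE x in lborel. u t x = v t x)) \<and>
        (\<forall>u. global_solution \<theta> m1 L u0 u \<longrightarrow>
           (\<forall>T>0. \<forall>\<epsilon>>0. \<exists>\<delta>>0. \<forall>v0 \<in> H_per L (m1/2). \<forall>v.
              H_norm L (m1/2) (\<lambda>x. v0 x - u0 x) < \<delta> \<and> global_solution \<theta> m1 L v0 v \<longrightarrow>
              (\<forall>t\<in>{0..T}. H_norm L (m1/2) (\<lambda>x. v t x - u t x) < \<epsilon>))))"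

definition conserved ::
    "(real \<Rightarrow> real) \<Rightarrow> real \<Rightarrow> real \<Rightarrow> ((real \<Rightarrow> real) \<Rightarrow> real) \<Rightarrow> bool" where
  "conserved \<theta> m1 L J \<longleftrightarrow>
     (\<forall>u0 \<in> H_per L (m1/2). \<forall>u. global_solution \<theta> m1 L u0 u \<longrightarrow> (\<forall>t\<ge>0. J (u t) = J u0))"

definition P_fun :: "(real \<Rightarrow> real) \<Rightarrow> real \<Rightarrow> (real \<Rightarrow> real) \<Rightarrow> real" where
  "P_fun \<theta> L u = 1/2 * (M_pair \<theta> L u u - 1/3 * per_integral L (\<lambda>x. (u x) ^ 3))"

definition F_fun :: "(real \<Rightarrow> real) \<Rightarrow> real \<Rightarrow> (real \<Rightarrow> real) \<Rightarrow> real" where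
  "F_fun \<theta> L u = 1/2 * (M_pair \<theta> L u u + per_integral L (\<lambda>x. (u x)\<^sup>2))"

definition M_fun :: "real \<Rightarrow> (real \<Rightarrow> real) \<Rightarrow> real" where
  "M_fun L u = per_integral L u"

definition orbit_dist :: "real \<Rightarrow> real \<Rightarrow> (real \<Rightarrow> real) \<Rightarrow> (real \<Rightarrow> real) \<Rightarrow> real" where
  "orbit_dist m1 L u v = (INF y. H_norm L (m1/2) (\<lambda>x. u x - v (x + y)))"

definition orbitally_stable :: "(real \<Rightarrow> real) \<Rightarrow> real \<Rightarrow> real \<Rightarrow> (real \<Rightarrow> real) \<Rightarrow> bool" where
  "orbitally_stable \<theta> m1 L \<phi> \<longleftrightarrow>
     (\<forall>\<epsilon>>0. \<exists>\<delta>>0. \<forall>u0 \<in> H_per L (m1/2).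
        H_norm L (m1/2) (\<lambda>x. u0 x - \<phi> x) < \<delta> \<longrightarrow>
        (\<exists>u. global_solution \<theta> m1 L u0 u) \<and>
        (\<forall>u. global_solution \<theta> m1 L u0 u \<longrightarrow> (\<forall>t\<ge>0. orbit_dist m1 L (u t) \<phi> < \<epsilon>)))"

definition s_fun :: "(real \<Rightarrow> real) \<Rightarrow> real \<Rightarrow> real \<Rightarrow> real \<Rightarrow> (real \<Rightarrow> real) \<Rightarrow> real" where
  "s_fun \<theta> L \<omega>0 A0 \<phi> =
     (2 * \<omega>0 * (\<omega>0 - 1) + 2 * A0 + 1) * per_integral L \<phi> + \<omega>0 * M_pair \<theta> L \<phi> \<phi>
       + (2 * A0 * (\<omega>0 + 1) - \<omega>0 + 1) * L"

end

theory Submission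
  imports Defs "HOL-Library.Function_Algebras"
begin

text \<open>
The wave \<open>\<phi>\<close> is a critical point of the conserved quantity \<open>G = P + (\<omega>\<^sub>0 - 1) F + A\<^sub>0 M\<close>, with second
variation \<open>\<L>\<^sub>0\<close>. It would be stable if \<open>\<L>\<^sub>0\<close> were positive transversally to the orbit of translates,
but \<open>\<L>\<^sub>0\<close> has one negative direction. A second conserved quantity removes it. As \<open>\<theta>\<close> vanishes at \<open>0\<close>,
the wave equation gives
\<open>\<L>\<^sub>0 (1 + \<phi>) = - \<omega>\<^sub>0 (\<phi> + \<M>\<phi>) + (\<omega>\<^sub>0 - 1 - 2 A\<^sub>0)\<close>,
which is the derivative at \<open>\<phi>\<close> of \<open>N = - \<omega>\<^sub>0 F + (\<omega>\<^sub>0 - 1 - 2 A\<^sub>0) M\<close>, and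
\<open>\<langle>\<L>\<^sub>0 (1 + \<phi>), 1 + \<phi>\<rangle> = - s(\<phi>)\<close> (lemmas \<open>Q_\<Upsilon>\<close> and \<open>Q_\<Upsilon>_\<Upsilon>\<close>, with \<open>\<Upsilon> = 1 + \<phi>\<close>). If
\<open>s(\<phi>) > 0\<close>, then \<open>\<L>\<^sub>0\<close> is therefore positive on the tangent space of the level set of \<open>N\<close>, modulo its
kernel \<open>\<phi>'\<close>; this is linear algebra of forms with one negative direction (\<open>index_one_coercive\<close>).
Consequently \<open>G - G(\<phi>) + (2 / s(\<phi>)) (N - N(\<phi>))\<^sup>2\<close> is a conserved quantity that near the orbit is bounded
below by a multiple of the squared distance to it (\<open>lyapunov\<close>). Applied at the nearest translate of
the wave, where the difference to the wave is orthogonal to \<open>\<phi>'\<close> (\<open>nearest_translate\<close>), this bound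
keeps solutions close to the orbit (\<open>stability\<close>).

The abstract argument needs \<open>\<L>\<^sub>0\<close> to be coercive off its negative eigenvector and its kernel, while the
hypotheses speak of eigenvalues only. The link is a variational principle: the infimum of the form
of \<open>\<L>\<^sub>0\<close> over the unit vectors orthogonal to finitely many eigenfunctions is attained, at another
eigenfunction (\<open>variational_eigenfunction\<close>). It also shows that \<open>\<omega>\<^sub>0 > 0\<close>, since otherwise \<open>\<L>\<^sub>0\<close> would
have infinitely many negative eigenvalues (\<open>\<omega>_pos\<close>).

All function spaces are described by Fourier coefficients, so the foundation is the \<open>L\<^sup>2\<close> theory of
Fourier series: completeness of the exponentials (\<open>fourier_unique\<close>), the theorem of Riesz and Fischer,
and Parseval's identity. Two facts about functions rather than coefficients enter. The wave is
bounded, because it has a square integrable derivative (\<open>weak_deriv_bounded\<close>); and the energy space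
\<open>H\<^sup>s\<close>, with \<open>s = m / 2 > 1 / 6\<close>, embeds into \<open>L\<^sup>3\<close> (\<open>sobolev_L3\<close>), so that the cubic term of \<open>P\<close> is of
third order in the energy norm.
\<close>

section \<open>Symmetric forms with one negative direction\<close>

text \<open>Functions form a real vector space pointwise, so that the spaces below are subspaces of it and
functions can be added and scaled without displaying their arguments.\<close>

instantiation "fun" :: (type, scaleR) scaleR
begin
definition scaleR_fun_def: "c *\<^sub>R f = (\<lambda>x. c *\<^sub>R f x)"
instance ..
end

lemma scaleR_fun_apply [simp]: "(c *\<^sub>R f) x = c *\<^sub>R f x"
  by (simp add: scaleR_fun_def)

instance "fun" :: (type, real_vector) real_vector
  by standard (simp_all add: fun_eq_iff scaleR_add_right scaleR_add_left)

lemma sum_fun_apply: "(\<Sum>i\<in>F. f i) x = (\<Sum>i\<in>F. f i (x::'b) :: 'c::comm_monoid_add)"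
  by (induction F rule: infinite_finite_induct) auto

text \<open>The quadratic functionals below come from forms that are bilinear only on some function space,
on which the defining integrals and series converge; hence the explicit carrier.\<close>

locale form =
  fixes X :: "'a::real_vector set" and Q :: "'a \<Rightarrow> 'a \<Rightarrow> real"
  assumes subspace: "subspace X"
    and sym: "u \<in> X \<Longrightarrow> v \<in> X \<Longrightarrow> Q u v = Q v u"
    and add_left: "u \<in> X \<Longrightarrow> v \<in> X \<Longrightarrow> w \<in> X \<Longrightarrow> Q (u + v) w = Q u w + Q v w"
    and scale_left: "u \<in> X \<Longrightarrow> w \<in> X \<Longrightarrow> Q (c *\<^sub>R u) w = c * Q u w"
begin

lemma closed [intro, simp]:
  "0 \<in> X" "u \<in> X \<Longrightarrow> v \<in> X \<Longrightarrow> u + v \<in> X" "u \<in> X \<Longrightarrow> v \<in> X \<Longrightarrow> u - v \<in> X"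
  "u \<in> X \<Longrightarrow> c *\<^sub>R u \<in> X" "u \<in> X \<Longrightarrow> - u \<in> X"
  using subspace by (auto simp: subspace_add subspace_0 subspace_diff subspace_scale subspace_neg)

lemma add_right: "u \<in> X \<Longrightarrow> v \<in> X \<Longrightarrow> w \<in> X \<Longrightarrow> Q w (u + v) = Q w u + Q w v"
  by (metis add_left closed(2) sym)

lemma scale_right: "u \<in> X \<Longrightarrow> w \<in> X \<Longrightarrow> Q w (c *\<^sub>R u) = c * Q w u"
  by (metis scale_left closed(4) sym)

lemma minus_left: "u \<in> X \<Longrightarrow> w \<in> X \<Longrightarrow> Q (- u) w = - Q u w"
  using scale_left[of u w "-1"] by simp

lemma minus_right: "u \<in> X \<Longrightarrow> w \<in> X \<Longrightarrow> Q w (- u) = - Q w u"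
  using scale_right[of u w "-1"] by simp

lemma diff_left: "u \<in> X \<Longrightarrow> v \<in> X \<Longrightarrow> w \<in> X \<Longrightarrow> Q (u - v) w = Q u w - Q v w"
  using add_left[of u "-v" w] by (simp add: minus_left)

lemma diff_right: "u \<in> X \<Longrightarrow> v \<in> X \<Longrightarrow> w \<in> X \<Longrightarrow> Q w (u - v) = Q w u - Q w v"
  using add_right[of u "-v" w] by (simp add: minus_right)

lemma zero_left [simp]: "w \<in> X \<Longrightarrow> Q 0 w = 0"
  using scale_left[of 0 w 0] by simp

lemmas bilin = add_left add_right scale_left scale_right diff_left diff_right minus_left minus_right

lemma sum_closed: "(\<And>i. i \<in> F \<Longrightarrow> e i \<in> X) \<Longrightarrow> (\<Sum>i\<in>F. c i *\<^sub>R e i) \<in> X"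
  using subspace by (simp add: subspace_sum subspace_scale)

lemma sum_left:
  assumes "w \<in> X" "\<And>i. i \<in> F \<Longrightarrow> e i \<in> X"
  shows "Q (\<Sum>i\<in>F. c i *\<^sub>R e i) w = (\<Sum>i\<in>F. c i * Q (e i) w)"
  using assms(2)
proof (induction F rule: infinite_finite_induct)
  case (insert x F)
  moreover have "(\<Sum>i\<in>F. c i *\<^sub>R e i) \<in> X"
    using insert by (intro sum_closed) auto
  ultimately show ?case using assms(1) by (simp add: bilin)
qed (use assms(1) in auto)

lemma sum_right:
  assumes "w \<in> X" "\<And>i. i \<in> F \<Longrightarrow> e i \<in> X"
  shows "Q w (\<Sum>i\<in>F. c i *\<^sub>R e i) = (\<Sum>i\<in>F. c i * Q w (e i))"
proof -
  have "Q w (\<Sum>i\<in>F. c i *\<^sub>R e i) = Q (\<Sum>i\<in>F. c i *\<^sub>R e i) w"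
    using assms sum_closed sym by blast
  also have "\<dots> = (\<Sum>i\<in>F. c i * Q (e i) w)" using sum_left assms by blast
  finally show ?thesis using assms sym by simp
qed

lemma quad_add: "u \<in> X \<Longrightarrow> v \<in> X \<Longrightarrow> Q (u + v) (u + v) = Q u u + 2 * Q u v + Q v v"
  by (simp add: bilin sym)

lemma quad_diff: "u \<in> X \<Longrightarrow> v \<in> X \<Longrightarrow> Q (u - v) (u - v) = Q u u - 2 * Q u v + Q v v"
  by (simp add: bilin sym)

lemma quad_scale: "u \<in> X \<Longrightarrow> Q (c *\<^sub>R u) (c *\<^sub>R u) = c\<^sup>2 * Q u u"
  by (simp add: bilin power2_eq_square)

lemma restrict: "subspace Y \<Longrightarrow> Y \<subseteq> X \<Longrightarrow> form Y Q"
  by unfold_locales (auto simp: bilin sym subset_iff)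

lemma subspace_orth: "e \<in> X \<Longrightarrow> subspace {v \<in> X. Q v e = 0}"
  unfolding subspace_def using bilin by auto

end

lemma form_combine:
  assumes "form X Q" "form X R"
  shows "form X (\<lambda>u v. a * Q u v + b * R u v)"
proof -
  interpret Q: form X Q by fact
  interpret R: form X R by fact
  show ?thesis
    by unfold_locales (auto simp: Q.bilin R.bilin Q.subspace Q.sym R.sym algebra_simps)
qed

locale psd_form = form +
  assumes nonneg: "u \<in> X \<Longrightarrow> 0 \<le> Q u u"
begin

lemma cauchy_schwarz:
  assumes u: "u \<in> X" and v: "v \<in> X"
  shows "(Q u v)\<^sup>2 \<le> Q u u * Q v v"
proof -
  have q: "0 \<le> Q u u + 2 * t * Q u v + t\<^sup>2 * Q v v" for t
    using nonneg[of "u + t *\<^sub>R v"] u v quad_add[of u "t *\<^sub>R v"] quad_scale[of v t]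
      scale_right[of v u t] by simp
  show ?thesis
  proof (cases "Q v v = 0")
    case True
    have "Q u v = 0"
    proof (rule ccontr)
      assume n: "Q u v \<noteq> 0"
      show False
        using q[of "- (Q u u + 1) / (2 * Q u v)"] n True by (simp add: field_simps)
    qed
    then show ?thesis by (simp add: True)
  next
    case False
    then have p: "Q v v > 0" using nonneg[OF v] by simp
    have "0 \<le> Q v v * (Q u u + 2 * (- Q u v / Q v v) * Q u v + (- Q u v / Q v v)\<^sup>2 * Q v v)"
      using p q[of "- Q u v / Q v v"] by simp
    also have "\<dots> = Q u u * Q v v - (Q u v)\<^sup>2"
      using p by (simp add: field_simps power2_eq_square)
    finally show ?thesis by simp
  qed
qed

lemma abs_le: "u \<in> X \<Longrightarrow> v \<in> X \<Longrightarrow> \<bar>Q u v\<bar> \<le> sqrt (Q u u) * sqrt (Q v v)"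
  using cauchy_schwarz[of u v] by (metis real_sqrt_abs real_sqrt_le_iff real_sqrt_mult)

lemma null_vector: "u \<in> X \<Longrightarrow> v \<in> X \<Longrightarrow> Q u u = 0 \<Longrightarrow> Q u v = 0"
  using cauchy_schwarz[of u v] by simp

lemma triangle:
  assumes "u \<in> X" "v \<in> X"
  shows "sqrt (Q (u + v) (u + v)) \<le> sqrt (Q u u) + sqrt (Q v v)"
proof (rule real_le_lsqrt)
  have "Q (u + v) (u + v) \<le> Q u u + 2 * (sqrt (Q u u) * sqrt (Q v v)) + Q v v"
    using abs_le[OF assms] assms by (simp add: quad_add)
  also have "\<dots> = (sqrt (Q u u) + sqrt (Q v v))\<^sup>2"
    using assms nonneg by (simp add: power2_sum)
  finally show "Q (u + v) (u + v) \<le> (sqrt (Q u u) + sqrt (Q v v))\<^sup>2" .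
qed (use assms nonneg in auto)

end

text \<open>A form with one negative direction \<open>\<eta>\<close> and kernel \<open>\<psi>\<close> is positive on the \<open>Q\<close>-orthogonal complement
of any vector \<open>\<Upsilon>\<close> with \<open>Q \<Upsilon> \<Upsilon> < 0\<close>. Indeed let \<open>p\<close> and \<open>r\<close> be the components of \<open>\<Upsilon>\<close> and of a vector
\<open>x\<close> with \<open>Q \<Upsilon> x = 0\<close> in the positive subspace. Then \<open>Q \<Upsilon> x = 0\<close> expresses the product of the two
\<open>\<eta>\<close>-components as \<open>Q p r\<close>, and the Cauchy-Schwarz inequality for \<open>Q\<close> bounds the negative part of
\<open>Q x x\<close> by a multiple of \<open>Q r r\<close> whose factor is less than one because \<open>Q \<Upsilon> \<Upsilon> < 0\<close>. A vector that is
not \<open>Q\<close>-orthogonal to \<open>\<Upsilon>\<close> is reduced to this case by subtracting a multiple of \<open>\<Upsilon>\<close>; the square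
\<open>(Q \<Upsilon> v)\<^sup>2\<close> pays for it.

The kernel is excluded by orthogonality in the form \<open>N\<close> in which the conclusion is measured, rather
than in \<open>ip\<close>: that is the condition satisfied by the difference to the nearest translate.\<close>

theorem index_one_coercive:
  assumes Q: "form X Q" and ip: "form X ip" and N: "psd_form X N"
    and mem: "\<eta> \<in> X" "\<psi> \<in> X" "\<Upsilon> \<in> X"
    and on: "ip \<eta> \<eta> = 1" "ip \<psi> \<psi> = 1" "ip \<eta> \<psi> = 0"
    and \<nu>: "\<nu> > 0" and eig\<eta>: "\<And>v. v \<in> X \<Longrightarrow> Q \<eta> v = - \<nu> * ip \<eta> v"
    and eig\<psi>: "\<And>v. v \<in> X \<Longrightarrow> Q \<psi> v = 0"
    and \<kappa>: "\<kappa> > 0"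
    and coer: "\<And>r. r \<in> X \<Longrightarrow> ip r \<eta> = 0 \<Longrightarrow> ip r \<psi> = 0 \<Longrightarrow> Q r r \<ge> \<kappa> * N r r"
    and s: "s > 0" "Q \<Upsilon> \<Upsilon> = - s"
  shows "\<exists>c>0. \<forall>v\<in>X. N v \<psi> = 0 \<longrightarrow> Q v v + 2 / s * (Q \<Upsilon> v)\<^sup>2 \<ge> c * N v v"
proof -
  interpret Q: form X Q by fact
  interpret ip: form X ip by fact
  interpret N: psd_form X N by fact
  define Z where "Z = {v \<in> X. ip v \<eta> = 0} \<inter> {v \<in> X. ip v \<psi> = 0}"
  have subZ: "subspace Z" unfolding Z_def
    using mem ip.subspace_orth by (intro subspace_inter) auto
  have ZX: "Z \<subseteq> X" by (auto simp: Z_def)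
  interpret QZ: psd_form Z Q
  proof -
    interpret form Z Q using subZ ZX by (rule Q.restrict)
    show "psd_form Z Q"
    proof
      fix u assume "u \<in> Z"
      then have "\<kappa> * N u u \<le> Q u u" "u \<in> X" using coer by (auto simp: Z_def)
      then show "0 \<le> Q u u" using N.nonneg[of u] \<kappa> by (smt (verit) mult_nonneg_nonneg)
    qed
  qed
  define pr where "pr u = u - ip u \<eta> *\<^sub>R \<eta> - ip u \<psi> *\<^sub>R \<psi>" for u
  have on': "ip \<psi> \<eta> = 0" using on mem ip.sym by metis
  have prZ: "pr u \<in> Z" if "u \<in> X" for u
    using that mem on on' by (auto simp: pr_def Z_def ip.bilin)
  have dec: "u = ip u \<eta> *\<^sub>R \<eta> + ip u \<psi> *\<^sub>R \<psi> + pr u" for u by (simp add: pr_def)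
  have Qdec: "Q u v = - \<nu> * ip u \<eta> * ip v \<eta> + Q (pr u) (pr v)" if uv: "u \<in> X" "v \<in> X" for u v
  proof -
    have a: "Q x \<eta> = - \<nu> * ip x \<eta>" "Q x \<psi> = 0" if "x \<in> X" for x
      using that eig\<eta> eig\<psi> mem Q.sym ip.sym by metis+
    have pu: "pr u \<in> X" "ip (pr u) \<eta> = 0" using prZ[OF uv(1)] by (auto simp: Z_def)
    have "Q (pr u) (pr v) = Q (pr u) v"
      using uv mem pu unfolding pr_def[of v] by (simp add: Q.bilin a)
    also have "\<dots> = Q u v + \<nu> * ip u \<eta> * ip v \<eta>"
      using uv mem ip.sym[OF mem(1) uv(2)] unfolding pr_def
      by (simp add: Q.bilin eig\<eta> eig\<psi>)
    finally have "Q (pr u) (pr v) = Q u v + \<nu> * ip u \<eta> * ip v \<eta>" .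
    then show ?thesis by simp
  qed
  define \<alpha> where "\<alpha> = ip \<Upsilon> \<eta>"
  define p where "p = pr \<Upsilon>"
  define A where "A = \<nu> * \<alpha>\<^sup>2"
  have pZ: "p \<in> Z" using prZ mem by (simp add: p_def)
  have Qp: "Q p p = A - s" using Qdec[OF mem(3) mem(3)] s
    by (simp add: p_def A_def \<alpha>_def power2_eq_square)
  have As: "A \<ge> s" using QZ.nonneg[OF pZ] Qp by simp
  have A0: "A > 0" using As s by simp
  define C where "C = 3 * ((N \<eta> \<eta> / \<nu> + 1 / \<kappa>) * (A / s) + N \<Upsilon> \<Upsilon> / s) + 1"
  have nn: "0 \<le> N \<eta> \<eta>" "0 \<le> N \<Upsilon> \<Upsilon>" using N.nonneg mem by auto
  have "C \<ge> 1" unfolding C_def using nn \<nu> \<kappa> A0 s by simp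
  have main: "N v v \<le> C * (Q v v + 2 / s * (Q \<Upsilon> v)\<^sup>2)" if v: "v \<in> X" "N v \<psi> = 0" for v
  proof -
    define a where "a = - Q \<Upsilon> v / s"
    define w where "w = v - a *\<^sub>R \<Upsilon>"
    have wX: "w \<in> X" using v mem by (simp add: w_def)
    have Q\<Upsilon>w: "Q \<Upsilon> w = 0" using v mem s by (simp add: w_def Q.bilin a_def)
    have vw: "v = w + a *\<^sub>R \<Upsilon>" by (simp add: w_def)
    have "Q v v = Q w w + a\<^sup>2 * Q \<Upsilon> \<Upsilon>"
      unfolding vw using wX mem Q\<Upsilon>w Q.quad_add[of w "a *\<^sub>R \<Upsilon>"] Q.quad_scale[of \<Upsilon> a]
        Q.scale_right[of \<Upsilon> w a] Q.sym[of w \<Upsilon>] by simp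
    moreover have "2 / s * (Q \<Upsilon> v)\<^sup>2 = 2 * a\<^sup>2 * s"
      using s by (simp add: a_def power2_eq_square)
    ultimately have lhs: "Q v v + 2 / s * (Q \<Upsilon> v)\<^sup>2 = Q w w + a\<^sup>2 * s" using s by simp
    define \<gamma> where "\<gamma> = ip w \<eta>"
    define r where "r = pr w"
    have rZ: "r \<in> Z" using prZ wX by (simp add: r_def)
    then have rX: "r \<in> X" and r0: "ip r \<eta> = 0" "ip r \<psi> = 0" by (auto simp: Z_def)
    have Qww: "Q w w = - \<nu> * \<gamma>\<^sup>2 + Q r r" using Qdec[OF wX wX]
      by (simp add: \<gamma>_def r_def power2_eq_square)
    have "Q p r = \<nu> * \<alpha> * \<gamma>" using Qdec[OF mem(3) wX] Q\<Upsilon>w by (simp add: p_def r_def \<alpha>_def \<gamma>_def)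
    then have "(\<nu> * \<alpha> * \<gamma>)\<^sup>2 \<le> (A - s) * Q r r"
      using QZ.cauchy_schwarz[OF pZ rZ] Qp by simp
    then have "A * (\<nu> * \<gamma>\<^sup>2) \<le> (A - s) * Q r r"
      by (simp add: A_def power2_eq_square ac_simps)
    then have "A * (Q r r - Q w w) \<le> (A - s) * Q r r" by (simp add: Qww)
    then have "s * Q r r \<le> A * Q w w" by (simp add: algebra_simps)
    then have Qr: "Q r r \<le> A / s * Q w w" using s by (simp add: field_simps)
    have Qr0: "0 \<le> Q r r" using QZ.nonneg[OF rZ] .
    have "0 \<le> A / s * Q w w" using Qr Qr0 by linarith
    then have Qw0: "0 \<le> Q w w" using A0 s by (simp add: zero_le_mult_iff field_simps)
    then have "\<nu> * \<gamma>\<^sup>2 \<le> Q r r" using Qww by simp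
    then have \<gamma>: "\<gamma>\<^sup>2 \<le> Q r r / \<nu>" using \<nu> by (simp add: field_simps)
    have Nr: "N r r \<le> Q r r / \<kappa>" using coer[OF rX r0] \<kappa> by (simp add: field_simps)
    define b where "b = ip w \<psi>"
    define x where "x = \<gamma> *\<^sub>R \<eta> + r"
    have xX: "x \<in> X" using rX mem by (simp add: x_def)
    have vb: "v - b *\<^sub>R \<psi> = x + a *\<^sub>R \<Upsilon>"
      unfolding vw x_def using dec[of w] by (simp add: \<gamma>_def b_def r_def algebra_simps)
    have "N v v \<le> N (v - b *\<^sub>R \<psi>) (v - b *\<^sub>R \<psi>)"
      using v mem N.nonneg[of "b *\<^sub>R \<psi>"] by (simp add: N.quad_diff N.scale_right)
    also have "\<dots> \<le> 3 * (\<gamma>\<^sup>2 * N \<eta> \<eta> + N r r + a\<^sup>2 * N \<Upsilon> \<Upsilon>)"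
    proof -
      have "N (\<gamma> *\<^sub>R \<eta> - r) (\<gamma> *\<^sub>R \<eta> - r) \<ge> 0" "N (\<gamma> *\<^sub>R \<eta> - a *\<^sub>R \<Upsilon>) (\<gamma> *\<^sub>R \<eta> - a *\<^sub>R \<Upsilon>) \<ge> 0"
        "N (r - a *\<^sub>R \<Upsilon>) (r - a *\<^sub>R \<Upsilon>) \<ge> 0"
        using rX mem by (intro N.nonneg; simp)+
      then show ?thesis unfolding vb x_def using rX mem N.sym[of r \<eta>] N.sym[of \<Upsilon> \<eta>] N.sym[of \<Upsilon> r]
        by (simp add: N.bilin power2_eq_square algebra_simps)
    qed
    also have "\<dots> \<le> 3 * (Q r r / \<nu> * N \<eta> \<eta> + Q r r / \<kappa> + a\<^sup>2 * N \<Upsilon> \<Upsilon>)"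
      using mult_right_mono[OF \<gamma> nn(1)] Nr by simp
    also have "\<dots> = 3 * ((N \<eta> \<eta> / \<nu> + 1 / \<kappa>) * Q r r + N \<Upsilon> \<Upsilon> / s * (a\<^sup>2 * s))"
      using s \<nu> \<kappa> by (simp add: field_simps)
    also have "\<dots> \<le> 3 * ((N \<eta> \<eta> / \<nu> + 1 / \<kappa>) * (A / s * Q w w) + N \<Upsilon> \<Upsilon> / s * (a\<^sup>2 * s))"
      using Qr nn \<nu> \<kappa> s by (intro mult_left_mono add_mono) auto
    also have "\<dots> \<le> C * (Q w w + a\<^sup>2 * s)"
    proof -
      define D where "D = (N \<eta> \<eta> / \<nu> + 1 / \<kappa>) * (A / s)"
      define E where "E = N \<Upsilon> \<Upsilon> / s"
      have "D \<ge> 0" "E \<ge> 0" unfolding D_def E_def using nn \<nu> \<kappa> A0 s by auto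
      moreover have "a\<^sup>2 * s \<ge> 0" using s by simp
      ultimately have "3 * (D * Q w w + E * (a\<^sup>2 * s)) \<le> (3 * (D + E) + 1) * (Q w w + a\<^sup>2 * s)"
        using Qw0 by (simp add: algebra_simps)
      then show ?thesis by (simp add: C_def D_def E_def mult.assoc)
    qed
    finally show ?thesis using lhs by simp
  qed
  show ?thesis
  proof (intro exI[of _ "1 / C"] conjI ballI impI)
    show "1 / C > 0" using \<open>C \<ge> 1\<close> by simp
    fix v assume "v \<in> X" "N v \<psi> = 0"
    from main[OF this] \<open>C \<ge> 1\<close> show "1 / C * N v v \<le> Q v v + 2 / s * (Q \<Upsilon> v)\<^sup>2"
      by (simp add: field_simps)
  qed
qed

section \<open>Square integrable periodic functions\<close>

lemma integrable_fatou:
  fixes f :: "nat \<Rightarrow> 'a \<Rightarrow> real"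
  assumes f: "\<And>n. integrable M (f n)" "\<And>n x. 0 \<le> f n x" "\<And>n. n \<ge> N \<Longrightarrow> integral\<^sup>L M (f n) \<le> C"
    and g: "g \<in> borel_measurable M" and lim: "AE x in M. (\<lambda>n. f n x) \<longlonglongrightarrow> g x"
  shows "integrable M g \<and> integral\<^sup>L M g \<le> C"
proof -
  note [measurable] = g borel_measurable_integrable[OF f(1)]
  have C: "0 \<le> C" using f(3)[of N] f(2) by (smt (verit) integral_nonneg_AE AE_I2 order_refl)
  have gn: "AE x in M. 0 \<le> g x"
    using lim by eventually_elim (rule LIMSEQ_le_const, auto simp: f(2))
  have "(\<integral>\<^sup>+x. ennreal (g x) \<partial>M) = (\<integral>\<^sup>+x. liminf (\<lambda>n. ennreal (f (n + N) x)) \<partial>M)"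
  proof (rule nn_integral_cong_AE, use lim in eventually_elim)
    fix x assume "(\<lambda>n. f n x) \<longlonglongrightarrow> g x"
    then have "(\<lambda>n. f (n + N) x) \<longlonglongrightarrow> g x" by (rule LIMSEQ_ignore_initial_segment)
    then have "(\<lambda>n. ennreal (f (n + N) x)) \<longlonglongrightarrow> ennreal (g x)" by (rule tendsto_ennrealI)
    then show "ennreal (g x) = liminf (\<lambda>n. ennreal (f (n + N) x))"
      by (simp add: lim_imp_Liminf)
  qed
  also have "\<dots> \<le> liminf (\<lambda>n. \<integral>\<^sup>+x. ennreal (f (n + N) x) \<partial>M)"
    by (rule nn_integral_liminf) auto
  also have "\<dots> \<le> liminf (\<lambda>n. ennreal C)"
  proof (intro Liminf_mono always_eventually allI)
    fix n
    show "(\<integral>\<^sup>+x. ennreal (f (n + N) x) \<partial>M) \<le> ennreal C"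
      using f(3)[of "n + N"] by (subst nn_integral_eq_integral) (auto simp: f intro: ennreal_leI)
  qed
  finally have le: "(\<integral>\<^sup>+x. ennreal (g x) \<partial>M) \<le> ennreal C" by (simp add: Liminf_const)
  have int: "integrable M g"
    by (rule integrableI_nonneg[OF g gn]) (use le in \<open>auto simp: less_top[symmetric] top_unique\<close>)
  have "ennreal (integral\<^sup>L M g) \<le> ennreal C"
    using le nn_integral_eq_integral[OF int gn] by simp
  then show ?thesis using int C by (simp add: ennreal_le_iff)
qed

text \<open>Integrals over one period are taken with respect to Lebesgue measure restricted to it, so that the
theory of finite measure spaces applies.\<close>

locale period =
  fixes L :: real
  assumes L_pos: "0 < L"
begin

abbreviation MP :: "real measure" where "MP \<equiv> restrict_space lborel {0..L}"

lemma per_integral_eq: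
  fixes f :: "real \<Rightarrow> 'a::{banach, second_countable_topology}"
  shows "set_lebesgue_integral lborel {0..L} f = integral\<^sup>L MP f"
  by (simp add: set_lebesgue_integral_def integral_restrict_space)

lemma set_integrable_eq:
  fixes f :: "real \<Rightarrow> 'a::{banach, second_countable_topology}"
  shows "set_integrable lborel {0..L} f \<longleftrightarrow> integrable MP f"
  by (simp add: set_integrable_def integrable_restrict_space)

lemma space_MP [simp]: "space MP = {0..L}" by (simp add: space_restrict_space)

sublocale MP: finite_measure MP
  using L_pos by (intro finite_measureI) (simp add: emeasure_restrict_space)

lemma measure_MP [simp]: "measure MP {0..L} = L"
  using L_pos by (simp add: measure_restrict_space)

lemma measurable_MP [measurable_dest]: "f \<in> borel_measurable borel \<Longrightarrow> f \<in> borel_measurable MP"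
  by (rule measurable_restrict_space1) simp

lemma L2_per_iff:
  "g \<in> L2_per L \<longleftrightarrow> periodic L g \<and> g \<in> borel_measurable borel \<and> integrable MP (\<lambda>x. (g x)\<^sup>2)"
  by (simp add: L2_per_def set_integrable_eq)

lemma L2_perD:
  assumes "g \<in> L2_per L"
  shows "g \<in> borel_measurable borel" "integrable MP (\<lambda>x. (g x)\<^sup>2)" "g (x + L) = g x"
  using assms by (auto simp: L2_per_iff periodic_def)

lemma integrable_mult_L2:
  assumes "u \<in> L2_per L" "v \<in> L2_per L"
  shows "integrable MP (\<lambda>x. u x * v x)"
proof (rule Bochner_Integration.integrable_bound)
  show "integrable MP (\<lambda>x. (u x)\<^sup>2 + (v x)\<^sup>2)" using assms by (auto dest: L2_perD)
  have [measurable]: "u \<in> borel_measurable borel" "v \<in> borel_measurable borel"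
    using assms by (auto dest: L2_perD)
  show "(\<lambda>x. u x * v x) \<in> borel_measurable MP" by measurable
  show "AE x in MP. norm (u x * v x) \<le> norm ((u x)\<^sup>2 + (v x)\<^sup>2)"
  proof (rule AE_I2)
    fix x
    have "0 \<le> (\<bar>u x\<bar> - \<bar>v x\<bar>)\<^sup>2" by simp
    then have "2 * (\<bar>u x\<bar> * \<bar>v x\<bar>) \<le> (u x)\<^sup>2 + (v x)\<^sup>2" by (simp add: power2_diff)
    moreover have "0 \<le> \<bar>u x\<bar> * \<bar>v x\<bar>" "norm (u x * v x) = \<bar>u x\<bar> * \<bar>v x\<bar>"
      "norm ((u x)\<^sup>2 + (v x)\<^sup>2) = (u x)\<^sup>2 + (v x)\<^sup>2"
      by (simp_all add: abs_mult)
    ultimately show "norm (u x * v x) \<le> norm ((u x)\<^sup>2 + (v x)\<^sup>2)" by linarith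
  qed
qed

lemma const_L2: "(\<lambda>x. c) \<in> L2_per L"
  by (simp add: L2_per_iff periodic_def)

lemma integrable_L2: "u \<in> L2_per L \<Longrightarrow> integrable MP u"
  using integrable_mult_L2[OF _ const_L2[of 1], of u] by simp

lemma subspace_L2: "subspace (L2_per L)"
  unfolding subspace_def
proof (intro conjI ballI allI)
  show "0 \<in> L2_per L" using const_L2[of 0] by (simp add: zero_fun_def)
next
  fix u v assume uv: "u \<in> L2_per L" "v \<in> L2_per L"
  then have [measurable]: "u \<in> borel_measurable borel" "v \<in> borel_measurable borel"
    by (auto dest: L2_perD)
  have "integrable MP (\<lambda>x. (u x)\<^sup>2 + 2 * (u x * v x) + (v x)\<^sup>2)"
    using uv integrable_mult_L2[OF uv] by (simp add: L2_perD)
  moreover have "u + v \<in> borel_measurable borel" unfolding plus_fun_def by measurable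
  ultimately show "u + v \<in> L2_per L"
    using uv by (simp add: L2_per_iff periodic_def power2_sum mult.assoc algebra_simps)
next
  fix c u assume u: "u \<in> L2_per L"
  then have [measurable]: "u \<in> borel_measurable borel" by (auto dest: L2_perD)
  have "c *\<^sub>R u \<in> borel_measurable borel" unfolding scaleR_fun_def by measurable
  then show "c *\<^sub>R u \<in> L2_per L"
    using u by (auto simp: L2_per_iff periodic_def power_mult_distrib)
qed

lemma L2_closed [intro, simp]:
  "u \<in> L2_per L \<Longrightarrow> v \<in> L2_per L \<Longrightarrow> u + v \<in> L2_per L"
  "u \<in> L2_per L \<Longrightarrow> v \<in> L2_per L \<Longrightarrow> u - v \<in> L2_per L"
  "u \<in> L2_per L \<Longrightarrow> c *\<^sub>R u \<in> L2_per L" "0 \<in> L2_per L"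
  using subspace_L2 by (auto simp: subspace_add subspace_0 subspace_diff subspace_scale)

definition ip :: "(real \<Rightarrow> real) \<Rightarrow> (real \<Rightarrow> real) \<Rightarrow> real" where
  "ip u v = (\<integral>x. u x * v x \<partial>MP)"

sublocale ip: psd_form "L2_per L" ip
proof
  show "subspace (L2_per L)" by (rule subspace_L2)
  fix u v w assume *: "u \<in> L2_per L" "v \<in> L2_per L" "w \<in> L2_per L"
  show "ip (u + v) w = ip u w + ip v w"
    using * by (simp add: ip_def distrib_right integrable_mult_L2)
next
  fix u show "0 \<le> ip u u" unfolding ip_def by (intro integral_nonneg_AE AE_I2) simp
qed (simp_all add: ip_def mult.commute mult.assoc mult.left_commute)

lemma periodic_int:
  assumes "\<And>x. f (x + L) = f x"
  shows "f (x + of_int n * L) = f x"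
proof (induction n arbitrary: x rule: int_induct[where k = 0])
  case (step1 i) then show ?case using assms[of "x + of_int i * L"] by (simp add: algebra_simps)
next
  case (step2 i) then show ?case using assms[of "x + of_int (i - 1) * L"] by (simp add: algebra_simps)
qed simp

text \<open>Periodic statements need to be checked over one period only, since the line is covered by
countably many translates of it.\<close>

lemma AE_periodic:
  assumes per: "\<And>x. P (x + L) = P x" and ae: "AE x in MP. P x"
  shows "AE x in lborel. P x"
proof -
  have 0: "AE x in lborel. x \<in> {0..L} \<longrightarrow> P x"
    using ae by (simp add: AE_restrict_space_iff)
  have "AE x in lborel. (of_int n * L + x) \<in> {0..L} \<longrightarrow> P (of_int n * L + x)" for n :: int
    by (rule AE_distrD[of "(+) (of_int n * L)" lborel borel]) (simp, subst lborel_distr_plus, rule 0)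
  then have "AE x in lborel. \<forall>n::int. (of_int n * L + x) \<in> {0..L} \<longrightarrow> P (of_int n * L + x)"
    by (simp add: AE_all_countable)
  then show ?thesis
  proof eventually_elim
    case (elim x)
    define n where "n = - \<lfloor>x / L\<rfloor>"
    have "of_int n * L + x \<in> {0..L}"
      using L_pos floor_divide_lower[of L x] floor_divide_upper[of L x]
      by (auto simp: n_def algebra_simps)
    then have "P (of_int n * L + x)" using elim by blast
    then show ?case using periodic_int[of P x n, OF per] by (simp add: add.commute)
  qed
qed

lemma AE_lborel_MP: "AE x in lborel. P x \<Longrightarrow> AE x in MP. P x"
  by (subst AE_restrict_space_iff) auto

lemma AE_L2_eq_iff:
  assumes "u \<in> L2_per L" "v \<in> L2_per L"
  shows "(AE x in lborel. u x = v x) \<longleftrightarrow> (AE x in MP. u x = v x)"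
proof
  show "AE x in MP. u x = v x \<Longrightarrow> AE x in lborel. u x = v x"
    by (rule AE_periodic) (simp_all add: L2_perD(3)[OF assms(1)] L2_perD(3)[OF assms(2)])
qed (rule AE_lborel_MP)

lemma ip_zero_iff: "u \<in> L2_per L \<Longrightarrow> ip u u = 0 \<longleftrightarrow> (AE x in lborel. u x = 0)"
proof -
  assume u: "u \<in> L2_per L"
  have "ip u u = 0 \<longleftrightarrow> (AE x in MP. (u x)\<^sup>2 = 0)"
    unfolding ip_def power2_eq_square[symmetric]
    by (rule integral_nonneg_eq_0_iff_AE) (use u in \<open>auto dest: L2_perD\<close>)
  then show ?thesis using AE_L2_eq_iff[OF u const_L2[of 0]] by simp
qed

lemma L1_le_L2:
  assumes "u \<in> L2_per L"
  shows "(\<integral>x. \<bar>u x\<bar> \<partial>MP) \<le> sqrt L * sqrt (ip u u)"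
proof -
  have a: "(\<lambda>x. \<bar>u x\<bar>) \<in> L2_per L" using assms by (auto simp: L2_per_iff periodic_def)
  have "ip (\<lambda>x. 1) (\<lambda>x. 1) = L" "ip (\<lambda>x. \<bar>u x\<bar>) (\<lambda>x. \<bar>u x\<bar>) = ip u u"
    by (simp_all add: ip_def)
  moreover have "ip (\<lambda>x. 1) (\<lambda>x. \<bar>u x\<bar>) = (\<integral>x. \<bar>u x\<bar> \<partial>MP)" by (simp add: ip_def)
  ultimately show ?thesis using ip.abs_le[OF const_L2[of 1] a] by simp
qed

text \<open>A rapidly converging subsequence has summable consecutive \<open>L\<^sup>1\<close> distances and so converges almost
everywhere; Fatou's lemma turns the pointwise limit into the limit in the mean. The limit is
defined by \<open>lim\<close> at every point, which makes it periodic everywhere and not just almost everywhere.\<close>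

theorem L2_complete:
  assumes f: "\<And>n. f n \<in> L2_per L"
    and cauchy: "\<And>e. e > 0 \<Longrightarrow> \<exists>N. \<forall>m\<ge>N. \<forall>n\<ge>N. ip (f m - f n) (f m - f n) < e"
  obtains g where "g \<in> L2_per L" "(\<lambda>n. ip (f n - g) (f n - g)) \<longlonglongrightarrow> 0"
proof -
  note [measurable] = L2_perD(1)[OF f]
  have "\<exists>N. \<forall>m\<ge>N. \<forall>n\<ge>N. ip (f m - f n) (f m - f n) < (1/4) ^ k" for k
    by (rule cauchy) simp
  then obtain R where R: "\<And>k m n. m \<ge> R k \<Longrightarrow> n \<ge> R k \<Longrightarrow> ip (f m - f n) (f m - f n) < (1/4) ^ k"
    by metis
  define r where "r k = (\<Sum>i\<le>k. R i) + k" for k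
  have rR: "r k \<ge> R k" for k by (simp add: r_def sum_nonneg member_le_sum trans_le_add1)
  have rmono: "r k \<le> r (Suc k)" for k by (simp add: r_def)
  have rk: "r k \<ge> k" for k by (simp add: r_def)
  define d where "d k x = \<bar>f (r (Suc k)) x - f (r k) x\<bar>" for k x
  have dint: "integrable MP (d k)" for k
    unfolding d_def using f by (intro integrable_abs Bochner_Integration.integrable_diff integrable_L2)
  have dle: "integral\<^sup>L MP (d k) \<le> sqrt L * (1/2) ^ k" for k
  proof -
    have "integral\<^sup>L MP (d k) \<le> sqrt L * sqrt (ip (f (r (Suc k)) - f (r k)) (f (r (Suc k)) - f (r k)))"
      unfolding d_def using L1_le_L2[of "f (r (Suc k)) - f (r k)"] f by simp
    also have "\<dots> \<le> sqrt L * sqrt ((1/4) ^ k)"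
      using R[of k "r (Suc k)" "r k"] rR[of k] rmono[of k] L_pos by (intro mult_left_mono real_sqrt_le_mono) auto
    also have "sqrt ((1/4) ^ k) = (1/2::real) ^ k"
      by (simp add: real_sqrt_power real_sqrt_divide)
    finally show ?thesis .
  qed
  have "(\<integral>\<^sup>+x. (\<Sum>k. ennreal (d k x)) \<partial>MP) = (\<Sum>k. \<integral>\<^sup>+x. ennreal (d k x) \<partial>MP)"
    by (rule nn_integral_suminf) (use dint in auto)
  also have "\<dots> \<le> (\<Sum>k. ennreal (sqrt L * (1/2) ^ k))"
  proof (intro suminf_le summableI)
    fix k show "(\<integral>\<^sup>+x. ennreal (d k x) \<partial>MP) \<le> ennreal (sqrt L * (1/2) ^ k)"
      by (subst nn_integral_eq_integral) (use dint dle in \<open>auto simp: d_def intro: ennreal_leI\<close>)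
  qed
  also have "\<dots> = ennreal (\<Sum>k. sqrt L * (1/2) ^ k)"
    by (rule suminf_ennreal2) (use L_pos in \<open>auto intro!: summable_mult summable_geometric\<close>)
  also have "\<dots> < \<infinity>" by simp
  finally have "AE x in MP. (\<Sum>k. ennreal (d k x)) \<noteq> \<infinity>"
    by (intro nn_integral_PInf_AE) (use dint in auto)
  then have conv: "AE x in MP. convergent (\<lambda>k. f (r k) x)"
  proof eventually_elim
    case (elim x)
    then have "summable (\<lambda>k. d k x)" by (intro summable_suminf_not_top) (auto simp: d_def)
    then have "summable (\<lambda>k. f (r (Suc k)) x - f (r k) x)"
      unfolding d_def by (rule summable_rabs_cancel)
    then have "convergent (\<lambda>n. f (r n) x - f (r 0) x)"
      unfolding summable_iff_convergent sum_lessThan_telescope[where f = "\<lambda>k. f (r k) x"] .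
    then show ?case by (simp add: convergent_diff_const_right_iff)
  qed
  define g where "g x = lim (\<lambda>k. f (r k) x)" for x
  have gm [measurable]: "g \<in> borel_measurable borel" unfolding g_def by measurable
  have gper: "periodic L g" unfolding periodic_def g_def using f by (simp add: L2_perD)
  have lim: "AE x in MP. (\<lambda>k. f (r k) x) \<longlonglongrightarrow> g x"
    using conv by eventually_elim (simp add: g_def convergent_LIMSEQ_iff)
  have key: "integrable MP (\<lambda>x. (f n x - g x)\<^sup>2) \<and> (\<integral>x. (f n x - g x)\<^sup>2 \<partial>MP) \<le> e"
    if e: "\<And>m. m \<ge> K \<Longrightarrow> ip (f n - f m) (f n - f m) \<le> e" for n K e
  proof (rule integrable_fatou[where f = "\<lambda>k x. (f n x - f (r k) x)\<^sup>2" and N = K])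
    fix k
    show "integrable MP (\<lambda>x. (f n x - f (r k) x)\<^sup>2)"
      using L2_perD(2)[OF L2_closed(2)[OF f[of n] f[of "r k"]]] by simp
    show "0 \<le> (f n x - f (r k) x)\<^sup>2" for x by simp
    assume "k \<ge> K"
    then show "(\<integral>x. (f n x - f (r k) x)\<^sup>2 \<partial>MP) \<le> e"
      using e[of "r k"] rk[of k] by (simp add: ip_def power2_eq_square)
  next
    show "AE x in MP. (\<lambda>k. (f n x - f (r k) x)\<^sup>2) \<longlonglongrightarrow> (f n x - g x)\<^sup>2"
      using lim by eventually_elim (intro tendsto_intros)
  qed measurable
  obtain N0 where N0: "\<And>m n. m \<ge> N0 \<Longrightarrow> n \<ge> N0 \<Longrightarrow> ip (f m - f n) (f m - f n) < 1"
    using cauchy[of 1] by auto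
  have "integrable MP (\<lambda>x. (f N0 x - g x)\<^sup>2)"
    using key[of N0 N0 1] N0 less_imp_le by blast
  then have "f N0 - g \<in> L2_per L"
    using f[of N0] gper by (simp add: L2_per_iff periodic_def fun_diff_def)
  then have "f N0 - (f N0 - g) \<in> L2_per L" using f by blast
  then have g: "g \<in> L2_per L" by simp
  moreover have "(\<lambda>n. ip (f n - g) (f n - g)) \<longlonglongrightarrow> 0"
  proof (rule LIMSEQ_I)
    fix e :: real assume e: "e > 0"
    obtain N where N: "\<And>m n. m \<ge> N \<Longrightarrow> n \<ge> N \<Longrightarrow> ip (f m - f n) (f m - f n) < e/2"
      using cauchy[of "e/2"] e by auto
    show "\<exists>no. \<forall>n\<ge>no. norm (ip (f n - g) (f n - g) - 0) < e"
    proof (intro exI[of _ N] allI impI)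
      fix n assume "n \<ge> N"
      then have "ip (f n - f m) (f n - f m) \<le> e/2" if "m \<ge> N" for m using N that less_imp_le by blast
      from key[OF this] have "ip (f n - g) (f n - g) \<le> e/2" by (simp add: ip_def power2_eq_square)
      then show "norm (ip (f n - g) (f n - g) - 0) < e"
        using e ip.nonneg[of "f n - g"] f g by simp
    qed
  qed
  ultimately show thesis by (rule that)
qed

end

section \<open>Fourier coefficients\<close>

lemma Re_mult_cnj_self: "Re (z * cnj z) = (norm z)\<^sup>2"
  by (simp add: cmod_power2) (simp add: power2_eq_square)

text \<open>
Coefficients are kept as complex numbers; splitting products into real and imaginary parts would
destroy the form \<open>Re (z * ek k x)\<close> of the test functions.\<close>

declare times_complex.sel [simp del]

context period
begin

abbreviation c :: "(real \<Rightarrow> real) \<Rightarrow> int \<Rightarrow> complex" where "c \<equiv> fourier_coeff L"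

definition ek :: "int \<Rightarrow> real \<Rightarrow> complex" where
  "ek k x = cis (2 * pi * of_int k * x / L)"

lemma ek_0 [simp]: "ek 0 x = 1" by (simp add: ek_def)
lemma ek_add: "ek (k + l) x = ek k x * ek l x"
  by (simp add: ek_def cis_mult add_divide_distrib algebra_simps)
lemma ek_plus: "ek k (x + y) = ek k x * ek k y"
  by (simp add: ek_def cis_mult add_divide_distrib algebra_simps)
lemma ek_cnj: "cnj (ek k x) = ek (- k) x" by (simp add: ek_def cis_cnj)
lemma norm_ek [simp]: "norm (ek k x) = 1" by (simp add: ek_def)
lemma ek_period [simp]: "ek k (x + L) = ek k x"
proof -
  have "ek k L = cis (2 * pi * of_int k)" using L_pos by (simp add: ek_def)
  also have "\<dots> = 1" by (rule cis_multiple_2pi) simp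
  finally show ?thesis by (simp add: ek_plus)
qed
lemma continuous_ek: "continuous_on S (ek k)"
  unfolding ek_def by (intro continuous_intros) (use L_pos in auto)
lemma measurable_ek [measurable]: "ek k \<in> borel_measurable borel"
  by (rule borel_measurable_continuous_onI) (rule continuous_ek)

lemma c_eq: "c u k = (\<integral>x. complex_of_real (u x) * ek (- k) x \<partial>MP) / L"
  by (simp add: fourier_coeff_def per_integral_eq ek_def)

lemma integral_ek: "(\<integral>x. ek k x \<partial>MP) = (if k = 0 then of_real L else 0)"
proof (cases "k = 0")
  case True then show ?thesis by (simp add: measure_restrict_space scaleR_conv_of_real)
next
  case False
  define w where "w = 2 * pi * of_int k / L"
  have w: "w \<noteq> 0" using False L_pos by (simp add: w_def)
  have ek: "ek k x = cis (w * x)" for x by (simp add: ek_def w_def)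
  have der: "((\<lambda>x. cis (w * x) / (\<i> * w)) has_vector_derivative ek k x) (at x within {0..L})" for x
  proof -
    have "((\<lambda>z. exp (\<i> * w * z) / (\<i> * w)) has_field_derivative exp (\<i> * w * of_real x)) (at (of_real x))"
      by (auto intro!: derivative_eq_intros simp: w)
    then have "((\<lambda>x. exp (\<i> * of_real (w * x)) / (\<i> * w)) has_vector_derivative exp (\<i> * of_real (w * x))) (at x within {0..L})"
      using has_vector_derivative_real_field by (fastforce simp: mult.assoc)
    then show ?thesis by (simp add: ek cis_conv_exp)
  qed
  have "(\<integral>x. indicator {0..L} x *\<^sub>R ek k x \<partial>lborel) = cis (w * L) / (\<i> * w) - cis (w * 0) / (\<i> * w)"
    using L_pos by (intro integral_FTC_Icc der continuous_ek) auto
  moreover have "cis (w * L) = 1" using ek_period[of k 0] by (simp add: ek)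
  ultimately have "set_lebesgue_integral lborel {0..L} (ek k) = 0"
    by (simp add: set_lebesgue_integral_def)
  then show ?thesis using False by (simp add: per_integral_eq)
qed

lemma integrable_ek:
  assumes "integrable MP (u :: real \<Rightarrow> real)"
  shows "integrable MP (\<lambda>x. complex_of_real (u x) * ek k x)"
  by (rule Bochner_Integration.integrable_bound[OF assms])
     (use assms in \<open>auto simp: norm_mult\<close>)

lemma c_add: "u \<in> L2_per L \<Longrightarrow> v \<in> L2_per L \<Longrightarrow> c (u + v) k = c u k + c v k"
  by (simp add: c_eq integrable_ek integrable_L2 add_divide_distrib distrib_right)

lemma c_scale: "c (a *\<^sub>R u) k = of_real a * c u k"
  by (simp add: c_eq mult.assoc)

lemma c_diff: "u \<in> L2_per L \<Longrightarrow> v \<in> L2_per L \<Longrightarrow> c (u - v) k = c u k - c v k"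
  by (simp add: c_eq integrable_ek integrable_L2 diff_divide_distrib left_diff_distrib)

lemma c_zero [simp]: "c 0 k = 0" by (simp add: c_eq)

lemma c_minus_index: "c u (- k) = cnj (c u k)"
proof -
  have "cnj (\<integral>x. complex_of_real (u x) * ek (- k) x \<partial>MP) = (\<integral>x. cnj (complex_of_real (u x) * ek (- k) x) \<partial>MP)"
    by (rule Bochner_Integration.integral_cnj[symmetric])
  then show ?thesis by (simp add: c_eq ek_cnj del: Bochner_Integration.integral_cnj)
qed

lemma c_cong_AE:
  assumes "u \<in> L2_per L" "v \<in> L2_per L" "AE x in lborel. u x = v x"
  shows "c u k = c v k"
proof -
  note [measurable] = L2_perD(1)[OF assms(1)] L2_perD(1)[OF assms(2)]
  have "(\<integral>x. complex_of_real (u x) * ek (- k) x \<partial>MP) = (\<integral>x. complex_of_real (v x) * ek (- k) x \<partial>MP)"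
    by (rule integral_cong_AE) (use AE_lborel_MP[OF assms(3)] in auto)
  then show ?thesis by (simp add: c_eq)
qed

lemma bounded_L2:
  assumes [measurable]: "u \<in> borel_measurable borel" and "\<And>x. u (x + L) = u x" "\<And>x. \<bar>u x\<bar> \<le> B"
  shows "u \<in> L2_per L"
proof -
  have "(u x)\<^sup>2 \<le> B\<^sup>2" for x using power_mono[OF assms(3)[of x], of 2] by simp
  then have "integrable MP (\<lambda>x. (u x)\<^sup>2)"
    by (intro MP.integrable_const_bound[where B = "B\<^sup>2"] AE_I2) auto
  then show ?thesis using assms by (simp add: L2_per_iff periodic_def)
qed

lemma norm_c_le:
  assumes "u \<in> L2_per L"
  shows "norm (c u k) \<le> sqrt (ip u u) / sqrt L"
proof -
  have "norm (\<integral>x. complex_of_real (u x) * ek (- k) x \<partial>MP) \<le> (\<integral>x. \<bar>u x\<bar> \<partial>MP)"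
    using integral_norm_bound[of MP "\<lambda>x. complex_of_real (u x) * ek (- k) x"] by (simp add: norm_mult)
  also have "\<dots> \<le> sqrt L * sqrt (ip u u)" by (rule L1_le_L2[OF assms])
  finally have "norm (c u k) \<le> (sqrt L * sqrt (ip u u)) / L"
    using L_pos by (simp add: c_eq norm_divide divide_right_mono)
  also have "\<dots> = sqrt (ip u u) / sqrt L"
    using sqrt_divide_self_eq[of L] L_pos
    by (metis divide_inverse less_imp_le mult.commute times_divide_eq_left)
  finally show ?thesis .
qed

text \<open>Taking real parts mode by mode makes \<open>tp a F\<close> real for arbitrary coefficients; for Hermitian
coefficients on a symmetric set of modes it is the usual partial sum.\<close>

definition tp :: "(int \<Rightarrow> complex) \<Rightarrow> int set \<Rightarrow> real \<Rightarrow> real" where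
  "tp a F x = (\<Sum>k\<in>F. Re (a k * ek k x))"

lemma tp_continuous: "continuous_on S (tp a F)"
  unfolding tp_def by (intro continuous_intros continuous_ek)

lemma abs_tp_le: "\<bar>tp a F x\<bar> \<le> (\<Sum>k\<in>F. norm (a k))"
proof -
  have "\<bar>Re (a k * ek k x)\<bar> \<le> norm (a k)" for k
    using abs_Re_le_cmod[of "a k * ek k x"] by (simp add: norm_mult)
  then show ?thesis unfolding tp_def by (intro order_trans[OF sum_abs] sum_mono)
qed

lemma tp_L2 [simp, intro]: "tp a F \<in> L2_per L"
  by (rule bounded_L2[OF borel_measurable_continuous_onI[OF tp_continuous] _ abs_tp_le])
     (simp add: tp_def)

lemma tp_sum: "tp a F = (\<Sum>k\<in>F. (\<lambda>x. Re (a k * ek k x)))"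
  by (simp add: fun_eq_iff tp_def sum_fun_apply)

lemma ip_tp:
  assumes v: "v \<in> L2_per L"
  shows "ip v (tp a F) = L * (\<Sum>k\<in>F. Re (a k * cnj (c v k)))"
proof -
  have int: "integrable MP (\<lambda>x. a k * (complex_of_real (v x) * ek k x))" for k
    using integrable_ek[OF integrable_L2[OF v]] by simp
  have *: "(\<integral>x. v x * Re (a k * ek k x) \<partial>MP) = L * Re (a k * cnj (c v k))" for k
  proof -
    have "(\<integral>x. v x * Re (a k * ek k x) \<partial>MP) = (\<integral>x. Re (a k * (complex_of_real (v x) * ek k x)) \<partial>MP)"
      by (rule Bochner_Integration.integral_cong) (auto simp: times_complex.sel algebra_simps)
    also have "\<dots> = Re (a k * (\<integral>x. complex_of_real (v x) * ek k x \<partial>MP))"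
      using integral_Re[OF int] by simp
    also have "(\<integral>x. complex_of_real (v x) * ek k x \<partial>MP) = of_real L * cnj (c v k)"
      using L_pos c_eq[of v "-k"] by (simp add: c_minus_index)
    finally show ?thesis by (simp add: times_complex.sel algebra_simps)
  qed
  have int': "integrable MP (\<lambda>x. v x * Re (a k * ek k x))" for k
    using integrable_Re[OF int, of k] by (simp add: times_complex.sel algebra_simps)
  show ?thesis
    unfolding ip_def tp_def sum_distrib_left by (simp add: int' * sum_distrib_left)
qed

lemma c_tp_single: "c (\<lambda>x. Re (z * ek j x)) k = ((if j = k then z else 0) + (if - j = k then cnj z else 0)) / 2"
proof -
  have 1: "complex_of_real (Re (z * ek j x)) * ek (- k) x = z / 2 * ek (j - k) x + cnj z / 2 * ek (- j - k) x" for x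
  proof -
    have "complex_of_real (Re (z * ek j x)) = (z * ek j x + cnj z * ek (- j) x) / 2"
      using complex_add_cnj[of "z * ek j x"] by (simp add: ek_cnj)
    then show ?thesis
      using ek_add[of j "-k" x] ek_add[of "-j" "-k" x] by (simp add: algebra_simps add_divide_distrib)
  qed
  have int: "integrable MP (\<lambda>x. z * ek l x)" for z l
    using integrable_ek[OF integrable_L2[OF const_L2[of 1]], of l] by simp
  have "(\<integral>x. complex_of_real (Re (z * ek j x)) * ek (- k) x \<partial>MP)
      = z / 2 * (\<integral>x. ek (j - k) x \<partial>MP) + cnj z / 2 * (\<integral>x. ek (- j - k) x \<partial>MP)"
    unfolding 1 using int[of "z/2"] int[of "cnj z / 2"] by simp
  then show ?thesis using L_pos
    by (auto simp: c_eq integral_ek simp flip: distrib_right)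
qed

lemma c_tp:
  assumes fin: "finite F" and symF: "\<And>k. k \<in> F \<Longrightarrow> - k \<in> F" and herm: "\<And>k. a (- k) = cnj (a k)"
  shows "c (tp a F) k = (if k \<in> F then a k else 0)"
proof -
  have L2: "(\<lambda>x. Re (a j * ek j x)) \<in> L2_per L" for j
    using tp_L2[of a "{j}"] by (simp add: tp_def[abs_def])
  have S: "(\<Sum>j\<in>F. (\<lambda>x. Re (a j * ek j x))) \<in> L2_per L" for F
    using tp_L2[of a F] by (simp add: tp_sum)
  have "c (tp a F) k = (\<Sum>j\<in>F. c (\<lambda>x. Re (a j * ek j x)) k)" 
    unfolding tp_sum using fin
  proof (induction F rule: finite_induct)
    case (insert j F)
    then show ?case using c_add[OF L2[of j] S[of F], of k]
      unfolding sum.insert[OF insert(1,2)] by metis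
  qed (simp only: sum.empty c_zero)
  also have "\<dots> = ((\<Sum>j\<in>F. if j = k then a j else 0) + (\<Sum>j\<in>F. if j = - k then cnj (a j) else 0)) / 2"
    unfolding c_tp_single sum_divide_distrib[symmetric] sum.distrib[symmetric]
    by (intro arg_cong[where f = "\<lambda>x. x / 2"] sum.cong) auto
  also have "\<dots> = (if k \<in> F then a k else 0)"
    using fin symF[of k] symF[of "-k"] by (auto simp: sum.delta herm)
  finally show ?thesis .
qed

abbreviation modes :: "nat \<Rightarrow> int set" where "modes n \<equiv> {- int n..int n}"

lemma modes_subset: "finite F \<Longrightarrow> \<exists>n. F \<subseteq> modes n"
proof (intro exI[of _ "\<Sum>k\<in>F. nat \<bar>k\<bar>"] subsetI)
  fix k assume F: "finite F" "k \<in> F"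
  then have "nat \<bar>k\<bar> \<le> (\<Sum>k\<in>F. nat \<bar>k\<bar>)" by (intro member_le_sum) auto
  then have "\<bar>k\<bar> \<le> int (\<Sum>k\<in>F. nat \<bar>k\<bar>)" by linarith
  then show "k \<in> modes (\<Sum>k\<in>F. nat \<bar>k\<bar>)" unfolding atLeastAtMost_iff by linarith
qed

lemma sum_modes_tendsto:
  fixes f :: "int \<Rightarrow> 'a::{topological_comm_monoid_add, t2_space}"
  assumes "f summable_on UNIV"
  shows "(\<lambda>n. sum f (modes n)) \<longlonglongrightarrow> infsum f UNIV"
proof -
  have "filterlim modes (finite_subsets_at_top UNIV) sequentially"
    unfolding filterlim_finite_subsets_at_top
  proof (intro allI impI)
    fix X :: "int set" assume "finite X \<and> X \<subseteq> UNIV"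
    then obtain n where n: "X \<subseteq> modes n" using modes_subset by blast
    show "\<forall>\<^sub>F m in sequentially. finite (modes m) \<and> X \<subseteq> modes m \<and> modes m \<subseteq> UNIV"
      using eventually_ge_at_top[of n] by eventually_elim (use n in fastforce)
  qed
  moreover have "(sum f \<longlongrightarrow> infsum f UNIV) (finite_subsets_at_top UNIV)"
    using has_sum_infsum[OF assms] by (simp add: has_sum_def)
  ultimately show ?thesis by (rule filterlim_compose[rotated])
qed

lemma ip_tp_tp:
  assumes "finite F" "\<And>k. k \<in> F \<Longrightarrow> - k \<in> F" "\<And>k. a (- k) = cnj (a k)"
  shows "ip (tp a F) (tp a F) = L * (\<Sum>k\<in>F. (norm (a k))\<^sup>2)"
  by (simp add: ip_tp c_tp[where F = F and a = a, OF assms] Re_mult_cnj_self cong: sum.cong) 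

lemma bessel_modes: 
  assumes u: "u \<in> L2_per L"
  shows "L * (\<Sum>k\<in>modes n. (norm (c u k))\<^sup>2) \<le> ip u u"
proof -
  let ?T = "tp (c u) (modes n)"
  have "0 \<le> ip (u - ?T) (u - ?T)" using u by (intro ip.nonneg) auto
  also have "\<dots> = ip u u - 2 * ip u ?T + ip ?T ?T" using u by (intro ip.quad_diff) auto
  also have "ip ?T ?T = L * (\<Sum>k\<in>modes n. (norm (c u k))\<^sup>2)"
    by (rule ip_tp_tp) (auto simp: c_minus_index)
  also have "ip u ?T = L * (\<Sum>k\<in>modes n. (norm (c u k))\<^sup>2)"
    using u by (simp add: ip_tp Re_mult_cnj_self)
  finally show ?thesis by simp
qed

lemma bessel:
  assumes u: "u \<in> L2_per L" and F: "finite F"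
  shows "L * (\<Sum>k\<in>F. (norm (c u k))\<^sup>2) \<le> ip u u"
proof -
  obtain n where "F \<subseteq> modes n" using modes_subset[OF F] by blast
  then have "(\<Sum>k\<in>F. (norm (c u k))\<^sup>2) \<le> (\<Sum>k\<in>modes n. (norm (c u k))\<^sup>2)"
    by (intro sum_mono2) auto
  then show ?thesis using bessel_modes[OF u, of n] L_pos by (smt (verit) mult_left_mono)
qed

lemma summable_c: "u \<in> L2_per L \<Longrightarrow> (\<lambda>k. (norm (c u k))\<^sup>2) summable_on UNIV"
proof (rule nonneg_bdd_above_summable_on)
  assume u: "u \<in> L2_per L"
  show "bdd_above (sum (\<lambda>k. (cmod (c u k))\<^sup>2) ` {F. F \<subseteq> UNIV \<and> finite F})"
  proof (rule bdd_aboveI[of _ "ip u u / L"])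
    fix y assume "y \<in> sum (\<lambda>k. (cmod (c u k))\<^sup>2) ` {F. F \<subseteq> UNIV \<and> finite F}"
    then obtain F where F: "finite F" "y = (\<Sum>k\<in>F. (norm (c u k))\<^sup>2)" by auto
    have "L * y \<le> ip u u" using bessel[OF u F(1)] F(2) by simp
    then show "y \<le> ip u u / L" by (simp add: pos_le_divide_eq[OF L_pos] mult.commute)
  qed
qed auto

text \<open>The squared \<open>L2\<close> distance of two partial sums is the sum of the squared coefficients between them,
so the partial sums form a Cauchy sequence.\<close>

theorem riesz_fischer:
  assumes herm: "\<And>k. a (- k) = cnj (a k)" and sum: "(\<lambda>k. (norm (a k))\<^sup>2) summable_on UNIV"
  obtains g where "g \<in> L2_per L" "\<And>k. c g k = a k"
    "(\<lambda>n. ip (tp a (modes n) - g) (tp a (modes n) - g)) \<longlonglongrightarrow> 0"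
proof -
  let ?s = "\<lambda>n. \<Sum>k\<in>modes n. (norm (a k))\<^sup>2"
  have d: "ip (tp a (modes m) - tp a (modes n)) (tp a (modes m) - tp a (modes n)) = L * \<bar>?s m - ?s n\<bar>" for m n
  proof (induction m n rule: linorder_wlog)
    case (le m n)
    let ?D = "modes n - modes m"
    have sub: "modes m \<subseteq> modes n" using le by auto
    have e: "tp a (modes n) = tp a (modes m) + tp a ?D"
      using sum.subset_diff[OF sub finite_atLeastAtMost_int, of "\<lambda>k. Re (a k * ek k _)"]
      by (simp add: fun_eq_iff tp_def add.commute)
    have "ip (tp a (modes m) - tp a (modes n)) (tp a (modes m) - tp a (modes n)) = ip (tp a ?D) (tp a ?D)"
      unfolding e by (simp add: ip_def)
    also have "\<dots> = L * (\<Sum>k\<in>?D. (norm (a k))\<^sup>2)" by (rule ip_tp_tp) (auto simp: herm)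
    also have "(\<Sum>k\<in>?D. (norm (a k))\<^sup>2) = ?s n - ?s m"
      using sum.subset_diff[OF sub, of "\<lambda>k. (norm (a k))\<^sup>2"] by simp
    also have "\<dots> = \<bar>?s m - ?s n\<bar>" using sum_mono2[OF _ sub, of "\<lambda>k. (norm (a k))\<^sup>2"] by simp
    finally show ?case .
  next
    case (sym m n)
    have "ip (tp a (modes n) - tp a (modes m)) (tp a (modes n) - tp a (modes m))
      = ip (tp a (modes m) - tp a (modes n)) (tp a (modes m) - tp a (modes n))"
      unfolding ip_def by (rule Bochner_Integration.integral_cong) (simp_all add: algebra_simps)
    then show ?case using sym by (metis abs_minus_commute)
  qed
  have cau: "Cauchy ?s" using sum_modes_tendsto[OF sum] LIMSEQ_imp_Cauchy by blast
  obtain g where g: "g \<in> L2_per L" "(\<lambda>n. ip (tp a (modes n) - g) (tp a (modes n) - g)) \<longlonglongrightarrow> 0"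
  proof (rule L2_complete[of "\<lambda>n. tp a (modes n)"])
    fix e :: real assume "e > 0"
    then obtain N where "\<forall>m\<ge>N. \<forall>n\<ge>N. \<bar>?s m - ?s n\<bar> < e / L"
      using cau L_pos unfolding Cauchy_def dist_real_def by (meson divide_pos_pos)
    then show "\<exists>N. \<forall>m\<ge>N. \<forall>n\<ge>N. ip (tp a (modes m) - tp a (modes n)) (tp a (modes m) - tp a (modes n)) < e"
      unfolding d using L_pos by (intro exI[of _ N]) (auto simp: field_simps)
  qed auto
  moreover have "c g k = a k" for k
  proof -
    have "(\<lambda>n. sqrt (ip (tp a (modes n) - g) (tp a (modes n) - g)) / sqrt L) \<longlonglongrightarrow> sqrt 0 / sqrt L"
      using g by (intro tendsto_intros) (use L_pos in auto)
    then have "(\<lambda>n. sqrt (ip (tp a (modes n) - g) (tp a (modes n) - g)) / sqrt L) \<longlonglongrightarrow> 0" by simp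
    then have "(\<lambda>n. c (tp a (modes n) - g) k) \<longlonglongrightarrow> 0"
      by (rule tendsto_norm_zero_cancel[OF tendsto_sandwich[rotated 2, OF tendsto_const]])
         (use g in \<open>auto intro!: always_eventually norm_c_le\<close>)
    moreover have "\<forall>\<^sub>F n in sequentially. c (tp a (modes n) - g) k = a k - c g k"
      using eventually_ge_at_top[of "nat \<bar>k\<bar>"]
    proof eventually_elim
      case (elim n)
      then have "k \<in> modes n" by auto
      moreover have "c (tp a (modes n)) k = (if k \<in> modes n then a k else 0)"
        by (rule c_tp) (auto simp: herm)
      ultimately show ?case using g by (simp only: c_diff tp_L2 if_True)
    qed
    ultimately have "(\<lambda>n::nat. a k - c g k) \<longlonglongrightarrow> 0" by (rule Lim_transform_eventually)
    then show ?thesis by (simp add: LIMSEQ_const_iff)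
  qed
  ultimately show thesis by (intro that)
qed

end

section \<open>Completeness of the exponentials\<close>

text \<open>This makes the indicator of an interval, as a function on the circle, a step function of the cosine
of the distance to its midpoint.\<close>

lemma cos_gt_iff:
  fixes \<theta> \<rho> :: real
  assumes "0 < \<rho>" "\<rho> \<le> pi" "- \<rho> \<le> \<theta>" "\<theta> \<le> 2 * pi - \<rho>"
  shows "cos \<theta> > cos \<rho> \<longleftrightarrow> - \<rho> < \<theta> \<and> \<theta> < \<rho>"
proof (cases "\<bar>\<theta>\<bar> < \<rho>")
  case True
  then have "cos \<bar>\<theta>\<bar> > cos \<rho>" using assms by (intro cos_monotone_0_pi) auto
  then show ?thesis using True by (auto simp: abs_if split: if_splits)
next
  case False
  have "cos \<theta> \<le> cos \<rho>"
  proof (cases "\<theta> \<le> pi")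
    case True
    show ?thesis
    proof (cases "\<theta> = - \<rho>")
      case False
      then have "\<rho> \<le> \<theta>" using \<open>\<not> \<bar>\<theta>\<bar> < \<rho>\<close> assms by (auto simp: abs_if split: if_splits)
      then show ?thesis using assms True by (intro cos_monotone_0_pi_le) auto
    qed simp
  next
    case False
    have "cos (2 * pi - \<theta>) \<le> cos \<rho>" using assms False by (intro cos_monotone_0_pi_le) auto
    then show ?thesis by (simp add: cos_diff)
  qed
  then show ?thesis using False by auto
qed

context period
begin

text \<open>The functions whose products with \<open>u\<close> have vanishing Fourier coefficients are closed under
multiplication by exponentials, hence by translated cosines.\<close>

lemma annihilates_cos_powers:
  assumes u: "u \<in> L2_per L" and zero: "\<And>k. c u k = 0"
  shows "(\<integral>x. complex_of_real (u x * cos (2 * pi * (x - a) / L) ^ i) * ek k x \<partial>MP) = 0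
     \<and> integrable MP (\<lambda>x. u x * cos (2 * pi * (x - a) / L) ^ i)"
proof (induction i arbitrary: k)
  case 0
  have "(\<integral>x. complex_of_real (u x) * ek k x \<partial>MP) = 0"
    using zero[of "- k"] L_pos by (simp add: c_eq)
  then show ?case using integrable_L2[OF u] by simp
next
  case (Suc i)
  note [measurable] = L2_perD(1)[OF u]
  let ?v = "\<lambda>x. u x * cos (2 * pi * (x - a) / L) ^ i"
  let ?z = "ek (- 1) a"
  have int: "integrable MP (\<lambda>x. z * (complex_of_real (?v x) * ek l x))" for l z
    using integrable_ek[of ?v] Suc by simp
  have cos: "complex_of_real (cos (2 * pi * (x - a) / L)) = (ek 1 x * ?z + ek (- 1) x * cnj ?z) / 2" for x
  proof -
    have "complex_of_real (cos (2 * pi * (x - a) / L)) = of_real (Re (ek 1 x * ?z))"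
      by (simp add: ek_def cis_mult) (simp add: diff_divide_distrib right_diff_distrib)
    also have "\<dots> = (ek 1 x * ?z + cnj (ek 1 x * ?z)) / 2" using complex_add_cnj[of "ek 1 x * ?z"] by simp
    finally show ?thesis by (simp add: ek_cnj)
  qed
  have "complex_of_real (u x * cos (2 * pi * (x - a) / L) ^ Suc i) * ek k x
     = ?z / 2 * (complex_of_real (?v x) * ek (1 + k) x) + cnj ?z / 2 * (complex_of_real (?v x) * ek (- 1 + k) x)" for x
    unfolding ek_add power_Suc of_real_mult cos by (simp add: algebra_simps add_divide_distrib)
  then have "(\<integral>x. complex_of_real (u x * cos (2 * pi * (x - a) / L) ^ Suc i) * ek k x \<partial>MP)
     = (\<integral>x. ?z / 2 * (complex_of_real (?v x) * ek (1 + k) x) + cnj ?z / 2 * (complex_of_real (?v x) * ek (- 1 + k) x) \<partial>MP)"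
    by simp
  also have "\<dots> = ?z / 2 * (\<integral>x. complex_of_real (?v x) * ek (1 + k) x \<partial>MP)
      + cnj ?z / 2 * (\<integral>x. complex_of_real (?v x) * ek (- 1 + k) x \<partial>MP)"
    by (subst Bochner_Integration.integral_add[OF int int]) simp
  also have "\<dots> = 0" using Suc by simp
  finally have "(\<integral>x. complex_of_real (u x * cos (2 * pi * (x - a) / L) ^ Suc i) * ek k x \<partial>MP) = 0" .
  moreover have "integrable MP (\<lambda>x. u x * cos (2 * pi * (x - a) / L) ^ Suc i)"
  proof (rule Bochner_Integration.integrable_bound[OF integrable_L2[OF u]])
    show "(\<lambda>x. u x * cos (2 * pi * (x - a) / L) ^ Suc i) \<in> borel_measurable MP"
      by (rule measurable_MP) measurable
    show "AE x in MP. norm (u x * cos (2 * pi * (x - a) / L) ^ Suc i) \<le> norm (u x)"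
    proof (rule AE_I2)
      fix x :: real
      have "\<bar>cos (2 * pi * (x - a) / L) ^ Suc i\<bar> \<le> 1"
        unfolding power_abs by (rule power_le_one) auto
      then show "norm (u x * cos (2 * pi * (x - a) / L) ^ Suc i) \<le> norm (u x)"
        unfolding real_norm_def abs_mult by (rule mult_left_le) simp
    qed
  qed
  ultimately show ?case by blast
qed

lemma annihilates_polynomial_cos:
  assumes u: "u \<in> L2_per L" and zero: "\<And>k. c u k = 0" and p: "real_polynomial_function p"
  shows "(\<integral>x. u x * p (cos (2 * pi * (x - a) / L)) \<partial>MP) = 0"
proof -
  obtain b n where p: "p = (\<lambda>t. \<Sum>i\<le>n. b i * t ^ i)"
    using p real_polynomial_function_iff_sum[of p] by auto
  have i: "integrable MP (\<lambda>x. u x * cos (2 * pi * (x - a) / L) ^ i)" for i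
    using annihilates_cos_powers[OF u zero] by blast
  have z: "(\<integral>x. u x * cos (2 * pi * (x - a) / L) ^ i \<partial>MP) = 0" for i
  proof -
    have "complex_of_real (\<integral>x. u x * cos (2 * pi * (x - a) / L) ^ i \<partial>MP)
      = (\<integral>x. complex_of_real (u x * cos (2 * pi * (x - a) / L) ^ i) * ek 0 x \<partial>MP)"
      using integral_complex_of_real[of MP "\<lambda>x. u x * cos (2 * pi * (x - a) / L) ^ i"] by simp
    also have "\<dots> = 0" using annihilates_cos_powers[OF u zero] by blast
    finally show ?thesis by simp
  qed
  have "(\<integral>x. u x * p (cos (2 * pi * (x - a) / L)) \<partial>MP)
     = (\<integral>x. (\<Sum>i\<le>n. b i * (u x * cos (2 * pi * (x - a) / L) ^ i)) \<partial>MP)"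
    unfolding p by (simp add: sum_distrib_left algebra_simps)
  also have "\<dots> = (\<Sum>i\<le>n. b i * (\<integral>x. u x * cos (2 * pi * (x - a) / L) ^ i \<partial>MP))"
    using i by simp
  finally show ?thesis by (simp add: z)
qed

text \<open>The indicator of the interval is a step function of a cosine. Steps are bounded pointwise limits of
continuous functions, and these are uniform limits of polynomials (Weierstrass), so dominated
convergence applies.\<close>

lemma annihilates_initial_interval:
  assumes u: "u \<in> L2_per L" and zero: "\<And>k. c u k = 0" and b: "0 < b" "b \<le> L"
  shows "(\<integral>x. u x * indicator {0<..<b} x \<partial>MP) = 0"
proof -
  note [measurable] = L2_perD(1)[OF u]
  define t0 where "t0 = cos (pi * b / L)"
  define h where "h n t = max 0 (min 1 (real n * (t - t0)))" for n t
  have "\<exists>p. real_polynomial_function p \<and> (\<forall>t\<in>{-1..1}. \<bar>h n t - p t\<bar> < 1 / (Suc n))" for n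
  proof -
    have "continuous_on {-1..1} (h n)" unfolding h_def by (intro continuous_intros)
    from compact_Icc this show ?thesis
    proof (rule Stone_Weierstrass_real_polynomial_function)
      show "0 < 1 / real (Suc n)" by simp
    qed blast
  qed
  then obtain p where p: "\<And>n. real_polynomial_function (p n)"
      "\<And>n t. t \<in> {-1..1} \<Longrightarrow> \<bar>h n t - p n t\<bar> < 1 / Suc n"
    by metis
  define C where "C x = cos (2 * pi * (x - b / 2) / L)" for x
  have C: "C x \<in> {-1..1}" for x by (simp add: C_def)
  have pm [measurable]: "p n \<in> borel_measurable borel" for n
    using p(1) by (intro borel_measurable_continuous_onI continuous_on_polymonial_function)
      (simp add: real_polynomial_function_eq)
  have Cm [measurable]: "C \<in> borel_measurable borel" unfolding C_def by measurable
  have lim: "(\<lambda>n. p n t) \<longlonglongrightarrow> (if t > t0 then 1 else 0)" if t: "t \<in> {-1..1}" for t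
  proof -
    have 1: "(\<lambda>n. h n t - p n t) \<longlonglongrightarrow> 0"
    proof (rule tendsto_rabs_zero_cancel, rule tendsto_sandwich[OF _ _ tendsto_const])
      show "(\<lambda>n. 1 / real (Suc n)) \<longlonglongrightarrow> 0" using LIMSEQ_inverse_real_of_nat by (simp add: inverse_eq_divide)
    qed (use p(2)[OF t] in \<open>auto simp: less_imp_le\<close>)
    have 2: "(\<lambda>n. h n t) \<longlonglongrightarrow> (if t > t0 then 1 else 0)"
    proof (cases "t > t0")
      case True
      obtain N where N: "1 / (t - t0) < real N" using reals_Archimedean2 by blast
      have "\<forall>\<^sub>F n in sequentially. h n t = 1"
        using eventually_ge_at_top[of N]
      proof eventually_elim
        case (elim n)
        have "1 < real N * (t - t0)" using N True by (simp add: field_simps)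
        also have "\<dots> \<le> real n * (t - t0)" using elim True by (intro mult_right_mono) auto
        finally show ?case by (simp add: h_def)
      qed
      then show ?thesis using True by (simp add: tendsto_eventually)
    next
      case False
      then have "real n * (t - t0) \<le> 0" for n by (intro mult_nonneg_nonpos) auto
      then have "h n t = 0" for n unfolding h_def by (smt (verit))
      then show ?thesis using False by simp
    qed
    from tendsto_diff[OF 2 1] show ?thesis by simp
  qed
  have bd: "\<bar>p n t\<bar> \<le> 2" if "t \<in> {-1..1}" for n t
  proof -
    have "\<bar>h n t\<bar> \<le> 1" by (simp add: h_def)
    moreover have "1 / real (Suc n) \<le> 1" by simp
    ultimately show ?thesis using p(2)[OF that, of n] by linarith
  qed
  have "(\<lambda>n. \<integral>x. u x * p n (C x) \<partial>MP) \<longlonglongrightarrow> (\<integral>x. u x * (if C x > t0 then 1 else 0) \<partial>MP)"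
  proof (rule integral_dominated_convergence[where w = "\<lambda>x. 2 * \<bar>u x\<bar>"])
    show "integrable MP (\<lambda>x. 2 * \<bar>u x\<bar>)" using integrable_L2[OF u] by simp
    show "AE x in MP. (\<lambda>n. u x * p n (C x)) \<longlonglongrightarrow> u x * (if t0 < C x then 1 else 0)"
      using lim[OF C] by (intro AE_I2 tendsto_mult tendsto_const)
    show "AE x in MP. norm (u x * p n (C x)) \<le> 2 * \<bar>u x\<bar>" for n
      using mult_left_mono[OF bd[OF C], of "\<bar>u _\<bar>"] by (intro AE_I2) (simp add: abs_mult mult.commute)
  qed measurable
  moreover have "(\<integral>x. u x * p n (C x) \<partial>MP) = 0" for n
    unfolding C_def by (rule annihilates_polynomial_cos[OF u zero p(1)])
  ultimately have "(\<integral>x. u x * (if C x > t0 then 1 else 0) \<partial>MP) = 0"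
    by (simp add: LIMSEQ_const_iff)
  moreover have "(if C x > t0 then 1 else 0) = (indicator {0<..<b} x :: real)" if "x \<in> {0..L}" for x
  proof -
    have "C x > t0 \<longleftrightarrow> - (pi * b / L) < 2 * pi * (x - b / 2) / L \<and> 2 * pi * (x - b / 2) / L < pi * b / L"
      unfolding C_def t0_def
    proof (rule cos_gt_iff)
      show "- (pi * b / L) \<le> 2 * pi * (x - b / 2) / L" using that L_pos by (simp add: field_simps)
      have "pi * x \<le> pi * L" using that by simp
      then show "2 * pi * (x - b / 2) / L \<le> 2 * pi - pi * b / L" using that L_pos by (simp add: field_simps)
      show "pi * b / L \<le> pi" using b L_pos by (simp add: field_simps)
    qed (use b L_pos in auto)
    also have "\<dots> \<longleftrightarrow> 0 < x \<and> x < b"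
    proof -
      have "2 * pi * (x - b / 2) / L = pi / L * (2 * x - b)" "pi * b / L = pi / L * b" "pi / L > 0"
        using L_pos by (simp_all add: field_simps)
      then show ?thesis by (simp only: minus_mult_right mult_less_cancel_left_pos) auto
    qed
    finally show ?thesis by (simp add: indicator_def)
  qed
  then have "(\<integral>x. u x * (if C x > t0 then 1 else 0) \<partial>MP) = (\<integral>x. u x * indicator {0<..<b} x \<partial>MP)"
    by (intro Bochner_Integration.integral_cong) auto
  ultimately show ?thesis by simp
qed

text \<open>The integrals of \<open>u\<close> over initial intervals vanish, hence its integrals over all Borel sets, since
the rays generate the Borel sets and are stable under intersection.\<close>

theorem fourier_unique:
  assumes u: "u \<in> L2_per L" and zero: "\<And>k. c u k = 0"
  shows "AE x in lborel. u x = 0"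
proof -
  note [measurable] = L2_perD(1)[OF u]
  note iu = integrable_L2[OF u]
  let ?S = "\<lambda>A. \<integral>x. u x * indicator A x \<partial>MP"
  have iA: "integrable MP (\<lambda>x. u x * indicator A x)" if "A \<in> sets borel" for A
  proof -
    have [measurable]: "A \<in> sets borel" by fact
    show ?thesis
    proof (rule Bochner_Integration.integrable_bound[OF iu])
      show "(\<lambda>x. u x * indicator A x) \<in> borel_measurable MP" by (rule measurable_MP) measurable
    qed (auto simp: indicator_def)
  qed
  have ray: "?S {..<b} = 0" for b
  proof -
    have e: "?S {..<b} = ?S {0<..<min b L}"
    proof (rule integral_cong_AE)
      have "AE x in lborel. x \<noteq> 0 \<and> x \<noteq> L" by (intro AE_conjI AE_lborel_singleton)
      then have "AE x in MP. x \<noteq> 0 \<and> x \<noteq> L" by (rule AE_lborel_MP)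
      then show "AE x in MP. u x * indicator {..<b} x = u x * indicator {0<..<min b L} x"
        using AE_space[of MP] by eventually_elim (auto simp: indicator_def)
      show "(\<lambda>x. u x * indicator {..<b} x) \<in> borel_measurable MP"
        by (rule measurable_MP) measurable
      show "(\<lambda>x. u x * indicator {0<..<min b L} x) \<in> borel_measurable MP"
        by (rule measurable_MP) measurable
    qed
    show ?thesis
    proof (cases "b \<le> 0")
      case True
      then have "{0<..<min b L} = {}" by auto
      then show ?thesis using e by simp
    next
      case False
      then show ?thesis using e annihilates_initial_interval[OF u zero, of "min b L"] L_pos by simp
    qed
  qed
  have tot: "(\<integral>x. u x \<partial>MP) = 0"
  proof -
    have "?S {..<L+1} = (\<integral>x. u x \<partial>MP)"
      by (rule Bochner_Integration.integral_cong) (auto simp: indicator_def)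
    then show ?thesis using ray by simp
  qed
  have sb: "sets (borel :: real measure) = sigma_sets UNIV (range lessThan)"
    by (subst borel_Iio) (simp add: sets_measure_of)
  have "?S A = 0" if "A \<in> sets borel" for A
  proof -
    have "Int_stable (range (lessThan :: real \<Rightarrow> real set))"
    proof -
      have "{..<a} \<inter> {..<b} = {..<min a b}" for a b :: real by auto
      then show ?thesis by (auto simp: Int_stable_def)
    qed
    moreover have "range (lessThan :: real \<Rightarrow> real set) \<subseteq> Pow UNIV" by auto
    moreover have "A \<in> sigma_sets UNIV (range lessThan)"
      using that sb by simp
    ultimately show ?thesis
    proof (induction A rule: sigma_sets_induct_disjoint)
      case (compl A)
      then have A: "A \<in> sets borel" using sb by simp
      have "?S (UNIV - A) = (\<integral>x. u x - u x * indicator A x \<partial>MP)"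
        by (rule Bochner_Integration.integral_cong) (auto simp: indicator_def)
      also have "\<dots> = 0" using iA[OF A] iu tot compl by simp
      finally show ?case .
    next
      case (union A)
      then have A: "A i \<in> sets borel" for i using sb by auto
      have eq: "set_lebesgue_integral MP (B \<inter> {0..L}) u = ?S B" for B
        unfolding set_lebesgue_integral_def by (rule Bochner_Integration.integral_cong) (auto simp: indicator_def)
      have [measurable]: "A i \<inter> {0..L} \<in> sets MP" for i using A by (auto simp: sets_restrict_space Int_commute)
      have "set_lebesgue_integral MP (\<Union>i. A i \<inter> {0..L}) u = (\<Sum>i. set_lebesgue_integral MP (A i \<inter> {0..L}) u)"
      proof (rule lebesgue_integral_countable_add)
        show "set_integrable MP (\<Union>i. A i \<inter> {0..L}) u"
          unfolding set_integrable_def by (intro integrable_mult_indicator iu) measurable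
        show "(A i \<inter> {0..L}) \<inter> (A j \<inter> {0..L}) = {}" if "i \<noteq> j" for i j
          using union(1) that by (auto simp: disjoint_family_on_def)
      qed measurable
      moreover have e: "(\<Union>i. A i \<inter> {0..L}) = (\<Union>i. A i) \<inter> {0..L}" by auto
      ultimately show ?case unfolding e eq union(3) by simp
    qed (use ray in auto)
  qed
  note S0 = this
  have "AE x in MP. u x = (\<lambda>x. 0) x"
  proof (rule MP.density_unique_banach[OF iu])
    fix A assume "A \<in> sets MP"
    then obtain B where B: "B \<in> sets borel" "A = B \<inter> {0..L}" by (auto simp: sets_restrict_space Int_commute)
    have "set_lebesgue_integral MP A u = ?S B"
      unfolding set_lebesgue_integral_def B by (rule Bochner_Integration.integral_cong) (auto simp: indicator_def)
    then show "set_lebesgue_integral MP A u = set_lebesgue_integral MP A (\<lambda>x. 0)"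
      using S0[OF B(1)] by (simp add: set_lebesgue_integral_def)
  qed simp
  then show ?thesis using AE_L2_eq_iff[OF u const_L2[of 0]] by simp
qed

lemma fourier_unique_eq:
  assumes "u \<in> L2_per L" "v \<in> L2_per L" "\<And>k. c u k = c v k"
  shows "AE x in lborel. u x = v x"
  using fourier_unique[of "u - v"] assms by (simp add: c_diff)

lemma ip_cong_AE:
  assumes "u \<in> L2_per L" "u' \<in> L2_per L" "v \<in> L2_per L" "v' \<in> L2_per L"
    "AE x in lborel. u x = u' x" "AE x in lborel. v x = v' x"
  shows "ip u v = ip u' v'"
proof -
  note [measurable] = assms(1-4)[THEN L2_perD(1)]
  show ?thesis unfolding ip_def
    by (rule integral_cong_AE) (use AE_lborel_MP[OF assms(5)] AE_lborel_MP[OF assms(6)] in auto)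
qed

text \<open>The partial sums converge to some function by the theorem of Riesz and Fischer; by uniqueness it is
the given one.\<close>

lemma partial_sums_L2:
  assumes u: "u \<in> L2_per L"
  shows "(\<lambda>n. ip (tp (c u) (modes n) - u) (tp (c u) (modes n) - u)) \<longlonglongrightarrow> 0"
proof -
  obtain g where g: "g \<in> L2_per L" "\<And>k. c g k = c u k"
    "(\<lambda>n. ip (tp (c u) (modes n) - g) (tp (c u) (modes n) - g)) \<longlonglongrightarrow> 0"
    using riesz_fischer[of "c u"] summable_c[OF u] c_minus_index by blast
  have ae: "AE x in lborel. g x = u x" by (rule fourier_unique_eq) (use g u in auto)
  have "ip (tp (c u) (modes n) - g) (tp (c u) (modes n) - g) = ip (tp (c u) (modes n) - u) (tp (c u) (modes n) - u)" for n
    by (rule ip_cong_AE) (use g u ae in auto)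
  then show ?thesis using g(3) by simp
qed

end

section \<open>Parseval's identity and weighted forms\<close>

lemma inverse_square_summable: "(\<lambda>k::int. 1 / (1 + (real_of_int k)\<^sup>2)) summable_on UNIV"
proof (rule nonneg_bdd_above_summable_on)
  let ?f = "\<lambda>k::int. 1 / (1 + (real_of_int k)\<^sup>2)"
  \<comment> \<open>the correction \<open>4 / (n + 1)\<close> makes the induction telescope\<close>
  have b: "sum ?f {- int n..int n} \<le> 5 - 4 / (real n + 1)" for n
  proof (induction n)
    case (Suc n)
    have e: "{- int (Suc n)..int (Suc n)} = insert (int (Suc n)) (insert (- int (Suc n)) {- int n..int n})"
      by auto
    have "sum ?f {- int (Suc n)..int (Suc n)} = 2 / (1 + (real n + 1)\<^sup>2) + sum ?f {- int n..int n}"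
    proof -
      have "(real_of_int (int (Suc n)))\<^sup>2 = (real n + 1)\<^sup>2"
        "(real_of_int (- int (Suc n)))\<^sup>2 = (real n + 1)\<^sup>2"
        by (simp_all add: power2_eq_square algebra_simps)
      then have f: "?f (int (Suc n)) = 1 / (1 + (real n + 1)\<^sup>2)" "?f (- int (Suc n)) = 1 / (1 + (real n + 1)\<^sup>2)"
        by metis+
      have "sum ?f (insert (int (Suc n)) (insert (- int (Suc n)) {- int n..int n}))
          = ?f (int (Suc n)) + sum ?f (insert (- int (Suc n)) {- int n..int n})"
        by (rule sum.insert) auto
      also have "sum ?f (insert (- int (Suc n)) {- int n..int n}) = ?f (- int (Suc n)) + sum ?f {- int n..int n}"
        by (rule sum.insert) auto
      finally show ?thesis unfolding e f by linarith
    qed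
    moreover have "2 / (1 + (real n + 1)\<^sup>2) \<le> 2 / ((real n + 1) * (real n + 2) / 2)"
    proof (rule divide_left_mono)
      show "(real n + 1) * (real n + 2) / 2 \<le> 1 + (real n + 1)\<^sup>2"
        by (simp add: power2_eq_square algebra_simps)
      show "0 < (1 + (real n + 1)\<^sup>2) * ((real n + 1) * (real n + 2) / 2)"
        by (intro mult_pos_pos) (auto intro!: add_pos_nonneg)
    qed simp
    moreover have "2 / ((real n + 1) * (real n + 2) / 2) = 4 / (real n + 1) - 4 / (real n + 2)"
      by (simp add: field_simps)
    ultimately show ?case using Suc by (simp add: add.commute)
  qed simp
  show "bdd_above (sum ?f ` {F. F \<subseteq> UNIV \<and> finite F})"
  proof (rule bdd_aboveI[of _ 5])
    fix y assume "y \<in> sum ?f ` {F. F \<subseteq> UNIV \<and> finite F}"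
    then obtain F where F: "finite F" "y = sum ?f F" by auto
    interpret p: period 1 by unfold_locales simp
    obtain n where "F \<subseteq> {- int n..int n}" using p.modes_subset[OF F(1)] by blast
    then have "y \<le> sum ?f {- int n..int n}" unfolding F(2) by (intro sum_mono2) auto
    also have "\<dots> \<le> 5"
    proof -
      have "0 \<le> 4 / (real n + 1)" by simp
      then show ?thesis using b[of n] by linarith
    qed
    finally show "y \<le> 5" .
  qed
qed auto

lemma null_by_bound:
  fixes f g :: "nat \<Rightarrow> real"
  assumes "\<And>n. \<bar>f n\<bar> \<le> g n" "g \<longlonglongrightarrow> 0"
  shows "f \<longlonglongrightarrow> 0"
  by (rule Lim_null_comparison[OF _ assms(2)]) (simp add: assms(1))

context period
begin

text \<open>Sobolev norms, the \<open>L\<^sup>2\<close> product and the quadratic form of the multiplier differ only in the weight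
of the Fourier modes, so they are treated together.\<close>

definition Hw :: "(int \<Rightarrow> real) \<Rightarrow> (real \<Rightarrow> real) set" where
  "Hw w = {u \<in> L2_per L. (\<lambda>k. w k * (norm (c u k))\<^sup>2) summable_on UNIV}"

definition B :: "(int \<Rightarrow> real) \<Rightarrow> (real \<Rightarrow> real) \<Rightarrow> (real \<Rightarrow> real) \<Rightarrow> real" where
  "B w u v = L * (\<Sum>\<^sub>\<infinity>k. w k * Re (c u k * cnj (c v k)))"

lemma Hw_L2: "u \<in> Hw w \<Longrightarrow> u \<in> L2_per L" by (simp add: Hw_def)

lemma abs_Re_mult_cnj_le: "\<bar>Re (a * cnj b)\<bar> \<le> (norm a)\<^sup>2 + (norm b)\<^sup>2"
proof -
  have "\<bar>Re (a * cnj b)\<bar> \<le> norm a * norm b" using abs_Re_le_cmod[of "a * cnj b"] by (simp add: norm_mult)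
  moreover have "0 \<le> (norm a - norm b)\<^sup>2" by simp
  moreover have "0 \<le> norm a * norm b" by simp
  ultimately show ?thesis unfolding power2_diff by linarith
qed

lemma summable_pair:
  assumes "\<And>k. 0 \<le> w k" "u \<in> Hw w" "v \<in> Hw w"
  shows "(\<lambda>k. w k * Re (c u k * cnj (c v k))) summable_on UNIV"
proof -
  have "(\<lambda>k. w k * (norm (c u k))\<^sup>2 + w k * (norm (c v k))\<^sup>2) summable_on UNIV"
    using assms by (intro summable_on_add) (auto simp: Hw_def)
  then have "(\<lambda>k. norm (w k * Re (c u k * cnj (c v k)))) summable_on UNIV"
  proof (rule summable_on_comparison_test)
    fix k
    show "norm (w k * Re (c u k * cnj (c v k))) \<le> w k * (norm (c u k))\<^sup>2 + w k * (norm (c v k))\<^sup>2"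
      using mult_left_mono[OF abs_Re_mult_cnj_le[of "c u k" "c v k"] assms(1)[of k]] assms(1)[of k]
      by (simp add: abs_mult distrib_left)
  qed auto
  then show ?thesis by (rule Infinite_Sum.abs_summable_summable)
qed

lemma B_self: "B w u u = L * (\<Sum>\<^sub>\<infinity>k. w k * (norm (c u k))\<^sup>2)"
  by (simp add: B_def Re_mult_cnj_self)

lemma subspace_Hw:
  assumes w: "\<And>k. 0 \<le> w k"
  shows "subspace (Hw w)"
  unfolding subspace_def
proof (intro conjI ballI allI)
  show "0 \<in> Hw w" by (simp add: Hw_def)
next
  fix u v assume uv: "u \<in> Hw w" "v \<in> Hw w"
  have "(\<lambda>k. w k * (norm (c u k))\<^sup>2 + w k * (norm (c v k))\<^sup>2 + 2 * (w k * Re (c u k * cnj (c v k)))) summable_on UNIV"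
    using uv summable_pair[OF w uv] by (intro summable_on_add summable_on_cmult_right) (auto simp: Hw_def)
  moreover have "w k * (norm (c u k))\<^sup>2 + w k * (norm (c v k))\<^sup>2 + 2 * (w k * Re (c u k * cnj (c v k)))
      = w k * (norm (c (u + v) k))\<^sup>2" for k
  proof -
    have "(norm (c u k + c v k))\<^sup>2 = (norm (c u k))\<^sup>2 + (norm (c v k))\<^sup>2 + 2 * Re (c u k * cnj (c v k))"
      by (simp add: Re_mult_cnj_self[symmetric] algebra_simps times_complex.sel)
    then show ?thesis using uv by (simp add: c_add Hw_L2 algebra_simps)
  qed
  ultimately show "u + v \<in> Hw w" using uv by (simp add: Hw_def)
next
  fix a u assume u: "u \<in> Hw w"
  have "(\<lambda>k. a\<^sup>2 * (w k * (norm (c u k))\<^sup>2)) summable_on UNIV"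
    using u by (intro summable_on_cmult_right) (auto simp: Hw_def)
  then show "a *\<^sub>R u \<in> Hw w"
    using u by (simp add: Hw_def c_scale norm_mult power_mult_distrib mult.left_commute)
qed

lemma psd_form_B:
  assumes w: "\<And>k. 0 \<le> w k"
  shows "psd_form (Hw w) (B w)"
proof
  show "subspace (Hw w)" by (rule subspace_Hw[OF w])
next
  fix u v show "B w u v = B w v u"
    unfolding B_def by (simp add: times_complex.sel mult.commute)
next
  fix u v x assume *: "u \<in> Hw w" "v \<in> Hw w" "x \<in> Hw w"
  have "(\<Sum>\<^sub>\<infinity>k. w k * Re (c (u + v) k * cnj (c x k)))
     = (\<Sum>\<^sub>\<infinity>k. w k * Re (c u k * cnj (c x k)) + w k * Re (c v k * cnj (c x k)))"
    using * by (simp add: c_add Hw_L2 distrib_right distrib_left)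
  also have "\<dots> = (\<Sum>\<^sub>\<infinity>k. w k * Re (c u k * cnj (c x k))) + (\<Sum>\<^sub>\<infinity>k. w k * Re (c v k * cnj (c x k)))"
    using * by (intro infsum_add summable_pair w)
  finally show "B w (u + v) x = B w u x + B w v x" by (simp add: B_def distrib_left)
next
  fix a u x
  have "w k * Re (c (a *\<^sub>R u) k * cnj (c x k)) = a * (w k * Re (c u k * cnj (c x k)))" for k
    by (simp add: c_scale times_complex.sel algebra_simps)
  then show "B w (a *\<^sub>R u) x = a * B w u x"
    unfolding B_def by (simp only: infsum_cmult_right' mult.left_commute)
next
  fix u show "0 \<le> B w u u"
    unfolding B_self using L_pos w by (intro mult_nonneg_nonneg infsum_nonneg) auto
qed

lemma Hw_mono:
  assumes "\<And>k. 0 \<le> w' k" "\<And>k. w' k \<le> C * w k" "u \<in> Hw w"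
  shows "u \<in> Hw w'" "B w' u u \<le> C * B w u u"
proof -
  have s: "(\<lambda>k. C * (w k * (norm (c u k))\<^sup>2)) summable_on UNIV"
    using assms(3) by (intro summable_on_cmult_right) (simp add: Hw_def)
  have le: "w' k * (norm (c u k))\<^sup>2 \<le> C * (w k * (norm (c u k))\<^sup>2)" for k
    using mult_right_mono[OF assms(2)[of k], of "(norm (c u k))\<^sup>2"] by simp
  have s': "(\<lambda>k. w' k * (norm (c u k))\<^sup>2) summable_on UNIV"
    by (rule summable_on_comparison_test[OF s]) (use le assms(1) in auto)
  then show "u \<in> Hw w'" using assms(3) by (simp add: Hw_def)
  have "(\<Sum>\<^sub>\<infinity>k. w' k * (norm (c u k))\<^sup>2) \<le> (\<Sum>\<^sub>\<infinity>k. C * (w k * (norm (c u k))\<^sup>2))"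
    by (rule infsum_mono) (use s' s le in auto)
  then show "B w' u u \<le> C * B w u u"
    unfolding B_self using L_pos by (simp add: infsum_cmult_right' mult.left_commute)
qed

lemma Hw_1: "Hw (\<lambda>_. 1) = L2_per L"
  using summable_c by (auto simp: Hw_def)

theorem parseval:
  assumes u: "u \<in> L2_per L" and v: "v \<in> L2_per L"
  shows "ip u v = B (\<lambda>_. 1) u v"
proof -
  let ?T = "\<lambda>n. tp (c u) (modes n)"
  have "(\<lambda>n. L * (\<Sum>k\<in>modes n. Re (c u k * cnj (c v k)))) \<longlonglongrightarrow> L * (\<Sum>\<^sub>\<infinity>k. Re (c u k * cnj (c v k)))"
    using summable_pair[of "\<lambda>_. 1" u v] u v
    by (intro tendsto_mult[OF tendsto_const] sum_modes_tendsto) (simp add: Hw_1)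
  moreover have "L * (\<Sum>k\<in>modes n. Re (c u k * cnj (c v k))) = ip (?T n) v" for n
    using ip_tp[OF v] ip.sym[OF v tp_L2] by simp
  ultimately have 1: "(\<lambda>n. ip (?T n) v) \<longlonglongrightarrow> B (\<lambda>_. 1) u v" by (simp add: B_def)
  have "(\<lambda>n. sqrt (ip (?T n - u) (?T n - u)) * sqrt (ip v v)) \<longlonglongrightarrow> sqrt 0 * sqrt (ip v v)"
    by (rule tendsto_mult[OF tendsto_real_sqrt[OF partial_sums_L2[OF u]] tendsto_const])
  then have "(\<lambda>n. sqrt (ip (?T n - u) (?T n - u)) * sqrt (ip v v)) \<longlonglongrightarrow> 0" by simp
  moreover have "\<bar>ip (?T n - u) v\<bar> \<le> sqrt (ip (?T n - u) (?T n - u)) * sqrt (ip v v)" for n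
    using u v by (intro ip.abs_le) auto
  ultimately have "(\<lambda>n. ip (?T n - u) v) \<longlonglongrightarrow> 0" by (rule null_by_bound[rotated])
  then have "(\<lambda>n. ip (?T n) v - ip u v) \<longlonglongrightarrow> 0" using u v by (simp add: ip.diff_left)
  then have "(\<lambda>n. ip (?T n) v) \<longlonglongrightarrow> ip u v" by (rule LIM_zero_cancel)
  then show ?thesis using 1 LIMSEQ_unique by blast
qed

lemma B_cong: "(\<And>k. c u k = c u' k) \<Longrightarrow> (\<And>k. c v k = c v' k) \<Longrightarrow> B w u v = B w u' v'"
  by (simp add: B_def)

lemma AE_subseq_of_L2:
  assumes f: "\<And>n. f n \<in> L2_per L" and g: "g \<in> L2_per L"
    and lim: "(\<lambda>n. ip (f n - g) (f n - g)) \<longlonglongrightarrow> 0"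
  obtains r :: "nat \<Rightarrow> nat" where "strict_mono r" "AE x in MP. (\<lambda>n. f (r n) x) \<longlonglongrightarrow> g x"
proof -
  let ?u = "\<lambda>n x. (f n x - g x)\<^sup>2"
  have "integrable MP (?u n)" for n using L2_perD(2)[OF L2_closed(2)[OF f[of n] g]] by simp
  moreover have "(\<lambda>n. \<integral>x. norm (?u n x) \<partial>MP) \<longlonglongrightarrow> 0"
    using lim by (simp add: ip_def power2_eq_square)
  ultimately obtain r :: "nat \<Rightarrow> nat" where r: "strict_mono r" "AE x in MP. (\<lambda>n. ?u (r n) x) \<longlonglongrightarrow> 0"
    using tendsto_L1_AE_subseq[of MP ?u] by blast
  show thesis
  proof (rule that[OF r(1)], use r(2) in eventually_elim)
    fix x assume "(\<lambda>n. ?u (r n) x) \<longlonglongrightarrow> 0"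
    then have "(\<lambda>n. sqrt (?u (r n) x)) \<longlonglongrightarrow> sqrt 0" by (rule tendsto_real_sqrt)
    then have "(\<lambda>n. \<bar>f (r n) x - g x\<bar>) \<longlonglongrightarrow> 0" by simp
    then show "(\<lambda>n. f (r n) x) \<longlonglongrightarrow> g x" by (rule LIM_zero_cancel[OF tendsto_rabs_zero_cancel])
  qed
qed

section \<open>Translations\<close>

text \<open>Modulo the period, a translation by \<open>y'\<close> in \<open>[0, L)\<close> exchanges the two pieces into which \<open>y'\<close> cuts the
period.\<close>

lemma shift_integral:
  fixes f :: "real \<Rightarrow> 'a::{banach, second_countable_topology}"
  assumes per: "\<And>x. f (x + L) = f x" and [measurable]: "f \<in> borel_measurable borel" and int: "integrable MP f"
  shows "integrable MP (\<lambda>x. f (x + y))" "(\<integral>x. f (x + y) \<partial>MP) = (\<integral>x. f x \<partial>MP)"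
proof -
  let ?h = "\<lambda>A x. indicator A x *\<^sub>R f x"
  define y' where "y' = y - of_int \<lfloor>y / L\<rfloor> * L"
  have y': "0 \<le> y'" "y' < L"
    using L_pos floor_divide_lower[of L y] floor_divide_upper[of L y] by (auto simp: y'_def algebra_simps)
  have fy: "f (x + y) = f (x + y')" for x
    using periodic_int[of f "x + y'" "\<lfloor>y / L\<rfloor>", OF per] by (simp add: y'_def)
  have intA: "integrable lborel (?h A)" if "A \<subseteq> {0..L}" "A \<in> sets borel" for A
  proof -
    have "integrable lborel (?h {0..L})" using int by (simp add: integrable_restrict_space)
    from integrable_mult_indicator[OF _ this, of A] that
    show ?thesis by (simp add: indicator_inter_arith[symmetric] Int_absorb2)
  qed
  have sh: "integrable lborel (\<lambda>x. ?h A (x + t))" "(\<integral>x. ?h A (x + t) \<partial>lborel) = (\<integral>x. ?h A x \<partial>lborel)"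
    if "A \<subseteq> {0..L}" "A \<in> sets borel" for A t
    using lborel_integrable_real_affine[OF intA[OF that], of 1 t] lborel_integral_real_affine[of 1 "?h A" t]
    by (simp_all add: add.commute)
  have split: "indicator {0..<L} x *\<^sub>R f (x + y') = ?h {y'..<L} (x + y') + ?h {0..<y'} (x + (y' - L))" for x
  proof -
    have "f (x + (y' - L)) = f (x + y')" using per[of "x + (y' - L)"] by (simp add: algebra_simps)
    then show ?thesis using y' by (auto simp: indicator_def)
  qed
  have s1: "{y'..<L} \<subseteq> {0..L}" "{0..<y'} \<subseteq> {0..L}" "{0..<L} \<subseteq> {0..L}" using y' by auto
  have i1: "integrable lborel (\<lambda>x. indicator {0..<L} x *\<^sub>R f (x + y'))"
    unfolding split by (intro Bochner_Integration.integrable_add sh(1) s1) auto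
  have "(\<integral>x. indicator {0..<L} x *\<^sub>R f (x + y') \<partial>lborel) = (\<integral>x. ?h {y'..<L} x \<partial>lborel) + (\<integral>x. ?h {0..<y'} x \<partial>lborel)"
    unfolding split by (subst Bochner_Integration.integral_add) (use sh s1 in auto)
  also have "\<dots> = (\<integral>x. ?h {y'..<L} x + ?h {0..<y'} x \<partial>lborel)"
    by (subst Bochner_Integration.integral_add) (use intA s1 in auto)
  also have "\<dots> = (\<integral>x. ?h {0..<L} x \<partial>lborel)"
    by (rule Bochner_Integration.integral_cong) (use y' in \<open>auto simp: indicator_def\<close>)
  finally have i2: "(\<integral>x. indicator {0..<L} x *\<^sub>R f (x + y') \<partial>lborel) = (\<integral>x. ?h {0..<L} x \<partial>lborel)" .
  have ae: "AE x in lborel. indicator {0..L} x *\<^sub>R g x = indicator {0..<L} x *\<^sub>R g x" for g :: "real \<Rightarrow> 'a"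
    using AE_lborel_singleton[of L] by eventually_elim (auto simp: indicator_def)
  have "integrable lborel (\<lambda>x. indicator {0..L} x *\<^sub>R f (x + y'))"
    using i1 by (rule integrable_cong_AE_imp) (use ae[of "\<lambda>x. f (x + y')"] in auto)
  then show "integrable MP (\<lambda>x. f (x + y))" by (simp add: integrable_restrict_space fy)
  have "(\<integral>x. indicator {0..L} x *\<^sub>R f (x + y') \<partial>lborel) = (\<integral>x. ?h {0..L} x \<partial>lborel)"
    using integral_cong_AE[OF _ _ ae[of "\<lambda>x. f (x + y')"]] integral_cong_AE[OF _ _ ae[of f]] i2 by simp
  then show "(\<integral>x. f (x + y) \<partial>MP) = (\<integral>x. f x \<partial>MP)" by (simp add: integral_restrict_space fy)
qed

definition shift :: "real \<Rightarrow> (real \<Rightarrow> real) \<Rightarrow> real \<Rightarrow> real" where "shift y u x = u (x + y)"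

lemma shift_measurable: "u \<in> borel_measurable borel \<Longrightarrow> shift y u \<in> borel_measurable borel"
  unfolding shift_def[abs_def] by (rule measurable_compose[where N = borel]) measurable

lemma shift_L2 [simp, intro]: "u \<in> L2_per L \<Longrightarrow> shift y u \<in> L2_per L"
proof -
  assume u: "u \<in> L2_per L"
  note [measurable] = L2_perD(1)[OF u]
  have "integrable MP (\<lambda>x. (u (x + y))\<^sup>2)"
    using shift_integral(1)[of "\<lambda>x. (u x)\<^sup>2" y] L2_perD(2,3)[OF u] by simp
  moreover have "u (x + L + y) = u (x + y)" for x using L2_perD(3)[OF u, of "x + y"] by (simp add: ac_simps)
  ultimately show ?thesis using shift_measurable[OF L2_perD(1)[OF u]]
    by (simp add: L2_per_iff periodic_def shift_def)
qed

lemma c_shift: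
  assumes u: "u \<in> L2_per L"
  shows "c (shift y u) k = ek k y * c u k"
proof -
  note [measurable] = L2_perD(1)[OF u]
  have "(\<integral>x. complex_of_real (u (x + y)) * ek (- k) (x + y) \<partial>MP) = (\<integral>x. complex_of_real (u x) * ek (- k) x \<partial>MP)"
    by (rule shift_integral(2)) (use u L2_perD(3)[OF u] in \<open>auto intro!: integrable_ek integrable_L2\<close>)
  moreover have "complex_of_real (u (x + y)) * ek (- k) x = ek k y * (complex_of_real (u (x + y)) * ek (- k) (x + y))" for x
  proof -
    have "ek k y * ek (- k) y = 1" using ek_add[of k "- k" y] by simp
    then have "ek (- k) x = ek k y * ek (- k) (x + y)" by (simp add: ek_plus mult.left_commute)
    then show ?thesis by (metis mult.left_commute)
  qed
  ultimately have "(\<integral>x. complex_of_real (u (x + y)) * ek (- k) x \<partial>MP) = ek k y * (\<integral>x. complex_of_real (u x) * ek (- k) x \<partial>MP)"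
    by (simp only: integral_mult_right_zero)
  then show ?thesis by (simp add: c_eq shift_def)
qed

lemma shift_Hw [simp, intro]: "u \<in> Hw w \<Longrightarrow> shift y u \<in> Hw w"
  by (auto simp: Hw_def c_shift norm_mult)

lemma B_shift:
  assumes "u \<in> L2_per L" "v \<in> L2_per L"
  shows "B w (shift y u) (shift y v) = B w u v"
proof -
  have "c (shift y u) k * cnj (c (shift y v) k) = c u k * cnj (c v k)" for k
  proof -
    have "c (shift y u) k * cnj (c (shift y v) k) = (ek k y * ek (- k) y) * (c u k * cnj (c v k))"
      using assms by (simp add: c_shift ek_cnj)
    also have "ek k y * ek (- k) y = 1" using ek_add[of k "- k" y] by simp
    finally show ?thesis by simp
  qed
  then show ?thesis by (simp add: B_def)
qed

lemma shift_shift [simp]: "shift y (shift z u) = shift (y + z) u"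
  by (simp add: shift_def fun_eq_iff add.assoc)

lemma shift_0 [simp]: "shift 0 u = u" by (simp add: shift_def fun_eq_iff)

lemma shift_diff: "shift y (u - v) = shift y u - shift y v" by (simp add: shift_def fun_eq_iff)

section \<open>Weak derivatives\<close>

definition freq :: "int \<Rightarrow> real" where "freq k = 2 * pi * of_int k / L"

lemma ek_has_derivative: "((\<lambda>x. Re (z * ek k x)) has_real_derivative Re (z * (\<i> * freq k) * ek k x)) (at x)"
proof -
  have e: "Re (z * ek k x) = Re z * cos (freq k * x) - Im z * sin (freq k * x)" for z x
    by (simp add: ek_def freq_def times_complex.sel)
  show ?thesis unfolding e
    by (auto intro!: derivative_eq_intros simp: times_complex.sel algebra_simps)
qed

lemma deriv_trig: "deriv (\<lambda>x. Re (z * ek k x)) = (\<lambda>x. Re (z * (\<i> * freq k) * ek k x))"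
  using DERIV_imp_deriv[OF ek_has_derivative] by blast

lemma test_fun_trig: "test_fun L (\<lambda>x. Re (z * ek k x))"
proof -
  have "(deriv ^^ n) (\<lambda>x. Re (z * ek k x)) = (\<lambda>x. Re (z * (\<i> * freq k) ^ n * ek k x))" for n
  proof (induction n)
    case (Suc n)
    have "(deriv ^^ Suc n) (\<lambda>x. Re (z * ek k x)) = deriv (\<lambda>x. Re (z * (\<i> * freq k) ^ n * ek k x))"
      by (simp only: funpow.simps comp_def Suc)
    also have "\<dots> = (\<lambda>x. Re (z * (\<i> * freq k) ^ Suc n * ek k x))"
      unfolding deriv_trig power_Suc2 by (simp only: mult.assoc)
    finally show ?case .
  qed simp
  moreover have "(\<lambda>x. Re (z * ek k x)) differentiable_on UNIV" for z
    using ek_has_derivative by (meson differentiable_on_def differentiable_at_withinI real_differentiable_def)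
  ultimately show ?thesis by (simp add: test_fun_def periodic_def)
qed

lemma ip_trig: "v \<in> L2_per L \<Longrightarrow> ip v (\<lambda>x. Re (z * ek k x)) = L * Re (z * cnj (c v k))"
  using ip_tp[of v "\<lambda>_. z" "{k}"] by (simp add: tp_def[abs_def])

text \<open>Testing a real function against \<open>Re (z * ek k x)\<close> for all complex \<open>z\<close>, that is against a cosine and
a sine, determines its coefficient \<open>k\<close>.\<close>

lemma Re_mult_eq_imp: "(\<And>z. Re (z * a) = Re (z * b)) \<Longrightarrow> a = b"
  using spec[of _ 1] by (metis (no_types) complex_eq_iff mult_1 Re_i_times minus_equation_iff)

lemma weak_deriv_c:
  assumes g: "g \<in> L2_per L" and d: "weak_deriv L g d"
  shows "c d k = \<i> * freq k * c g k"
proof -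
  have dL: "d \<in> L2_per L" using d by (simp add: weak_deriv_def)
  have "cnj (c d k) = - (\<i> * freq k) * cnj (c g k)"
  proof (rule Re_mult_eq_imp)
    fix z
    have "ip d (\<lambda>x. Re (z * ek k x)) = - ip g (\<lambda>x. Re (z * (\<i> * freq k) * ek k x))"
      using d test_fun_trig[of z k] by (simp add: weak_deriv_def per_integral_eq ip_def deriv_trig)
    then have "L * Re (z * cnj (c d k)) = L * - Re (z * (\<i> * freq k) * cnj (c g k))"
      by (simp add: ip_trig dL g)
    then have "Re (z * cnj (c d k)) = - Re (z * (\<i> * freq k) * cnj (c g k))"
      using L_pos mult_left_cancel[of L] by blast
    then show "Re (z * cnj (c d k)) = Re (z * (- (\<i> * freq k) * cnj (c g k)))"
      by (simp add: mult.assoc)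
  qed
  then have "cnj (cnj (c d k)) = cnj (- (\<i> * freq k) * cnj (c g k))" by simp
  then show ?thesis by simp
qed

text \<open>The coefficients of a function with square integrable derivative are products of two square
summable sequences, namely the coefficients of the derivative and the inverse frequencies, so the
Fourier series converges absolutely.\<close>

lemma weak_deriv_bounded:
  assumes g: "g \<in> L2_per L" and d: "weak_deriv L g d"
  obtains C where "C > 0" "AE x in lborel. \<bar>g x\<bar> \<le> C"
proof -
  have dL: "d \<in> L2_per L" using d by (simp add: weak_deriv_def)
  let ?b = "\<lambda>k::int. (if k = 0 then norm (c g 0) else 0) + ((norm (c d k))\<^sup>2 + (L / (2 * pi))\<^sup>2 * 2 * (1 / (1 + (real_of_int k)\<^sup>2)))"
  have "norm (c g k) \<le> ?b k" for k
  proof (cases "k = 0")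
    case False
    define a where "a = L / (2 * pi) / \<bar>real_of_int k\<bar>"
    have "norm (c d k) = \<bar>freq k\<bar> * norm (c g k)" by (simp add: weak_deriv_c[OF g d] norm_mult)
    then have "norm (c g k) = a * norm (c d k)"
      using False L_pos by (simp add: freq_def a_def abs_mult field_simps)
    moreover have "0 \<le> (a - norm (c d k))\<^sup>2" by simp
    moreover have "0 \<le> a * norm (c d k)" using L_pos by (simp add: a_def)
    ultimately have "norm (c g k) \<le> (norm (c d k))\<^sup>2 + a\<^sup>2" unfolding power2_diff by linarith
    moreover have "a\<^sup>2 \<le> (L / (2 * pi))\<^sup>2 * 2 * (1 / (1 + (real_of_int k)\<^sup>2))"
    proof -
      have k1: "1 \<le> (real_of_int k)\<^sup>2" using False by (smt (verit) of_int_1 of_int_le_iff of_int_power power2_less_0 zero_less_power2 int_one_le_iff_zero_less)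
      have "a\<^sup>2 = (L / (2 * pi))\<^sup>2 * (1 / (real_of_int k)\<^sup>2)" by (simp add: a_def power_divide power_mult_distrib)
      also have "\<dots> \<le> (L / (2 * pi))\<^sup>2 * (2 * (1 / (1 + (real_of_int k)\<^sup>2)))"
      proof (intro mult_left_mono)
        show "1 / (real_of_int k)\<^sup>2 \<le> 2 * (1 / (1 + (real_of_int k)\<^sup>2))"
        proof -
          have "1 + (real_of_int k)\<^sup>2 \<le> 2 * (real_of_int k)\<^sup>2" "0 < (real_of_int k)\<^sup>2" using k1 by auto
          then have "2 * (1 / (2 * (real_of_int k)\<^sup>2)) \<le> 2 * (1 / (1 + (real_of_int k)\<^sup>2))" by (intro mult_left_mono divide_left_mono) auto
          then show ?thesis by simp
        qed
      qed simp
      finally show ?thesis by simp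
    qed
    ultimately show ?thesis using False by simp
  qed simp
  note bb = this
  have sb: "?b summable_on UNIV"
  proof (intro summable_on_add summable_on_cmult_right summable_c dL inverse_square_summable)
    show "(\<lambda>k::int. if k = 0 then norm (c g 0) else 0) summable_on UNIV"
      by (rule summable_on_cong_neutral[where T = "{0}" and g = "\<lambda>k. norm (c g 0)", THEN iffD2]) auto
  qed
  have sg: "(\<lambda>k. norm (c g k)) summable_on UNIV"
    by (rule summable_on_comparison_test[OF sb]) (rule bb, rule norm_ge_zero)
  let ?C = "infsum (\<lambda>k. norm (c g k)) UNIV"
  obtain r :: "nat \<Rightarrow> nat" where r: "strict_mono r" "AE x in MP. (\<lambda>n. tp (c g) (modes (r n)) x) \<longlonglongrightarrow> g x"
    using AE_subseq_of_L2[OF _ g partial_sums_L2[OF g]] by auto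
  have bd: "\<bar>tp (c g) (modes n) x\<bar> \<le> ?C" for n x
    by (rule order_trans[OF abs_tp_le]) (rule finite_sum_le_infsum[OF sg], auto)
  have "AE x in MP. \<bar>g x\<bar> \<le> ?C + 1"
    using r(2)
  proof eventually_elim
    case (elim x)
    then have "(\<lambda>n. \<bar>tp (c g) (modes (r n)) x\<bar>) \<longlonglongrightarrow> \<bar>g x\<bar>" by (rule tendsto_rabs)
    then have "\<bar>g x\<bar> \<le> ?C" by (rule LIMSEQ_le_const2) (use bd in auto)
    then show ?case by simp
  qed
  then have "AE x in lborel. \<bar>g x\<bar> \<le> ?C + 1"
    by (intro AE_periodic) (simp_all add: L2_perD(3)[OF g])
  moreover have "?C + 1 > 0" using infsum_nonneg[of UNIV "\<lambda>k. norm (c g k)"] by simp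
  ultimately show thesis by (intro that)
qed

end

section \<open>Cubes of Sobolev functions are integrable\<close>

text \<open>The Cauchy-Schwarz inequality, applied twice, bounds the square of each weighted power sum by the
product of its two neighbours.\<close>

lemma cubic_mean_ineq:
  fixes w x :: "'a \<Rightarrow> real"
  assumes w: "\<And>i. i \<in> I \<Longrightarrow> 0 \<le> w i" and x: "\<And>i. i \<in> I \<Longrightarrow> 0 \<le> x i"
  shows "(\<Sum>i\<in>I. w i * x i) ^ 3 \<le> (\<Sum>i\<in>I. w i)\<^sup>2 * (\<Sum>i\<in>I. w i * x i ^ 3)"
proof -
  define A where "A = (\<Sum>i\<in>I. w i * x i)"
  define A2 where "A2 = (\<Sum>i\<in>I. w i * x i ^ 2)"
  define A3 where "A3 = (\<Sum>i\<in>I. w i * x i ^ 3)"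
  define W where "W = (\<Sum>i\<in>I. w i)"
  have nn: "0 \<le> A" "0 \<le> A2" "0 \<le> A3" "0 \<le> W"
    unfolding A_def A2_def A3_def W_def by (intro sum_nonneg mult_nonneg_nonneg zero_le_power w x; assumption)+
  have "(\<Sum>i\<in>I. sqrt (w i) * (sqrt (w i) * x i))\<^sup>2 \<le> (\<Sum>i\<in>I. (sqrt (w i))\<^sup>2) * (\<Sum>i\<in>I. (sqrt (w i) * x i)\<^sup>2)"
    by (rule Cauchy_Schwarz_ineq_sum)
  moreover have "(\<Sum>i\<in>I. sqrt (w i) * (sqrt (w i) * x i)) = A" unfolding A_def
    by (rule sum.cong) (use w in \<open>auto simp: mult.assoc[symmetric]\<close>)
  moreover have "(\<Sum>i\<in>I. (sqrt (w i))\<^sup>2) = W" unfolding W_def by (rule sum.cong) (use w in auto)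
  moreover have "(\<Sum>i\<in>I. (sqrt (w i) * x i)\<^sup>2) = A2" unfolding A2_def
    by (rule sum.cong) (use w in \<open>auto simp: power_mult_distrib\<close>)
  ultimately have 1: "A\<^sup>2 \<le> W * A2" by simp
  have "(\<Sum>i\<in>I. sqrt (w i * x i) * (sqrt (w i * x i) * x i))\<^sup>2 \<le> (\<Sum>i\<in>I. (sqrt (w i * x i))\<^sup>2) * (\<Sum>i\<in>I. (sqrt (w i * x i) * x i)\<^sup>2)"
    by (rule Cauchy_Schwarz_ineq_sum)
  moreover have "(\<Sum>i\<in>I. sqrt (w i * x i) * (sqrt (w i * x i) * x i)) = A2" unfolding A2_def
    by (rule sum.cong) (use w x in \<open>auto simp: mult.assoc[symmetric] power2_eq_square abs_mult\<close>)
  moreover have "(\<Sum>i\<in>I. (sqrt (w i * x i))\<^sup>2) = A" unfolding A_def by (rule sum.cong) (use w x in auto)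
  moreover have "(\<Sum>i\<in>I. (sqrt (w i * x i) * x i)\<^sup>2) = A3" unfolding A3_def
    by (rule sum.cong) (use w x in \<open>auto simp: power_mult_distrib power2_eq_square power3_eq_cube\<close>)
  ultimately have 2: "A2\<^sup>2 \<le> A * A3" by simp
  have "A ^ 3 \<le> W\<^sup>2 * A3"
  proof (cases "A = 0")
    case False
    have "A * A ^ 3 = (A\<^sup>2)\<^sup>2" by (simp add: power2_eq_square power3_eq_cube)
    also have "\<dots> \<le> (W * A2)\<^sup>2" using 1 by (intro power_mono) auto
    also have "\<dots> = W\<^sup>2 * A2\<^sup>2" by (rule power_mult_distrib)
    also have "\<dots> \<le> W\<^sup>2 * (A * A3)" using 2 by (intro mult_left_mono) auto
    finally have "A * A ^ 3 \<le> A * (W\<^sup>2 * A3)" by (simp add: mult.left_commute)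
    then show ?thesis using False nn by simp
  qed (use nn in auto)
  then show ?thesis by (simp add: A_def A3_def W_def)
qed

context period
begin

definition wt :: "real \<Rightarrow> int \<Rightarrow> real" where "wt s k = (1 + (real_of_int k)\<^sup>2) powr s"

lemma wt_nonneg [simp]: "0 \<le> wt s k" by (simp add: wt_def)

lemma wt_ge_1: "0 \<le> s \<Longrightarrow> 1 \<le> wt s k" by (simp add: wt_def ge_one_powr_ge_zero)

definition dyad :: "nat \<Rightarrow> int set" where
  "dyad j = {k. (j = 0 \<or> 2 ^ (j - 1) \<le> \<bar>k\<bar>) \<and> \<bar>k\<bar> < 2 ^ j}"

lemma finite_dyad: "finite (dyad j)"
  by (rule finite_subset[of _ "{- (2 ^ j)..2 ^ j}"]) (auto simp: dyad_def abs_if split: if_splits)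

lemma card_dyad: "card (dyad j) \<le> 2 * 2 ^ j"
proof -
  have "card (dyad j) \<le> card {- (2 ^ j)<..<(2 ^ j :: int)}"
    by (rule card_mono) (auto simp: dyad_def abs_if split: if_splits)
  also have "\<dots> \<le> nat (2 * 2 ^ j)" by simp
  also have "\<dots> = 2 * 2 ^ j" by (simp add: nat_mult_distrib nat_power_eq)
  finally show ?thesis .
qed

lemma dyad_sum: "(\<Sum>j\<le>J. \<Sum>k\<in>dyad j. f k) = (\<Sum>k\<in>modes (2 ^ J - 1). f k :: real)"
proof (induction J)
  case 0
  have "dyad 0 = {0}" by (auto simp: dyad_def)
  then show ?case by simp
next
  case (Suc J)
  have m: "modes (2 ^ n - 1) = {k. \<bar>k\<bar> < 2 ^ n}" for n
    by (auto simp: of_nat_diff abs_if split: if_splits)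
  have "modes (2 ^ Suc J - 1) = modes (2 ^ J - 1) \<union> dyad (Suc J)"
    unfolding m by (auto simp: dyad_def)
  moreover have "modes (2 ^ J - 1) \<inter> dyad (Suc J) = {}" unfolding m by (auto simp: dyad_def)
  ultimately have "(\<Sum>k\<in>modes (2 ^ Suc J - 1). f k) = (\<Sum>k\<in>modes (2 ^ J - 1). f k) + (\<Sum>k\<in>dyad (Suc J). f k)"
    by (simp add: sum.union_disjoint finite_dyad)
  then show ?case using Suc by simp
qed

text \<open>On a dyadic block of \<open>2 ^ j\<close> modes the supremum norm is at most \<open>2 ^ (j/2)\<close> times the mean square
norm, up to a constant, and the latter gains a factor \<open>2 powr (- s * j)\<close> from the Sobolev norm. With
\<open>z = 4 powr (- s)\<close> the cube thus has integral of order \<open>(sqrt 2 * sqrt z ^ 3) ^ j\<close>.\<close>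

lemma integral_cube_dyad:
  assumes s: "s > 0" and u: "u \<in> Hw (wt s)"
  defines "h \<equiv> 4 powr s * (B (wt s) u u / L)" and "z \<equiv> 1 / 4 powr s"
  shows "integrable MP (\<lambda>x. \<bar>tp (c u) (dyad j) x\<bar> ^ 3)"
    "(\<integral>x. \<bar>tp (c u) (dyad j) x\<bar> ^ 3 \<partial>MP) \<le> sqrt 2 * L * sqrt h ^ 3 * (sqrt 2 * sqrt z ^ 3) ^ j"
proof -
  define E where "E = (\<Sum>k\<in>dyad j. (norm (c u k))\<^sup>2)"
  let ?b = "tp (c u) (dyad j)"
  have Z: "1 \<le> 4 powr s" using s by (intro ge_one_powr_ge_zero) auto
  have sum: "(\<lambda>k. wt s k * (norm (c u k))\<^sup>2) summable_on UNIV" using u by (simp add: Hw_def)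
  have z0: "0 < z" by (simp add: z_def)
  have wtj: "1 \<le> 4 powr s * z ^ j * wt s k" if "k \<in> dyad j" for k
  proof (cases j)
    case 0
    then show ?thesis using mult_mono[OF Z wt_ge_1[of s k]] s by simp
  next
    case (Suc i)
    have "2 ^ i \<le> \<bar>k\<bar>" using that Suc by (simp add: dyad_def)
    then have "2 ^ i \<le> \<bar>real_of_int k\<bar>" by (metis of_int_abs of_int_le_iff of_int_numeral of_int_power)
    then have "(2 ^ i)\<^sup>2 \<le> (real_of_int k)\<^sup>2" by (metis abs_ge_zero power2_abs power_mono zero_le_numeral zero_le_power)
    then have "4 ^ i \<le> 1 + (real_of_int k)\<^sup>2" by (simp add: power_mult[symmetric] mult.commute[of i 2] power_mult)
    then have "(4 ^ i) powr s \<le> wt s k" unfolding wt_def using s by (intro powr_mono2) auto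
    also have "(4 ^ i :: real) powr s = (4 powr s) ^ i"
      by (simp add: powr_realpow[symmetric] powr_powr mult.commute)
    finally have "(4 powr s) ^ i \<le> wt s k" .
    then have "4 powr s * z ^ j * (4 powr s) ^ i \<le> 4 powr s * z ^ j * wt s k"
      using z0 by (intro mult_left_mono) auto
    moreover have "4 powr s * z ^ j * (4 powr s) ^ i = 1"
      using Z by (simp add: Suc z_def power_divide)
    ultimately show ?thesis by simp
  qed
  have h0: "0 \<le> h" unfolding h_def B_self
    using L_pos by (auto intro!: mult_nonneg_nonneg infsum_nonneg)
  have Ele: "E \<le> h * z ^ j"
  proof -
    have "E \<le> (\<Sum>k\<in>dyad j. 4 powr s * z ^ j * (wt s k * (norm (c u k))\<^sup>2))"
      unfolding E_def
    proof (rule sum_mono)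
      fix k assume "k \<in> dyad j"
      from mult_right_mono[OF wtj[OF this], of "(norm (c u k))\<^sup>2"]
      show "(norm (c u k))\<^sup>2 \<le> 4 powr s * z ^ j * (wt s k * (norm (c u k))\<^sup>2)" by (simp add: mult.assoc)
    qed
    also have "\<dots> = 4 powr s * z ^ j * (\<Sum>k\<in>dyad j. wt s k * (norm (c u k))\<^sup>2)"
      by (simp add: sum_distrib_left)
    also have "\<dots> \<le> 4 powr s * z ^ j * (\<Sum>\<^sub>\<infinity>k. wt s k * (norm (c u k))\<^sup>2)"
      using z0 by (intro mult_left_mono finite_sum_le_infsum sum finite_dyad) auto
    also have "\<dots> = h * z ^ j" using L_pos by (simp add: h_def B_self)
    finally show ?thesis .
  qed
  have E0: "0 \<le> E" unfolding E_def by (intro sum_nonneg) auto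
  define M where "M = sqrt 2 * sqrt 2 ^ j * sqrt E"
  have M0: "0 \<le> M" unfolding M_def by (intro mult_nonneg_nonneg zero_le_power) (use E0 in auto)
  have sup: "\<bar>?b x\<bar> \<le> M" for x
  proof -
    have "(\<Sum>k\<in>dyad j. norm (c u k))\<^sup>2 \<le> real (card (dyad j)) * E"
      using Cauchy_Schwarz_ineq_sum[of "\<lambda>_. 1" "\<lambda>k. norm (c u k)" "dyad j"] by (simp add: E_def)
    also have "\<dots> \<le> (2 * 2 ^ j) * E"
    proof (rule mult_right_mono[OF _ E0])
      have "real (card (dyad j)) \<le> real (2 * 2 ^ j)" using card_dyad[of j] by (rule of_nat_mono)
      then show "real (card (dyad j)) \<le> 2 * 2 ^ j" by simp
    qed
    also have "\<dots> = M\<^sup>2"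
    proof -
      have "(sqrt 2 ^ j)\<^sup>2 = (2::real) ^ j" 
        by (metis mult.commute power_mult real_sqrt_pow2 zero_le_numeral)
      then show ?thesis using E0 by (simp add: M_def power_mult_distrib)
    qed
    finally have "(\<Sum>k\<in>dyad j. norm (c u k)) \<le> M" using M0 by (rule power2_le_imp_le)
    then show ?thesis using abs_tp_le[of "c u" "dyad j" x] by linarith
  qed
  have [measurable]: "?b \<in> borel_measurable borel" by (rule borel_measurable_continuous_onI[OF tp_continuous])
  have cube: "\<bar>?b x\<bar> ^ 3 \<le> M * (?b x)\<^sup>2" for x
    using mult_right_mono[OF sup, of "(?b x)\<^sup>2" x] by (simp add: power3_eq_cube power2_eq_square)
  have i2: "integrable MP (\<lambda>x. M * (?b x)\<^sup>2)" using L2_perD(2)[OF tp_L2] by simp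
  show i3: "integrable MP (\<lambda>x. \<bar>?b x\<bar> ^ 3)"
  proof (rule Bochner_Integration.integrable_bound[OF i2])
    show "(\<lambda>x. \<bar>?b x\<bar> ^ 3) \<in> borel_measurable MP" by (rule measurable_MP) measurable
    show "AE x in MP. norm (\<bar>?b x\<bar> ^ 3) \<le> norm (M * (?b x)\<^sup>2)"
      using cube M0 by (intro AE_I2) (simp add: abs_mult)
  qed
  have "(\<integral>x. \<bar>?b x\<bar> ^ 3 \<partial>MP) \<le> (\<integral>x. M * (?b x)\<^sup>2 \<partial>MP)"
    by (rule integral_mono[OF i3 i2]) (rule cube)
  also have "\<dots> = M * ip ?b ?b" by (simp add: ip_def power2_eq_square)
  also have "ip ?b ?b = L * E" unfolding E_def
    by (rule ip_tp_tp[OF finite_dyad]) (auto simp: c_minus_index dyad_def)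
  also have "M * (L * E) = sqrt 2 * L * sqrt 2 ^ j * sqrt E ^ 3"
    using E0 by (simp add: M_def power3_eq_cube)
  also have "\<dots> \<le> sqrt 2 * L * sqrt 2 ^ j * sqrt (h * z ^ j) ^ 3"
    using Ele E0 L_pos by (intro mult_left_mono power_mono) auto
  also have "\<dots> = sqrt 2 * L * sqrt h ^ 3 * (sqrt 2 * sqrt z ^ 3) ^ j"
    by (simp add: real_sqrt_mult real_sqrt_power power_mult_distrib power_mult[symmetric] mult.commute)
  finally show "(\<integral>x. \<bar>?b x\<bar> ^ 3 \<partial>MP) \<le> sqrt 2 * L * sqrt h ^ 3 * (sqrt 2 * sqrt z ^ 3) ^ j" .
qed

lemma geometric_sum_le:
  fixes r :: real assumes "0 \<le> r" "r < 1" shows "(\<Sum>j\<le>J. r ^ j) \<le> 1 / (1 - r)"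
proof -
  have "(\<Sum>j\<le>J. r ^ j) = (1 - r ^ Suc J) / (1 - r)" using assms sum_gp_basic[of r J] by (simp add: field_simps)
  also have "\<dots> \<le> 1 / (1 - r)" using assms by (intro divide_right_mono) auto
  finally show ?thesis .
qed

text \<open>The ratio \<open>q = sqrt 2 * sqrt z ^ 3\<close> of the bounds for consecutive dyadic blocks is less than one
exactly when \<open>s > 1/6\<close>. Geometric weights \<open>r ^ j\<close> with \<open>r\<^sup>2 = sqrt q\<close> split the decay evenly: they are
summable, and dividing the bound for block \<open>j\<close> by \<open>r ^ (2 * j)\<close> still leaves \<open>sqrt q ^ j\<close>. The partial
sums are therefore bounded in \<open>L\<^sup>3\<close>, and Fatou's lemma passes to the limit.\<close>

theorem sobolev_L3:
  assumes s: "s > 1/6"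
  obtains C where "C > 0" "\<And>u. u \<in> Hw (wt s) \<Longrightarrow> integrable MP (\<lambda>x. \<bar>u x\<bar> ^ 3)"
    "\<And>u. u \<in> Hw (wt s) \<Longrightarrow> (\<integral>x. \<bar>u x\<bar> ^ 3 \<partial>MP) \<le> C * sqrt (B (wt s) u u) ^ 3"
proof -
  define z where "z = 1 / (4::real) powr s"
  define q where "q = sqrt 2 * sqrt z ^ 3"
  have z0: "0 < z" by (simp add: z_def)
  have q0: "0 < q" using z0 by (simp add: q_def)
  have "z ^ 3 = 4 powr (- 3 * s)"
    by (simp add: z_def powr_minus_divide powr_power mult.commute power_divide)
  also have "\<dots> < 4 powr (- (1/2))" using s by (intro powr_less_mono) auto
  also have "\<dots> = 1 / 2" by (simp add: powr_minus powr_half_sqrt)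
  finally have "z ^ 3 < 1 / 2" .
  moreover have "q\<^sup>2 = 2 * z ^ 3"
  proof -
    have "(sqrt z ^ 3)\<^sup>2 = ((sqrt z)\<^sup>2) ^ 3" by (simp flip: power_mult)
    then show ?thesis using z0 by (simp add: q_def power_mult_distrib)
  qed
  ultimately have "q\<^sup>2 < 1\<^sup>2" by simp
  then have q1: "q < 1" using power2_less_imp_less[of q 1] by simp
  define r where "r = sqrt (sqrt q)"
  have r: "0 < r" "r < 1" using q0 q1 by (auto simp: r_def)
  have r2: "r\<^sup>2 = sqrt q" using q0 by (simp add: r_def)
  have sq: "0 < sqrt q" "sqrt q < 1" using q0 q1 by auto
  define C0 where "C0 = (1 / (1 - r))\<^sup>2 * (sqrt 2 * L * (1 / (1 - sqrt q)))"
  define C where "C = C0 * sqrt (4 powr s / L) ^ 3"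
  have C: "C > 0" using r sq L_pos by (simp add: C_def C0_def)
  have main: "integrable MP (\<lambda>x. \<bar>u x\<bar> ^ 3) \<and> (\<integral>x. \<bar>u x\<bar> ^ 3 \<partial>MP) \<le> C * sqrt (B (wt s) u u) ^ 3"
    if u: "u \<in> Hw (wt s)" for u
  proof -
    have uL: "u \<in> L2_per L" using u Hw_L2 by blast
    note [measurable] = L2_perD(1)[OF uL]
    define h where "h = 4 powr s * (B (wt s) u u / L)"
    let ?b = "\<lambda>j. tp (c u) (dyad j)"
    let ?S = "\<lambda>J. tp (c u) (modes (2 ^ J - 1))"
    note blk = integral_cube_dyad[of s u, folded h_def z_def q_def, OF _ u]
    have h0: "0 \<le> h" unfolding h_def B_self
      using L_pos by (auto intro!: mult_nonneg_nonneg infsum_nonneg)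
    have S: "?S J x = (\<Sum>j\<le>J. ?b j x)" for J x
      unfolding tp_def by (rule dyad_sum[symmetric])
    have pw: "\<bar>?S J x\<bar> ^ 3 \<le> (1 / (1 - r))\<^sup>2 * (\<Sum>j\<le>J. \<bar>?b j x\<bar> ^ 3 / sqrt q ^ j)" for J x
    proof -
      have "\<bar>?S J x\<bar> \<le> (\<Sum>j\<le>J. r ^ j * (\<bar>?b j x\<bar> / r ^ j))"
        unfolding S using r by (intro order_trans[OF sum_abs] sum_mono) simp
      then have "\<bar>?S J x\<bar> ^ 3 \<le> (\<Sum>j\<le>J. r ^ j * (\<bar>?b j x\<bar> / r ^ j)) ^ 3" by (intro power_mono) auto
      also have "\<dots> \<le> (\<Sum>j\<le>J. r ^ j)\<^sup>2 * (\<Sum>j\<le>J. r ^ j * (\<bar>?b j x\<bar> / r ^ j) ^ 3)"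
        by (rule cubic_mean_ineq) (use r in auto)
      also have "\<dots> \<le> (1 / (1 - r))\<^sup>2 * (\<Sum>j\<le>J. r ^ j * (\<bar>?b j x\<bar> / r ^ j) ^ 3)"
        using geometric_sum_le[of r J] r by (intro mult_right_mono power_mono sum_nonneg) auto
      also have "(\<Sum>j\<le>J. r ^ j * (\<bar>?b j x\<bar> / r ^ j) ^ 3) = (\<Sum>j\<le>J. \<bar>?b j x\<bar> ^ 3 / sqrt q ^ j)"
      proof (rule sum.cong[OF refl])
        fix j
        have "r ^ j * (\<bar>?b j x\<bar> / r ^ j) ^ 3 = \<bar>?b j x\<bar> ^ 3 / (r ^ j)\<^sup>2"
          using r by (simp add: power_divide power3_eq_cube power2_eq_square)
        also have "(r ^ j)\<^sup>2 = sqrt q ^ j" by (simp add: r2[symmetric] power_mult[symmetric] mult.commute)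
        finally show "r ^ j * (\<bar>?b j x\<bar> / r ^ j) ^ 3 = \<bar>?b j x\<bar> ^ 3 / sqrt q ^ j" .
      qed
      finally show ?thesis .
    qed
    have iR: "integrable MP (\<lambda>x. (1 / (1 - r))\<^sup>2 * (\<Sum>j\<le>J. \<bar>?b j x\<bar> ^ 3 / sqrt q ^ j))" for J
      using blk(1) s by (intro integrable_mult_right Bochner_Integration.integrable_sum integrable_divide) auto
    have [measurable]: "tp (c u) F \<in> borel_measurable borel" for F
      by (rule borel_measurable_continuous_onI[OF tp_continuous])
    have iS: "integrable MP (\<lambda>x. \<bar>?S J x\<bar> ^ 3)" for J
    proof (rule Bochner_Integration.integrable_bound[OF iR[of J]])
      show "(\<lambda>x. \<bar>?S J x\<bar> ^ 3) \<in> borel_measurable MP" by (rule measurable_MP) measurable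
      show "AE x in MP. norm (\<bar>?S J x\<bar> ^ 3) \<le> norm ((1 / (1 - r))\<^sup>2 * (\<Sum>j\<le>J. \<bar>?b j x\<bar> ^ 3 / sqrt q ^ j))"
      proof (rule AE_I2)
        fix x
        show "norm (\<bar>?S J x\<bar> ^ 3) \<le> norm ((1 / (1 - r))\<^sup>2 * (\<Sum>j\<le>J. \<bar>?b j x\<bar> ^ 3 / sqrt q ^ j))"
          using pw[of J x] unfolding real_norm_def by (smt (verit) zero_le_power abs_ge_zero)
      qed
    qed
    have le: "(\<integral>x. \<bar>?S J x\<bar> ^ 3 \<partial>MP) \<le> C0 * sqrt h ^ 3" for J
    proof -
      have "(\<integral>x. \<bar>?S J x\<bar> ^ 3 \<partial>MP) \<le> (\<integral>x. (1 / (1 - r))\<^sup>2 * (\<Sum>j\<le>J. \<bar>?b j x\<bar> ^ 3 / sqrt q ^ j) \<partial>MP)"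
        by (rule integral_mono[OF iS iR]) (rule pw)
      also have "\<dots> = (1 / (1 - r))\<^sup>2 * (\<Sum>j\<le>J. (\<integral>x. \<bar>?b j x\<bar> ^ 3 \<partial>MP) / sqrt q ^ j)"
        using blk(1) s by (simp add: Bochner_Integration.integral_sum integrable_divide)
      also have "\<dots> \<le> (1 / (1 - r))\<^sup>2 * (\<Sum>j\<le>J. (sqrt 2 * L * sqrt h ^ 3) * sqrt q ^ j)"
      proof (intro mult_left_mono sum_mono)
        fix j
        have "(\<integral>x. \<bar>?b j x\<bar> ^ 3 \<partial>MP) / sqrt q ^ j \<le> (sqrt 2 * L * sqrt h ^ 3 * q ^ j) / sqrt q ^ j"
          using blk(2)[of j] s sq by (intro divide_right_mono) auto
        also have "q ^ j = sqrt q ^ j * sqrt q ^ j" using q0 by (simp add: power_mult_distrib[symmetric])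
        finally show "(\<integral>x. \<bar>?b j x\<bar> ^ 3 \<partial>MP) / sqrt q ^ j \<le> (sqrt 2 * L * sqrt h ^ 3) * sqrt q ^ j"
          using sq by simp
      qed simp
      also have "\<dots> = (1 / (1 - r))\<^sup>2 * ((sqrt 2 * L * sqrt h ^ 3) * (\<Sum>j\<le>J. sqrt q ^ j))"
        by (simp add: sum_distrib_left)
      also have "\<dots> \<le> (1 / (1 - r))\<^sup>2 * ((sqrt 2 * L * sqrt h ^ 3) * (1 / (1 - sqrt q)))"
        using geometric_sum_le[of "sqrt q" J] sq L_pos h0 by (intro mult_left_mono mult_nonneg_nonneg) auto
      finally show ?thesis by (simp add: C0_def ac_simps)
    qed
    have "strict_mono (\<lambda>J::nat. 2 ^ J - 1 :: nat)"
      by (rule strict_monoI) (simp add: diff_less_mono)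
    from LIMSEQ_subseq_LIMSEQ[OF partial_sums_L2[OF uL] this]
    have "(\<lambda>J. ip (?S J - u) (?S J - u)) \<longlonglongrightarrow> 0" by (simp add: comp_def)
    then obtain \<rho> :: "nat \<Rightarrow> nat" where \<rho>: "strict_mono \<rho>" "AE x in MP. (\<lambda>n. ?S (\<rho> n) x) \<longlonglongrightarrow> u x"
      using AE_subseq_of_L2[of ?S u] uL by blast
    have "integrable MP (\<lambda>x. \<bar>u x\<bar> ^ 3) \<and> (\<integral>x. \<bar>u x\<bar> ^ 3 \<partial>MP) \<le> C0 * sqrt h ^ 3"
    proof (rule integrable_fatou[where f = "\<lambda>n x. \<bar>?S (\<rho> n) x\<bar> ^ 3" and N = 0])
      show "AE x in MP. (\<lambda>n. \<bar>?S (\<rho> n) x\<bar> ^ 3) \<longlonglongrightarrow> \<bar>u x\<bar> ^ 3"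
        using \<rho>(2) by eventually_elim (intro tendsto_intros)
      show "(\<lambda>x. \<bar>u x\<bar> ^ 3) \<in> borel_measurable MP" by (rule measurable_MP) measurable
    qed (use iS le in auto)
    moreover have "C0 * sqrt h ^ 3 = C * sqrt (B (wt s) u u) ^ 3"
      by (simp add: C_def h_def real_sqrt_mult real_sqrt_divide power_mult_distrib power_divide)
    ultimately show ?thesis by simp
  qed
  show thesis by (rule that[OF C]) (use main in auto)
qed

end

section \<open>The energy space and the dispersion operator\<close>

lemma finite_convergent_subseq:
  fixes s :: "nat \<Rightarrow> 'a \<Rightarrow> 'b::heine_borel"
  assumes "finite F" and "\<And>k. k \<in> F \<Longrightarrow> bounded (range (\<lambda>n. s n k))"
  obtains r :: "nat \<Rightarrow> nat" where "strict_mono r" "\<And>k. k \<in> F \<Longrightarrow> convergent (\<lambda>n. s (r n) k)"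
  using assms
proof (induction F arbitrary: thesis rule: finite_induct)
  case empty
  show ?case by (rule empty(1)[of id]) (auto simp: strict_mono_def)
next
  case (insert j F)
  obtain r :: "nat \<Rightarrow> nat" where r: "strict_mono r" "\<And>k. k \<in> F \<Longrightarrow> convergent (\<lambda>n. s (r n) k)"
    using insert.IH insert.prems(2) by blast
  have "bounded (range (\<lambda>n. s (r n) j))"
    using insert.prems(2)[of j] by (rule bounded_subset) auto
  then obtain l r' where r': "strict_mono (r' :: nat \<Rightarrow> nat)" "(\<lambda>n. s (r (r' n)) j) \<longlonglongrightarrow> l"
    using bounded_imp_convergent_subsequence[of "\<lambda>n. s (r n) j"] unfolding comp_def by blast
  show ?case
  proof (rule insert.prems(1)[of "r \<circ> r'"])
    show "strict_mono (r \<circ> r')" using r(1) r'(1) by (rule strict_mono_o)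
    fix k assume k: "k \<in> insert j F"
    show "convergent (\<lambda>n. s ((r \<circ> r') n) k)"
    proof (cases "k = j")
      case True then show ?thesis using r'(2) by (auto simp: convergent_def)
    next
      case False
      then obtain m where "(\<lambda>n. s (r n) k) \<longlonglongrightarrow> m" using r(2) k by (auto simp: convergent_def)
      from LIMSEQ_subseq_LIMSEQ[OF this r'(1)] show ?thesis by (auto simp: convergent_def comp_def)
    qed
  qed
qed

context period
begin

lemma summable_finite_support:
  assumes "finite F" "\<And>k. k \<notin> F \<Longrightarrow> f k = (0::real)"
  shows "f summable_on UNIV"
  by (rule summable_on_cong_neutral[where T = F and g = f, THEN iffD2]) (use assms in auto)

lemma trig_L2: "(\<lambda>x. Re (z * ek j x)) \<in> L2_per L"
  using tp_L2[of "\<lambda>_. z" "{j}"] by (simp add: tp_def[abs_def])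

lemma trig_Hw: "(\<lambda>x. Re (z * ek j x)) \<in> Hw w"
proof -
  have "(\<lambda>k. w k * (norm (c (\<lambda>x. Re (z * ek j x)) k))\<^sup>2) summable_on UNIV"
    by (rule summable_finite_support[of "{j, - j}"]) (auto simp: c_tp_single)
  then show ?thesis using trig_L2 by (simp add: Hw_def)
qed

lemma B_trig:
  assumes u: "u \<in> Hw w" and w: "\<And>k. 0 \<le> w k" "\<And>k. w (- k) = w k"
  shows "B w u (\<lambda>x. Re (z * ek j x)) = L * (w j * Re (z * cnj (c u j)))"
proof -
  let ?e = "\<lambda>x. Re (z * ek j x)"
  have "(\<Sum>\<^sub>\<infinity>k. w k * Re (c u k * cnj (c ?e k))) = (\<Sum>\<^sub>\<infinity>k. w j * Re (c u k * cnj (c ?e k)))"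
    by (rule infsum_cong) (auto simp: c_tp_single w)
  then have "B w u ?e = w j * B (\<lambda>_. 1) u ?e"
    by (simp add: B_def infsum_cmult_right')
  also have "B (\<lambda>_. 1) u ?e = ip u ?e" using u trig_L2 by (simp add: parseval Hw_L2)
  also have "\<dots> = L * Re (z * cnj (c u j))" using u by (simp add: ip_trig Hw_L2)
  finally show ?thesis by simp
qed

lemma Hw_add: 
  assumes "u \<in> Hw w" "u \<in> Hw w'"
  shows "u \<in> Hw (\<lambda>k. \<alpha> * w k + \<beta> * w' k)"
    "B (\<lambda>k. \<alpha> * w k + \<beta> * w' k) u u = \<alpha> * B w u u + \<beta> * B w' u u"
proof -
  have s: "(\<lambda>k. \<alpha> * (w k * (norm (c u k))\<^sup>2)) summable_on UNIV" "(\<lambda>k. \<beta> * (w' k * (norm (c u k))\<^sup>2)) summable_on UNIV"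
    using assms by (auto simp: Hw_def intro: summable_on_cmult_right)
  have e: "(\<alpha> * w k + \<beta> * w' k) * (norm (c u k))\<^sup>2 = \<alpha> * (w k * (norm (c u k))\<^sup>2) + \<beta> * (w' k * (norm (c u k))\<^sup>2)" for k
    by (simp add: algebra_simps)
  show "u \<in> Hw (\<lambda>k. \<alpha> * w k + \<beta> * w' k)" using assms summable_on_add[OF s] by (simp add: Hw_def e)
  show "B (\<lambda>k. \<alpha> * w k + \<beta> * w' k) u u = \<alpha> * B w u u + \<beta> * B w' u u"
    unfolding B_self e infsum_add[OF s] by (simp add: infsum_cmult_right' algebra_simps)
qed

lemma B_indicator:
  assumes "finite F" "u \<in> L2_per L"
  shows "u \<in> Hw (indicator F)" "B (indicator F) u u = L * (\<Sum>k\<in>F. (norm (c u k))\<^sup>2)"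
proof -
  have "(\<lambda>k. indicator F k * (norm (c u k))\<^sup>2) summable_on UNIV"
    by (rule summable_finite_support[OF assms(1)]) simp
  then show "u \<in> Hw (indicator F)" using assms by (simp add: Hw_def)
  have "(\<Sum>\<^sub>\<infinity>k. indicator F k * (norm (c u k))\<^sup>2) = (\<Sum>\<^sub>\<infinity>k\<in>F. (norm (c u k))\<^sup>2)"
    by (rule infsum_cong_neutral) auto
  then show "B (indicator F) u u = L * (\<Sum>k\<in>F. (norm (c u k))\<^sup>2)"
    using assms by (simp add: B_self)
qed

lemma L2_continuous_form:
  assumes R: "form (L2_per L) R" and b: "\<And>u v. u \<in> L2_per L \<Longrightarrow> v \<in> L2_per L \<Longrightarrow> \<bar>R u v\<bar> \<le> C * (sqrt (ip u u) * sqrt (ip v v))"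
    and f: "\<And>n. f n \<in> L2_per L" and g: "g \<in> L2_per L" and lim: "(\<lambda>n. ip (f n - g) (f n - g)) \<longlonglongrightarrow> 0"
  shows "v \<in> L2_per L \<Longrightarrow> (\<lambda>n. R (f n) v) \<longlonglongrightarrow> R g v" "(\<lambda>n. R (f n) (f n)) \<longlonglongrightarrow> R g g"
proof -
  interpret R: form "L2_per L" R by fact
  have s0: "(\<lambda>n. sqrt (ip (f n - g) (f n - g))) \<longlonglongrightarrow> 0"
    using tendsto_real_sqrt[OF lim] by simp
  have lin: "(\<lambda>n. R (f n) v) \<longlonglongrightarrow> R g v" if v: "v \<in> L2_per L" for v
  proof (rule LIM_zero_cancel, rule null_by_bound)
    show "\<bar>R (f n) v - R g v\<bar> \<le> C * (sqrt (ip (f n - g) (f n - g)) * sqrt (ip v v))" for n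
      using b[OF _ v, of "f n - g"] f[of n] g v by (simp add: R.diff_left)
    show "(\<lambda>n. C * (sqrt (ip (f n - g) (f n - g)) * sqrt (ip v v))) \<longlonglongrightarrow> 0"
      using tendsto_mult[OF tendsto_const[of C] tendsto_mult[OF s0 tendsto_const[of "sqrt (ip v v)"]]] by simp
  qed
  then show "v \<in> L2_per L \<Longrightarrow> (\<lambda>n. R (f n) v) \<longlonglongrightarrow> R g v" .
  have "(\<lambda>n. R (f n - g) (f n - g)) \<longlonglongrightarrow> 0"
  proof (rule null_by_bound)
    show "\<bar>R (f n - g) (f n - g)\<bar> \<le> C * (sqrt (ip (f n - g) (f n - g)) * sqrt (ip (f n - g) (f n - g)))" for n
      using b[of "f n - g" "f n - g"] f[of n] g by simp
    show "(\<lambda>n. C * (sqrt (ip (f n - g) (f n - g)) * sqrt (ip (f n - g) (f n - g)))) \<longlonglongrightarrow> 0"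
      using tendsto_mult[OF tendsto_const[of C] tendsto_mult[OF s0 s0]] by simp
  qed
  from tendsto_add[OF this tendsto_mult[OF tendsto_const[of 2] lin[OF g]]]
  have "(\<lambda>n. R (f n - g) (f n - g) + 2 * R (f n) g - R g g) \<longlonglongrightarrow> 0 + 2 * R g g - R g g"
    by (intro tendsto_diff tendsto_const)
  moreover have "R (f n - g) (f n - g) + 2 * R (f n) g - R g g = R (f n) (f n)" for n
    using f[of n] g by (simp add: R.quad_diff)
  ultimately show "(\<lambda>n. R (f n) (f n)) \<longlonglongrightarrow> R g g" by simp
qed

end

locale dispersive = period +
  fixes \<theta> :: "real \<Rightarrow> real" and m :: real
  assumes adm: "admissible_symbol \<theta> m"
begin

definition T :: "int \<Rightarrow> real" where "T k = \<theta> (of_int k)"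

abbreviation X where "X \<equiv> Hw (wt (m / 2))"

lemma m_pos: "m > 1/3" using adm by (simp add: admissible_symbol_def)

lemma T_bounds:
  obtains \<upsilon>1 \<upsilon>2 where "\<upsilon>1 > 0" "\<upsilon>2 > 0" "\<And>k. \<upsilon>1 * \<bar>real_of_int k\<bar> powr m \<le> T k"
    "\<And>k. T k \<le> \<upsilon>2 * \<bar>real_of_int k\<bar> powr m"
  using adm unfolding admissible_symbol_def T_def by blast

lemma T_nonneg [simp]: "0 \<le> T k"
proof -
  obtain \<upsilon>1 \<upsilon>2 where "\<upsilon>1 > 0" "\<And>k. \<upsilon>1 * \<bar>real_of_int k\<bar> powr m \<le> T k" using T_bounds by metis
  then show ?thesis by (smt (verit) mult_nonneg_nonneg powr_ge_zero)
qed

lemma T_even: "T (- k) = T k" using adm by (simp add: T_def admissible_symbol_def)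

lemma T_0: "T 0 = 0"
proof -
  obtain \<upsilon>1 \<upsilon>2 where "\<And>k. T k \<le> \<upsilon>2 * \<bar>real_of_int k\<bar> powr m" using T_bounds by metis
  from this[of 0] show ?thesis using T_nonneg[of 0] by simp
qed

lemma abs_powr_le_wt: "\<bar>real_of_int k\<bar> powr m \<le> wt (m / 2) k"
proof (cases "k = 0")
  case False
  have "\<bar>real_of_int k\<bar> powr m = (\<bar>real_of_int k\<bar> powr 2) powr (m / 2)" by (subst powr_powr) simp
  also have "\<bar>real_of_int k\<bar> powr 2 = (real_of_int k)\<^sup>2" using False by simp
  also have "\<dots> powr (m / 2) \<le> wt (m / 2) k" unfolding wt_def using m_pos by (intro powr_mono2) auto
  finally show ?thesis .
qed (simp add: wt_def)

lemma wt_le_abs_powr: "k \<noteq> 0 \<Longrightarrow> wt s k \<le> 2 powr s * \<bar>real_of_int k\<bar> powr (2 * s)" if "s \<ge> 0"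
proof -
  assume k: "k \<noteq> 0"
  have "1 \<le> \<bar>k\<bar>" using k by linarith
  then have "1 \<le> \<bar>real_of_int k\<bar>" by linarith
  then have "1 \<le> (real_of_int k)\<^sup>2" using abs_le_square_iff[of 1 "real_of_int k"] by simp
  then have "wt s k \<le> (2 * (real_of_int k)\<^sup>2) powr s" unfolding wt_def using that by (intro powr_mono2) auto
  also have "\<dots> = 2 powr s * ((real_of_int k)\<^sup>2) powr s" by (simp add: powr_mult)
  also have "((real_of_int k)\<^sup>2) powr s = (\<bar>real_of_int k\<bar> powr 2) powr s" using k by simp
  also have "\<dots> = \<bar>real_of_int k\<bar> powr (2 * s)" by (simp only: powr_powr)
  finally show ?thesis .
qed

lemma T_le_wt: obtains C where "C > 0" "\<And>k. T k \<le> C * wt (m / 2) k"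
proof -
  obtain \<upsilon>1 \<upsilon>2 where v: "\<upsilon>2 > 0" "\<And>k. T k \<le> \<upsilon>2 * \<bar>real_of_int k\<bar> powr m" using T_bounds by metis
  have "T k \<le> \<upsilon>2 * wt (m / 2) k" for k
    using v(2)[of k] mult_left_mono[OF abs_powr_le_wt[of k], of \<upsilon>2] v(1) by linarith
  then show thesis using that v(1) by blast
qed

lemma wt_le_T: obtains C where "C > 0" "\<And>k. wt (m / 2) k \<le> C * (1 + T k)" "\<And>k. wt m k \<le> C * (1 + (T k)\<^sup>2)"
proof -
  obtain \<upsilon>1 \<upsilon>2 where v: "\<upsilon>1 > 0" "\<And>k. \<upsilon>1 * \<bar>real_of_int k\<bar> powr m \<le> T k" using T_bounds by metis
  define C where "C = 1 + 2 powr (m / 2) / \<upsilon>1 + 2 powr m / \<upsilon>1\<^sup>2"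
  have p: "0 \<le> 2 powr (m / 2) / \<upsilon>1" "0 \<le> 2 powr m / \<upsilon>1\<^sup>2" using v by auto
  have C: "C \<ge> 1" "C \<ge> 2 powr (m / 2) / \<upsilon>1" "C \<ge> 2 powr m / \<upsilon>1\<^sup>2" using p by (simp_all add: C_def)
  have 1: "wt (m / 2) k \<le> C * (1 + T k)" for k
  proof (cases "k = 0")
    case True then show ?thesis using C(1) by (simp add: wt_def T_0)
  next
    case False
    have "wt (m / 2) k \<le> 2 powr (m / 2) * \<bar>real_of_int k\<bar> powr m"
      using wt_le_abs_powr[OF _ False, of "m / 2"] m_pos by simp
    also have "\<dots> = 2 powr (m / 2) / \<upsilon>1 * (\<upsilon>1 * \<bar>real_of_int k\<bar> powr m)" using v by simp
    also have "\<dots> \<le> C * T k" using v C p by (intro mult_mono) auto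
    also have "\<dots> \<le> C * (1 + T k)" using C(1) by simp
    finally show ?thesis .
  qed
  have 2: "wt m k \<le> C * (1 + (T k)\<^sup>2)" for k
  proof (cases "k = 0")
    case True then show ?thesis using C(1) by (simp add: wt_def T_0)
  next
    case False
    have "wt m k \<le> 2 powr m * \<bar>real_of_int k\<bar> powr (2 * m)"
      using wt_le_abs_powr[OF _ False, of m] m_pos by simp
    also have "\<bar>real_of_int k\<bar> powr (2 * m) = (\<bar>real_of_int k\<bar> powr m)\<^sup>2"
      by (simp add: power2_eq_square flip: powr_add)
    also have "2 powr m * \<dots> = 2 powr m / \<upsilon>1\<^sup>2 * (\<upsilon>1 * \<bar>real_of_int k\<bar> powr m)\<^sup>2" using v by (simp add: power_mult_distrib)
    also have "\<dots> \<le> C * (T k)\<^sup>2" using v C p by (intro mult_mono power_mono) auto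
    also have "\<dots> \<le> C * (1 + (T k)\<^sup>2)" using C(1) by simp
    finally show ?thesis .
  qed
  show thesis using that[of C] C(1) 1 2 by auto
qed

lemma T_large: obtains N where "\<And>k. k \<notin> modes N \<Longrightarrow> R \<le> T k"
proof -
  obtain \<upsilon>1 \<upsilon>2 where v: "\<upsilon>1 > 0" "\<And>k. \<upsilon>1 * \<bar>real_of_int k\<bar> powr m \<le> T k" using T_bounds by metis
  define R' where "R' = max 1 (R / \<upsilon>1)"
  obtain N where N: "R' powr (1 / m) \<le> real N" using real_arch_simple by blast
  show thesis
  proof (rule that)
    fix k assume "k \<notin> modes N"
    then have "int N \<le> \<bar>k\<bar>" by auto
    then have "real N \<le> \<bar>real_of_int k\<bar>" by linarith
    then have "(R' powr (1 / m)) powr m \<le> \<bar>real_of_int k\<bar> powr m" using N m_pos by (intro powr_mono2) auto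
    then have "R' \<le> \<bar>real_of_int k\<bar> powr m" using m_pos by (simp add: powr_powr R'_def)
    then have "R / \<upsilon>1 \<le> \<bar>real_of_int k\<bar> powr m" by (simp add: R'_def)
    then show "R \<le> T k" using v(1) v(2)[of k] by (simp add: field_simps)
  qed
qed

lemma X_T: "u \<in> X \<Longrightarrow> u \<in> Hw T"
proof -
  obtain C where C: "\<And>k. T k \<le> C * wt (m / 2) k" using T_le_wt by metis
  show "u \<in> X \<Longrightarrow> u \<in> Hw T" by (rule Hw_mono(1)[OF T_nonneg C])
qed

lemma X_L2: "u \<in> X \<Longrightarrow> u \<in> L2_per L" by (rule Hw_L2)

lemma T_X: assumes "u \<in> Hw T" shows "u \<in> X"
proof -
  obtain C where C: "\<And>k. wt (m / 2) k \<le> C * (1 + T k)" using wt_le_T by metis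
  have 1: "u \<in> Hw (\<lambda>_. 1)" using assms by (simp add: Hw_1 Hw_L2)
  have le: "wt (m / 2) k \<le> C * (1 * 1 + 1 * T k)" for k using C[of k] by simp
  show ?thesis by (rule Hw_mono(1)[OF wt_nonneg le Hw_add(1)[OF 1 assms]])
qed

sublocale BX: psd_form X "B (wt (m / 2))" by (rule psd_form_B) simp

lemma form_BT: "psd_form X (B T)"
proof -
  interpret t: psd_form "Hw T" "B T" by (rule psd_form_B) simp
  interpret f: form X "B T" by (rule t.restrict[OF BX.subspace]) (rule subsetI, rule X_T)
  show ?thesis by unfold_locales (rule t.nonneg, rule X_T)
qed

sublocale BT: psd_form X "B T" by (rule form_BT)

sublocale ipX: psd_form X ip
proof -
  interpret f: form X ip by (rule ip.restrict[OF BX.subspace]) (rule subsetI, rule X_L2)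
  show "psd_form X ip" by unfold_locales (rule ip.nonneg, rule X_L2)
qed

lemma ip_le_X: "u \<in> X \<Longrightarrow> ip u u \<le> B (wt (m / 2)) u u"
  using Hw_mono(2)[of "\<lambda>_. 1" 1 "wt (m / 2)" u] wt_ge_1[of "m / 2"] m_pos by (simp add: parseval X_L2)

lemma BT_le_X: obtains C where "C > 0" "\<And>u. u \<in> X \<Longrightarrow> B T u u \<le> C * B (wt (m / 2)) u u"
proof -
  obtain C where C: "C > 0" "\<And>k. T k \<le> C * wt (m / 2) k" using T_le_wt by metis
  show thesis by (rule that[OF C(1)]) (rule Hw_mono(2)[OF T_nonneg C(2)])
qed

lemma X_le_BT: obtains C where "C > 0" "\<And>u. u \<in> X \<Longrightarrow> B (wt (m / 2)) u u \<le> C * (ip u u + B T u u)"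
proof -
  obtain C where C: "C > 0" "\<And>k. wt (m / 2) k \<le> C * (1 + T k)" using wt_le_T by metis
  have "B (wt (m / 2)) u u \<le> C * (ip u u + B T u u)" if u: "u \<in> X" for u
  proof -
    have 1: "u \<in> Hw (\<lambda>_. 1)" "u \<in> Hw T" using u by (auto simp: Hw_1 X_L2 X_T)
    have le: "wt (m / 2) k \<le> C * (1 * 1 + 1 * T k)" for k using C(2)[of k] by simp
    have "B (wt (m / 2)) u u \<le> C * B (\<lambda>k. 1 * 1 + 1 * T k) u u"
      by (rule Hw_mono(2)[OF wt_nonneg le Hw_add(1)[OF 1]])
    also have "B (\<lambda>k. 1 * 1 + 1 * T k) u u = ip u u + B T u u"
      unfolding Hw_add(2)[OF 1] using u by (simp add: parseval X_L2)
    finally show ?thesis .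
  qed
  then show thesis using that C(1) by blast
qed

text \<open>Outside finitely many modes the dispersive form dominates any multiple of the \<open>L\<^sup>2\<close> norm. This is
the only compactness of the energy space in \<open>L\<^sup>2\<close> that the spectral theory uses.\<close>

lemma low_mode_control:
  assumes a: "a > 0" and D: "D > 0" and high: "\<And>k. k \<notin> modes N \<Longrightarrow> D / a \<le> T k" and u: "u \<in> X"
  shows "D * ip u u \<le> a * B T u u + D * (L * (\<Sum>k\<in>modes N. (norm (c u k))\<^sup>2))"
proof -
  let ?F = "modes N"
  have uT: "u \<in> Hw T" and uF: "u \<in> Hw (indicator ?F)" and uL: "u \<in> L2_per L"
    using u X_T X_L2 B_indicator(1)[of ?F u] by auto
  have le: "(1::real) \<le> (1 / D) * (a * T k + D * indicator ?F k)" for k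
  proof (cases "k \<in> ?F")
    case True
    have "0 \<le> a * T k" using a by simp
    then show ?thesis using True D by (simp add: field_simps)
  next
    case False
    have "D \<le> a * T k" using high[OF False] a by (simp add: field_simps)
    then show ?thesis using False D by (simp add: field_simps)
  qed
  have "B (\<lambda>_. 1) u u \<le> (1 / D) * B (\<lambda>k. a * T k + D * indicator ?F k) u u"
    by (rule Hw_mono(2)[OF _ le Hw_add(1)[OF uT uF]]) simp
  also have "B (\<lambda>k. a * T k + D * indicator ?F k) u u = a * B T u u + D * (L * (\<Sum>k\<in>?F. (norm (c u k))\<^sup>2))"
    unfolding Hw_add(2)[OF uT uF] using B_indicator(2)[of ?F u] uL by simp
  finally show ?thesis using D uL by (simp add: parseval field_simps)
qed

lemma H_per_eq: "H_per L s = Hw (wt s)"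
  by (simp add: H_per_def Hw_def wt_def)

lemma H_norm_eq: "H_norm L s u = sqrt (B (wt s) u u)"
  by (simp add: H_norm_def B_self wt_def)

text \<open>The pairing is defined by a complex series; it converges absolutely, so real parts can be taken
termwise.\<close>

lemma M_pair_eq:
  assumes "u \<in> Hw T" "v \<in> Hw T"
  shows "M_pair \<theta> L u v = B T u v"
proof -
  let ?f = "\<lambda>k. complex_of_real (T k) * c u k * cnj (c v k)"
  have "(\<lambda>k. T k * (norm (c u k))\<^sup>2 + T k * (norm (c v k))\<^sup>2) summable_on UNIV"
    using assms by (intro summable_on_add) (auto simp: Hw_def)
  then have "(\<lambda>k. norm (?f k)) summable_on UNIV"
  proof (rule summable_on_comparison_test)
    fix k
    have "0 \<le> (norm (c u k) - norm (c v k))\<^sup>2" "0 \<le> norm (c u k) * norm (c v k)" by simp_all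
    then have "norm (c u k) * norm (c v k) \<le> (norm (c u k))\<^sup>2 + (norm (c v k))\<^sup>2"
      unfolding power2_diff by linarith
    from mult_left_mono[OF this T_nonneg[of k]]
    show "norm (?f k) \<le> T k * (norm (c u k))\<^sup>2 + T k * (norm (c v k))\<^sup>2"
      by (simp add: norm_mult distrib_left)
  qed simp
  then have "?f summable_on UNIV" by (rule Infinite_Sum.abs_summable_summable)
  then have "Re (infsum ?f UNIV) = (\<Sum>\<^sub>\<infinity>k. Re (?f k))" by (simp add: infsum_Re)
  also have "(\<lambda>k. Re (?f k)) = (\<lambda>k. T k * Re (c u k * cnj (c v k)))"
    by (simp add: fun_eq_iff times_complex.sel algebra_simps)
  finally show ?thesis by (simp add: M_pair_def B_def T_def)
qed

end

section \<open>Eigenfunctions of a dispersive operator with bounded potential\<close>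

text \<open>The operator \<open>a \<M> + W\<close>. The factor \<open>a\<close> may be negative, so that an operator and its negative are
both instances.\<close>

locale schroedinger = dispersive +
  fixes a :: real and W :: "real \<Rightarrow> real" and Cw :: real
  assumes a0: "a \<noteq> 0" and W_meas: "W \<in> borel_measurable borel" and W_per: "W (x + L) = W x"
    and Cw0: "Cw \<ge> 0" and W_bound: "AE x in lborel. \<bar>W x\<bar> \<le> Cw"
begin

definition Wm :: "(real \<Rightarrow> real) \<Rightarrow> real \<Rightarrow> real" where "Wm u x = W x * u x"

lemma Wm_sq_le:
  assumes u: "u \<in> L2_per L"
  shows "Wm u \<in> L2_per L" "ip (Wm u) (Wm u) \<le> Cw\<^sup>2 * ip u u"
proof -
  note [measurable] = W_meas L2_perD(1)[OF u]
  have m: "Wm u \<in> borel_measurable borel" unfolding Wm_def[abs_def] by measurable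
  have le: "AE x in MP. (Wm u x)\<^sup>2 \<le> Cw\<^sup>2 * (u x)\<^sup>2"
    using AE_lborel_MP[OF W_bound]
  proof eventually_elim
    case (elim x)
    then have "(W x)\<^sup>2 \<le> Cw\<^sup>2" using power_mono[OF elim, of 2] by simp
    then show ?case by (simp add: Wm_def power_mult_distrib mult_right_mono)
  qed
  have i: "integrable MP (\<lambda>x. Cw\<^sup>2 * (u x)\<^sup>2)" using L2_perD(2)[OF u] by simp
  have i2: "integrable MP (\<lambda>x. (Wm u x)\<^sup>2)"
  proof (rule Bochner_Integration.integrable_bound[OF i])
    show "(\<lambda>x. (Wm u x)\<^sup>2) \<in> borel_measurable MP" using m by (intro measurable_MP) measurable
    show "AE x in MP. norm ((Wm u x)\<^sup>2) \<le> norm (Cw\<^sup>2 * (u x)\<^sup>2)"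
      using le by eventually_elim simp
  qed
  show "Wm u \<in> L2_per L" using i2 m by (simp add: L2_per_iff periodic_def Wm_def W_per L2_perD(3)[OF u])
  show "ip (Wm u) (Wm u) \<le> Cw\<^sup>2 * ip u u"
    using integral_mono_AE[OF i2 i le] by (simp add: ip_def power2_eq_square)
qed

definition V :: "(real \<Rightarrow> real) \<Rightarrow> (real \<Rightarrow> real) \<Rightarrow> real" where "V u v = ip (Wm u) v"

lemma form_V: "form (L2_per L) V"
proof
  show "subspace (L2_per L)" by (rule subspace_L2)
  show "V u v = V v u" for u v by (simp add: V_def ip_def Wm_def ac_simps)
  fix u v x assume *: "u \<in> L2_per L" "v \<in> L2_per L" "x \<in> L2_per L"
  have "Wm (u + v) = Wm u + Wm v" by (simp add: fun_eq_iff Wm_def distrib_left)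
  then show "V (u + v) x = V u x + V v x" using * by (simp add: V_def ip.add_left Wm_sq_le)
next
  fix b u x assume *: "u \<in> L2_per L" "x \<in> L2_per L"
  have "Wm (b *\<^sub>R u) = b *\<^sub>R Wm u" by (simp add: fun_eq_iff Wm_def)
  then show "V (b *\<^sub>R u) x = b * V u x" using * by (simp add: V_def ip.scale_left Wm_sq_le)
qed

lemma V_bound:
  assumes "u \<in> L2_per L" "v \<in> L2_per L"
  shows "\<bar>V u v\<bar> \<le> Cw * (sqrt (ip u u) * sqrt (ip v v))"
proof -
  have "\<bar>V u v\<bar> \<le> sqrt (ip (Wm u) (Wm u)) * sqrt (ip v v)"
    unfolding V_def using assms by (intro ip.abs_le Wm_sq_le)
  also have "\<dots> \<le> sqrt (Cw\<^sup>2 * ip u u) * sqrt (ip v v)"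
    using Wm_sq_le(2)[OF assms(1)] ip.nonneg[OF assms(2)] by (intro mult_right_mono real_sqrt_le_mono) auto
  finally show ?thesis using Cw0 by (simp add: real_sqrt_mult)
qed

lemma V_self_bound: "u \<in> L2_per L \<Longrightarrow> \<bar>V u u\<bar> \<le> Cw * ip u u"
  using V_bound[of u u] ip.nonneg[of u] by simp

definition Q :: "(real \<Rightarrow> real) \<Rightarrow> (real \<Rightarrow> real) \<Rightarrow> real" where "Q u v = a * B T u v + V u v"

lemma form_Q: "form X Q"
proof -
  interpret V: form "L2_per L" V by (rule form_V)
  interpret V: form X V by (rule V.restrict[OF BX.subspace]) (rule subsetI, rule X_L2)
  show ?thesis unfolding Q_def[abs_def]
    using form_combine[OF BT.form_axioms V.form_axioms, of a 1] by simp
qed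

sublocale Q: form X Q by (rule form_Q)

lemma garding: "u \<in> X \<Longrightarrow> a * B T u u - Cw * ip u u \<le> Q u u"
  using V_self_bound[of u] by (simp add: Q_def X_L2 abs_le_iff)

definition weak_eig :: "real \<Rightarrow> (real \<Rightarrow> real) \<Rightarrow> bool" where
  "weak_eig \<mu> g \<longleftrightarrow> g \<in> X \<and> (\<forall>v\<in>X. Q g v = \<mu> * ip g v)"

lemma weak_eigD: "weak_eig \<mu> g \<Longrightarrow> g \<in> X" "weak_eig \<mu> g \<Longrightarrow> v \<in> X \<Longrightarrow> Q g v = \<mu> * ip g v"
  by (auto simp: weak_eig_def)

text \<open>Testing a weak eigenfunction against the exponentials identifies the Fourier coefficients of its
image under the multiplier as those of a square integrable function, so it lies in the domain of
the operator.\<close>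

lemma weak_eig_regular:
  assumes g: "weak_eig \<mu> g"
  defines "h \<equiv> (\<lambda>x. (\<mu> * g x - W x * g x) / a)"
  shows "is_multiplier \<theta> L g h" "g \<in> Hw (wt m)"
proof -
  have gX: "g \<in> X" and gL: "g \<in> L2_per L" using weak_eigD(1)[OF g] X_L2 by auto
  have h: "h = (1 / a) *\<^sub>R (\<mu> *\<^sub>R g - Wm g)"
    by (simp add: fun_eq_iff h_def Wm_def)
  have hL: "h \<in> L2_per L" unfolding h using gL by (intro L2_closed Wm_sq_le)
  have ch: "c h k = T k * c g k" for k
  proof -
    have "cnj (c h k) = T k * cnj (c g k)"
    proof (rule Re_mult_eq_imp)
      fix z
      let ?e = "\<lambda>x. Re (z * ek k x)"
      have eX: "?e \<in> X" "?e \<in> L2_per L" using trig_Hw trig_L2 by auto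
      have "a * B T g ?e + V g ?e = \<mu> * ip g ?e" using weak_eigD(2)[OF g eX(1)] by (simp add: Q_def)
      moreover have "ip h ?e = (\<mu> * ip g ?e - V g ?e) / a"
        unfolding h V_def using gL eX(2) by (simp add: ip.bilin Wm_sq_le)
      ultimately have "a * ip h ?e = a * B T g ?e" using a0 by simp
      then have "ip h ?e = B T g ?e" using a0 by simp
      then have "L * Re (z * cnj (c h k)) = L * (T k * Re (z * cnj (c g k)))"
        using hL X_T[OF gX] by (simp add: ip_trig B_trig T_even)
      then have "Re (z * cnj (c h k)) = T k * Re (z * cnj (c g k))" using L_pos by simp
      also have "\<dots> = Re (z * (T k * cnj (c g k)))" by (simp add: times_complex.sel algebra_simps)
      finally show "Re (z * cnj (c h k)) = Re (z * (T k * cnj (c g k)))" .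
    qed
    then have "cnj (cnj (c h k)) = cnj (T k * cnj (c g k))" by simp
    then show ?thesis by simp
  qed
  then show "is_multiplier \<theta> L g h" using hL by (simp add: is_multiplier_def T_def)
  obtain C where C: "\<And>k. wt m k \<le> C * (1 + (T k)\<^sup>2)" using wt_le_T by metis
  have "(\<lambda>k. (norm (c g k))\<^sup>2 + (norm (c h k))\<^sup>2) summable_on UNIV"
    by (intro summable_on_add summable_c gL hL)
  then have s: "(\<lambda>k. C * ((norm (c g k))\<^sup>2 + (norm (c h k))\<^sup>2)) summable_on UNIV"
    by (rule summable_on_cmult_right)
  have "(\<lambda>k. wt m k * (norm (c g k))\<^sup>2) summable_on UNIV"
  proof (rule summable_on_comparison_test[OF s])
    fix k
    have "wt m k * (norm (c g k))\<^sup>2 \<le> C * (1 + (T k)\<^sup>2) * (norm (c g k))\<^sup>2"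
      using C by (intro mult_right_mono) auto
    also have "\<dots> = C * ((norm (c g k))\<^sup>2 + (norm (c h k))\<^sup>2)"
      by (simp add: ch norm_mult power_mult_distrib algebra_simps)
    finally show "wt m k * (norm (c g k))\<^sup>2 \<le> C * ((norm (c g k))\<^sup>2 + (norm (c h k))\<^sup>2)" .
  qed simp
  then show "g \<in> Hw (wt m)" using gL by (simp add: Hw_def)
qed

lemma multiplier_weak_eig:
  assumes g: "g \<in> X" and h: "is_multiplier \<theta> L g h"
    and eq: "AE x in lborel. a * h x + W x * g x = \<mu> * g x"
  shows "weak_eig \<mu> g"
  unfolding weak_eig_def
proof (intro conjI ballI g)
  fix v assume v: "v \<in> X"
  have hL: "h \<in> L2_per L" and ch: "\<And>k. c h k = T k * c g k" using h by (auto simp: is_multiplier_def T_def)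
  note L2 = X_L2[OF g] X_L2[OF v] hL
  have "B T g v = B (\<lambda>_. 1) h v"
    by (simp add: B_def ch times_complex.sel algebra_simps)
  then have BT: "B T g v = ip h v" using L2 by (simp add: parseval)
  have "Q g v = ip (a *\<^sub>R h + Wm g) v" using L2 by (simp add: Q_def V_def BT ip.bilin Wm_sq_le)
  also have "\<dots> = ip (\<mu> *\<^sub>R g) v"
  proof (rule ip_cong_AE)
    show "AE x in lborel. (a *\<^sub>R h + Wm g) x = (\<mu> *\<^sub>R g) x"
      using eq by eventually_elim (simp add: Wm_def)
  qed (use L2 in \<open>auto intro!: L2_closed Wm_sq_le\<close>)
  also have "\<dots> = \<mu> * ip g v" using L2 by (simp add: ip.bilin)
  finally show "Q g v = \<mu> * ip g v" .
qed

lemma weak_eig_iff_multiplier: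
  "weak_eig \<mu> g \<longleftrightarrow> g \<in> H_per L m \<and>
     (\<exists>h. is_multiplier \<theta> L g h \<and> (AE x in lborel. a * h x + W x * g x = \<mu> * g x))"
proof
  assume g: "weak_eig \<mu> g"
  show "g \<in> H_per L m \<and> (\<exists>h. is_multiplier \<theta> L g h \<and> (AE x in lborel. a * h x + W x * g x = \<mu> * g x))"
    using weak_eig_regular[OF g] a0
    by (intro conjI exI[of _ "\<lambda>x. (\<mu> * g x - W x * g x) / a"]) (auto simp: H_per_eq)
next
  assume r: "g \<in> H_per L m \<and> (\<exists>h. is_multiplier \<theta> L g h \<and> (AE x in lborel. a * h x + W x * g x = \<mu> * g x))"
  have "wt (m / 2) k \<le> 1 * wt m k" for k unfolding wt_def using m_pos by (simp add: powr_mono)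
  from Hw_mono(1)[OF wt_nonneg this] have "g \<in> X" using r by (simp add: H_per_eq)
  then show "weak_eig \<mu> g" using r multiplier_weak_eig by blast
qed

lemma bessel_orthonormal:
  assumes I: "finite I" and on: "\<And>i. i \<in> I \<Longrightarrow> e i \<in> X" "\<And>i j. i \<in> I \<Longrightarrow> j \<in> I \<Longrightarrow> ip (e i) (e j) = (if i = j then 1 else 0)"
    and v: "v \<in> X"
  shows "(\<Sum>i\<in>I. (ip v (e i))\<^sup>2) \<le> ip v v"
    and "v - (\<Sum>i\<in>I. ip v (e i) *\<^sub>R e i) \<in> X"
    and "j \<in> I \<Longrightarrow> ip (v - (\<Sum>i\<in>I. ip v (e i) *\<^sub>R e i)) (e j) = 0"
    and "ip (v - (\<Sum>i\<in>I. ip v (e i) *\<^sub>R e i)) (v - (\<Sum>i\<in>I. ip v (e i) *\<^sub>R e i)) = ip v v - (\<Sum>i\<in>I. (ip v (e i))\<^sup>2)"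
proof -
  let ?p = "\<Sum>i\<in>I. ip v (e i) *\<^sub>R e i"
  have pX: "?p \<in> X" using on by (intro ipX.sum_closed) auto
  show 1: "v - ?p \<in> X" using v pX by (rule ipX.closed)
  have "ip ?p (e j) = ip v (e j)" if j: "j \<in> I" for j
  proof -
    have "ip ?p (e j) = (\<Sum>i\<in>I. ip v (e i) * ip (e i) (e j))" using on j by (intro ipX.sum_left) auto
    also have "\<dots> = (\<Sum>i\<in>I. if i = j then ip v (e i) else 0)" using on j by (intro sum.cong) auto
    finally show ?thesis using j I by simp
  qed
  then show 2: "ip (v - ?p) (e j) = 0" if "j \<in> I" for j
    using that v pX on by (simp add: ipX.diff_left)
  have "ip (v - ?p) ?p = (\<Sum>i\<in>I. ip v (e i) * ip (v - ?p) (e i))"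
    using on 1 by (intro ipX.sum_right) auto
  then have o: "ip (v - ?p) ?p = 0" using 2 by simp
  have "ip v ?p = (\<Sum>i\<in>I. ip v (e i) * ip v (e i))" using on v by (intro ipX.sum_right) auto
  then show 3: "ip (v - ?p) (v - ?p) = ip v v - (\<Sum>i\<in>I. (ip v (e i))\<^sup>2)"
    using o v pX 1 ipX.diff_right[OF v pX 1] ipX.diff_left[OF v pX v] ipX.sym[OF pX v]
    by (simp add: power2_eq_square)
  show "(\<Sum>i\<in>I. (ip v (e i))\<^sup>2) \<le> ip v v" using 3 ipX.nonneg[OF 1] by simp
qed

text \<open>The space is infinite dimensional: if \<open>n + 1\<close> orthonormal cosines were combinations of \<open>n\<close> orthonormal
vectors, then summing the squares of all their inner products in the two possible orders would give
\<open>n + 1 \<le> n\<close>.\<close>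

lemma orthogonal_unit_vector:
  assumes I: "finite I" and on: "\<And>i. i \<in> I \<Longrightarrow> e i \<in> X" "\<And>i j. i \<in> I \<Longrightarrow> j \<in> I \<Longrightarrow> ip (e i) (e j) = (if i = j then 1 else 0)"
  obtains v where "v \<in> X" "ip v v = 1" "\<And>i. i \<in> I \<Longrightarrow> ip v (e i) = 0"
proof -
  define f where "f j = (\<lambda>x. Re (complex_of_real (sqrt (2 / L)) * ek (int j) x))" for j :: nat
  have fX: "f j \<in> X" for j unfolding f_def by (rule trig_Hw)
  let ?J = "{1..Suc (card I)}"
  have ff: "ip (f i) (f j) = (if i = j then 1 else 0)" if "i \<in> ?J" "j \<in> ?J" for i j
  proof -
    have "ip (f i) (f j) = L * Re (complex_of_real (sqrt (2 / L)) * cnj (c (f i) (int j)))"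
      unfolding f_def[of j] using fX X_L2 by (intro ip_trig) auto
    also have "\<dots> = (if i = j then 1 else 0)"
      unfolding f_def c_tp_single using that L_pos by (auto simp: times_complex.sel real_sqrt_mult_self)
    finally show ?thesis .
  qed
  have "\<exists>j\<in>?J. ip (f j) (f j) \<noteq> (\<Sum>i\<in>I. (ip (f j) (e i))\<^sup>2)"
  proof (rule ccontr)
    assume "\<not> ?thesis"
    then have "real (Suc (card I)) = (\<Sum>j\<in>?J. \<Sum>i\<in>I. (ip (f j) (e i))\<^sup>2)" using ff by simp
    also have "\<dots> = (\<Sum>i\<in>I. \<Sum>j\<in>?J. (ip (e i) (f j))\<^sup>2)"
      by (subst sum.swap) (auto intro!: sum.cong simp: ipX.sym[OF fX on(1)])
    also have "\<dots> \<le> (\<Sum>i\<in>I. ip (e i) (e i))"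
      using bessel_orthonormal(1)[of ?J f, OF _ fX ff on(1)] by (intro sum_mono) auto
    also have "\<dots> = real (card I)" using on by simp
    finally show False by simp
  qed
  then obtain j where j: "ip (f j) (f j) \<noteq> (\<Sum>i\<in>I. (ip (f j) (e i))\<^sup>2)" by blast
  define w where "w = f j - (\<Sum>i\<in>I. ip (f j) (e i) *\<^sub>R e i)"
  note b = bessel_orthonormal[OF I on fX[of j], folded w_def]
  have wX: "w \<in> X" and w0: "\<And>i. i \<in> I \<Longrightarrow> ip w (e i) = 0" and ww: "ip w w > 0"
    using b j ipX.nonneg[of w] by auto
  show thesis
  proof (rule that[of "(1 / sqrt (ip w w)) *\<^sub>R w"])
    show "(1 / sqrt (ip w w)) *\<^sub>R w \<in> X" using wX by simp
    show "ip ((1 / sqrt (ip w w)) *\<^sub>R w) ((1 / sqrt (ip w w)) *\<^sub>R w) = 1"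
      using wX ww by (simp add: ipX.quad_scale power_divide)
    show "ip ((1 / sqrt (ip w w)) *\<^sub>R w) (e i) = 0" if "i \<in> I" for i
      using wX w0 on that by (simp add: ipX.scale_left)
  qed
qed

text \<open>The direct method: the form \<open>Q\<close> is minimised over unit vectors orthogonal to the given
eigenfunctions. By the parallelogram identity the differences of a minimising sequence are nearly
minimal for \<open>Q - \<nu> ip\<close>, a form that controls all but finitely many modes. After passing to a
subsequence along which those modes converge, the sequence is therefore Cauchy in the mean. Its
limit belongs to the energy space and attains the minimum, because the dispersive form is lower
semicontinuous and the potential form is continuous. Since \<open>Q - \<nu> ip\<close> is nonnegative on the
orthogonal complement and vanishes at the minimiser, the Cauchy-Schwarz inequality yields the
Euler-Lagrange equation there; in the direction of the given eigenfunctions it is their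
orthogonality to the minimiser.\<close>

theorem variational_eigenfunction:
  assumes apos: "a > 0" and I: "finite I"
    and on: "\<And>i j. i \<in> I \<Longrightarrow> j \<in> I \<Longrightarrow> ip (e i) (e j) = (if i = j then 1 else 0)"
    and eig: "\<And>i. i \<in> I \<Longrightarrow> weak_eig (\<mu> i) (e i)"
  obtains \<nu> g where "weak_eig \<nu> g" "ip g g = 1" "\<And>i. i \<in> I \<Longrightarrow> ip g (e i) = 0"
    "\<And>v. v \<in> X \<Longrightarrow> (\<And>i. i \<in> I \<Longrightarrow> ip v (e i) = 0) \<Longrightarrow> \<nu> * ip v v \<le> Q v v"
proof -
  have eX: "e i \<in> X" if "i \<in> I" for i using weak_eigD(1)[OF eig[OF that]] .
  define Y where "Y = {v \<in> X. \<forall>i\<in>I. ip v (e i) = 0}"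
  have YX: "Y \<subseteq> X" by (auto simp: Y_def)
  have subY: "subspace Y" unfolding subspace_def Y_def using eX by (auto simp: ipX.bilin)
  define A where "A = {Q v v | v. v \<in> Y \<and> ip v v = 1}"
  define \<nu> where "\<nu> = Inf A"
  have Ane: "A \<noteq> {}"
  proof -
    obtain v where "v \<in> X" "ip v v = 1" "\<And>i. i \<in> I \<Longrightarrow> ip v (e i) = 0"
      using orthogonal_unit_vector[OF I eX on] by blast
    then have "Q v v \<in> A" by (auto simp: A_def Y_def)
    then show ?thesis by blast
  qed
  have low: "- Cw \<le> Q v v" if "v \<in> Y" "ip v v = 1" for v
  proof -
    have "0 \<le> a * B T v v" using apos BT.nonneg[of v] that YX by auto
    then show ?thesis using garding[of v] that YX by auto
  qed
  then have bdd: "bdd_below A" by (intro bdd_belowI[of _ "- Cw"]) (auto simp: A_def)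
  have \<nu>Cw: "- Cw \<le> \<nu>" unfolding \<nu>_def using low by (intro cInf_greatest Ane) (auto simp: A_def)
  have Qge: "\<nu> * ip v v \<le> Q v v" if v: "v \<in> Y" for v
  proof (cases "ip v v = 0")
    case True
    have vX: "v \<in> X" using v YX by auto
    have "0 \<le> a * B T v v" using apos BT.nonneg[OF vX] by simp
    then show ?thesis using garding[OF vX] True by simp
  next
    case False
    have vX: "v \<in> X" using v YX by auto
    then have p: "ip v v > 0" using False ipX.nonneg[of v] by simp
    define w where "w = (1 / sqrt (ip v v)) *\<^sub>R v"
    have "w \<in> Y" using v subY by (simp add: w_def subspace_scale)
    moreover have "ip w w = 1" using vX p by (simp add: w_def ipX.quad_scale power_divide)
    ultimately have "\<nu> \<le> Q w w" unfolding \<nu>_def by (intro cInf_lower bdd) (auto simp: A_def)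
    also have "Q w w = Q v v / ip v v" using vX p by (simp add: w_def Q.quad_scale power_divide)
    finally show ?thesis using p by (simp add: field_simps)
  qed
  have "\<exists>v. v \<in> Y \<and> ip v v = 1 \<and> Q v v < \<nu> + 1 / Suc n" for n
  proof -
    have "Inf A < \<nu> + 1 / Suc n" by (simp add: \<nu>_def)
    then obtain x where "x \<in> A" "x < \<nu> + 1 / Suc n" using cInf_lessD[OF Ane] by blast
    then show ?thesis by (auto simp: A_def)
  qed
  then obtain v where v: "\<And>n. v n \<in> Y" "\<And>n. ip (v n) (v n) = 1" "\<And>n. Q (v n) (v n) < \<nu> + 1 / Suc n"
    by metis
  have vX: "v n \<in> X" and vL: "v n \<in> L2_per L" for n using v(1)[of n] YX X_L2 by auto
  define D where "D = Cw + \<nu> + 1"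
  have D1: "D \<ge> 1" using \<nu>Cw by (simp add: D_def)
  obtain N where N: "\<And>k. k \<notin> modes N \<Longrightarrow> D / a \<le> T k" using T_large by metis
  let ?F = "modes N"
  \<comment> \<open>modes outside \<open>?F\<close> are controlled by the form, so only finitely many need a convergent subsequence\<close>
  have high: "ip w w \<le> Q w w - \<nu> * ip w w + D * (L * (\<Sum>k\<in>?F. (norm (c w k))\<^sup>2))" if w: "w \<in> X" for w
  proof -
    have "D * ip w w \<le> a * B T w w + D * (L * (\<Sum>k\<in>?F. (norm (c w k))\<^sup>2))"
      by (rule low_mode_control[OF apos _ N w]) (use D1 in simp)
    then show ?thesis using garding[OF w] by (simp add: D_def algebra_simps)
  qed
  obtain r :: "nat \<Rightarrow> nat" where r: "strict_mono r" "\<And>k. k \<in> ?F \<Longrightarrow> convergent (\<lambda>n. c (v (r n)) k)"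
  proof (rule finite_convergent_subseq[of ?F "\<lambda>n k. c (v n) k"])
    fix k
    show "bounded (range (\<lambda>n. c (v n) k))"
      unfolding bounded_iff using norm_c_le[OF vL] v(2) by (intro exI[of _ "1 / sqrt L"]) auto
  qed auto
  let ?w = "\<lambda>n. v (r n)"
  \<comment> \<open>the parallelogram identity for two members of the minimising sequence\<close>
  have diff: "ip (?w i - ?w j) (?w i - ?w j) \<le> 2 / Suc i + 2 / Suc j + D * (L * (\<Sum>k\<in>?F. (norm (c (?w i) k - c (?w j) k))\<^sup>2))" for i j
  proof -
    let ?x = "v (r i)" and ?y = "v (r j)"
    have xy: "?x \<in> X" "?y \<in> X" "?x + ?y \<in> Y" using vX v(1) subY by (auto simp: subspace_add)
    have le: "1 / real (Suc (r n)) \<le> 1 / real (Suc n)" for n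
      using seq_suble[OF r(1), of n] by (intro divide_left_mono) auto
    have "Q (?x - ?y) (?x - ?y) = 2 * Q ?x ?x + 2 * Q ?y ?y - Q (?x + ?y) (?x + ?y)"
      using xy by (simp add: Q.quad_add Q.quad_diff)
    moreover have "ip (?x + ?y) (?x + ?y) = 4 - ip (?x - ?y) (?x - ?y)"
      using xy v(2) by (simp add: ipX.quad_add ipX.quad_diff)
    then have "\<nu> * ip (?x + ?y) (?x + ?y) = 4 * \<nu> - \<nu> * ip (?x - ?y) (?x - ?y)"
      by (simp only: right_diff_distrib mult.commute)
    moreover have "\<nu> * ip (?x + ?y) (?x + ?y) \<le> Q (?x + ?y) (?x + ?y)" by (rule Qge[OF xy(3)])
    moreover have "Q ?x ?x \<le> \<nu> + 1 / Suc i" "Q ?y ?y \<le> \<nu> + 1 / Suc j"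
      using v(3)[of "r i"] v(3)[of "r j"] le[of i] le[of j] by linarith+
    ultimately have "Q (?x - ?y) (?x - ?y) - \<nu> * ip (?x - ?y) (?x - ?y) \<le> 2 / Suc i + 2 / Suc j"
      by linarith
    moreover have "c (?x - ?y) k = c ?x k - c ?y k" for k using vL by (intro c_diff)
    ultimately show ?thesis using high[of "?x - ?y"] xy by simp
  qed
  obtain g where gL: "g \<in> L2_per L" and lim: "(\<lambda>n. ip (?w n - g) (?w n - g)) \<longlonglongrightarrow> 0"
  proof (rule L2_complete[of ?w])
    fix \<epsilon> :: real assume \<epsilon>: "\<epsilon> > 0"
    define \<delta> where "\<delta> = \<epsilon> / (8 * (D * L * (2 * real N + 1)))"
    have DL: "0 < D * L * (2 * real N + 1)" using D1 L_pos by (intro mult_pos_pos) auto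
    then have \<delta>: "\<delta> > 0" using \<epsilon> by (simp add: \<delta>_def)
    have "\<exists>M. \<forall>i\<ge>M. \<forall>j\<ge>M. norm (c (?w i) k - c (?w j) k) < sqrt \<delta>" if "k \<in> ?F" for k
      using convergent_Cauchy[OF r(2)[OF that]] \<delta> unfolding Cauchy_def dist_norm by simp
    then obtain M where M: "\<And>k i j. k \<in> ?F \<Longrightarrow> i \<ge> M k \<Longrightarrow> j \<ge> M k \<Longrightarrow> norm (c (?w i) k - c (?w j) k) < sqrt \<delta>"
      by metis
    define M0 where "M0 = (\<Sum>k\<in>?F. M k) + nat \<lceil>8 / \<epsilon>\<rceil>"
    show "\<exists>N. \<forall>m\<ge>N. \<forall>n\<ge>N. ip (?w m - ?w n) (?w m - ?w n) < \<epsilon>"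
    proof (intro exI[of _ M0] allI impI)
      fix i j assume ij: "i \<ge> M0" "j \<ge> M0"
      have Mk: "M k \<le> M0" if "k \<in> ?F" for k
        using member_le_sum[OF that, of M] by (simp add: M0_def)
      have "(\<Sum>k\<in>?F. (norm (c (?w i) k - c (?w j) k))\<^sup>2) \<le> (\<Sum>k\<in>?F. \<delta>)"
      proof (rule sum_mono)
        fix k assume k: "k \<in> ?F"
        have "norm (c (?w i) k - c (?w j) k) \<le> sqrt \<delta>" using M[OF k, of i j] Mk[OF k] ij by simp
        then have "(norm (c (?w i) k - c (?w j) k))\<^sup>2 \<le> (sqrt \<delta>)\<^sup>2" by (intro power_mono) auto
        then show "(norm (c (?w i) k - c (?w j) k))\<^sup>2 \<le> \<delta>" using \<delta> by simp
      qed
      also have "\<dots> = (2 * real N + 1) * \<delta>" by simp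
      finally have "D * (L * (\<Sum>k\<in>?F. (norm (c (?w i) k - c (?w j) k))\<^sup>2)) \<le> D * (L * ((2 * real N + 1) * \<delta>))"
        using D1 L_pos by (intro mult_left_mono) auto
      also have "\<dots> = (D * L * (2 * real N + 1)) * \<delta>" by (simp add: ac_simps)
      also have "\<dots> = \<epsilon> / 8"
      proof -
        have "K * (\<epsilon> / (8 * K)) = \<epsilon> / 8" if "0 < K" for K :: real using that by simp
        from this[OF DL] show ?thesis unfolding \<delta>_def .
      qed
      finally have 1: "D * (L * (\<Sum>k\<in>?F. (norm (c (?w i) k - c (?w j) k))\<^sup>2)) \<le> \<epsilon> / 8" .
      have 2: "2 / real (Suc n) \<le> \<epsilon> / 4" if "n \<ge> M0" for n
      proof -
        have "8 / \<epsilon> \<le> real M0" unfolding M0_def by linarith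
        then have "8 / \<epsilon> \<le> real (Suc n)" using that by simp
        then show ?thesis using \<epsilon> by (simp add: field_simps)
      qed
      show "ip (?w i - ?w j) (?w i - ?w j) < \<epsilon>"
        using diff[of i j] 1 2[OF ij(1)] 2[OF ij(2)] \<epsilon> by linarith
    qed
  qed (rule vL)
  note cont = L2_continuous_form[OF _ _ vL gL lim]
  have ipb: "\<bar>ip u v\<bar> \<le> 1 * (sqrt (ip u u) * sqrt (ip v v))" if "u \<in> L2_per L" "v \<in> L2_per L" for u v
    using ip.abs_le[OF that] by simp
  have gg: "ip g g = 1"
    using cont(2)[OF ip.form_axioms ipb] v(2) by (simp add: LIMSEQ_const_iff)
  have gY: "ip g (e i) = 0" if "i \<in> I" for i
  proof -
    have "(\<lambda>n. ip (?w n) (e i)) \<longlonglongrightarrow> ip g (e i)"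
      using cont(1)[OF ip.form_axioms ipb] X_L2[OF eX[OF that]] by blast
    moreover have "ip (?w n) (e i) = 0" for n using v(1) that by (simp add: Y_def)
    ultimately show ?thesis by (simp add: LIMSEQ_const_iff)
  qed
  have Vlim: "(\<lambda>n. V (?w n) (?w n)) \<longlonglongrightarrow> V g g"
    by (rule cont(2)[OF form_V V_bound])
  have clim: "(\<lambda>n. c (?w n) k) \<longlonglongrightarrow> c g k" for k
  proof (rule LIM_zero_cancel, rule Lim_null_comparison[OF always_eventually])
    show "\<forall>n. norm (c (?w n) k - c g k) \<le> sqrt (ip (?w n - g) (?w n - g)) / sqrt L"
      using norm_c_le[OF L2_closed(2)[OF vL gL]] c_diff[OF vL gL] by metis
    show "(\<lambda>n. sqrt (ip (?w n - g) (?w n - g)) / sqrt L) \<longlonglongrightarrow> 0"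
      using tendsto_divide[OF tendsto_real_sqrt[OF lim] tendsto_const[of "sqrt L"]] L_pos by simp
  qed
  have fin: "a * (L * (\<Sum>k\<in>G. T k * (norm (c g k))\<^sup>2)) \<le> \<nu> - V g g" if G: "finite G" for G
  proof (rule LIMSEQ_le)
    show "(\<lambda>n. a * (L * (\<Sum>k\<in>G. T k * (norm (c (?w n) k))\<^sup>2))) \<longlonglongrightarrow> a * (L * (\<Sum>k\<in>G. T k * (norm (c g k))\<^sup>2))"
      by (intro tendsto_mult tendsto_const tendsto_sum tendsto_power tendsto_norm clim)
    have "(\<lambda>n. \<nu> + 1 / real (Suc n) - V (?w n) (?w n)) \<longlonglongrightarrow> \<nu> + 0 - V g g"
      by (intro tendsto_diff tendsto_add tendsto_const Vlim)
         (use LIMSEQ_inverse_real_of_nat in \<open>simp add: inverse_eq_divide\<close>)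
    then show "(\<lambda>n. \<nu> + 1 / real (Suc n) - V (?w n) (?w n)) \<longlonglongrightarrow> \<nu> - V g g" by simp
    show "\<exists>N. \<forall>n\<ge>N. a * (L * (\<Sum>k\<in>G. T k * (norm (c (?w n) k))\<^sup>2)) \<le> \<nu> + 1 / real (Suc n) - V (?w n) (?w n)"
    proof (intro exI[of _ 0] allI impI)
      fix n
      have "(\<Sum>k\<in>G. T k * (norm (c (?w n) k))\<^sup>2) \<le> (\<Sum>\<^sub>\<infinity>k. T k * (norm (c (?w n) k))\<^sup>2)"
        using X_T[OF vX] G by (intro finite_sum_le_infsum) (auto simp: Hw_def)
      then have "a * (L * (\<Sum>k\<in>G. T k * (norm (c (?w n) k))\<^sup>2)) \<le> a * B T (?w n) (?w n)"
        unfolding B_self using apos L_pos by (intro mult_left_mono) auto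
      moreover have "1 / real (Suc (r n)) \<le> 1 / real (Suc n)"
        using seq_suble[OF r(1), of n] by (intro divide_left_mono) auto
      ultimately show "a * (L * (\<Sum>k\<in>G. T k * (norm (c (?w n) k))\<^sup>2)) \<le> \<nu> + 1 / real (Suc n) - V (?w n) (?w n)"
        using v(3)[of "r n"] by (simp add: Q_def)
    qed
  qed
  have fin': "(\<Sum>k\<in>G. T k * (norm (c g k))\<^sup>2) \<le> (\<nu> - V g g) / (a * L)" if "finite G" for G
    using fin[OF that] apos L_pos by (simp add: field_simps)
  have sT: "(\<lambda>k. T k * (norm (c g k))\<^sup>2) summable_on UNIV"
  proof (rule nonneg_bdd_above_summable_on)
    show "bdd_above (sum (\<lambda>k. T k * (norm (c g k))\<^sup>2) ` {F. F \<subseteq> UNIV \<and> finite F})"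
    proof (rule bdd_aboveI)
      fix y assume "y \<in> sum (\<lambda>k. T k * (norm (c g k))\<^sup>2) ` {F. F \<subseteq> UNIV \<and> finite F}"
      then obtain G where "finite G" "y = (\<Sum>k\<in>G. T k * (norm (c g k))\<^sup>2)" by auto
      then show "y \<le> (\<nu> - V g g) / (a * L)" using fin' by simp
    qed
  qed simp
  have gT: "g \<in> Hw T" using sT gL by (simp add: Hw_def)
  then have gX: "g \<in> X" by (rule T_X)
  have "(\<Sum>\<^sub>\<infinity>k. T k * (norm (c g k))\<^sup>2) \<le> (\<nu> - V g g) / (a * L)"
    by (rule infsum_le_finite_sums[OF sT]) (rule fin')
  then have "a * B T g g \<le> \<nu> - V g g"
    unfolding B_self using apos L_pos by (simp add: field_simps)
  then have Qg: "Q g g \<le> \<nu>" by (simp add: Q_def)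
  have gY': "g \<in> Y" using gX gY by (simp add: Y_def)
  have Qgg: "Q g g = \<nu>" using Qg Qge[OF gY'] gg by simp
  interpret R: psd_form Y "\<lambda>u v. 1 * Q u v + (- \<nu>) * ip u v"
  proof -
    interpret QY: form Y Q by (rule Q.restrict[OF subY YX])
    interpret iY: form Y ip by (rule ipX.restrict[OF subY YX])
    interpret R: form Y "\<lambda>u v. 1 * Q u v + (- \<nu>) * ip u v"
      by (rule form_combine[OF QY.form_axioms iY.form_axioms])
    show "psd_form Y (\<lambda>u v. 1 * Q u v + (- \<nu>) * ip u v)"
      by unfold_locales (use Qge in auto)
  qed
  \<comment> \<open>Euler-Lagrange equation, tested within the constraint space only\<close>
  have ELY: "Q g v = \<nu> * ip g v" if "v \<in> Y" for v
    using R.null_vector[OF gY' that] Qgg gg by simp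
  have "Q g u = \<nu> * ip g u" if u: "u \<in> X" for u
  proof -
    let ?p = "\<Sum>i\<in>I. ip u (e i) *\<^sub>R e i"
    note b = bessel_orthonormal[OF I eX on u]
    have pX: "?p \<in> X" using eX by (intro ipX.sum_closed) auto
    have "u - ?p \<in> Y" using b(2,3) by (simp add: Y_def)
    then have 1: "Q g (u - ?p) = \<nu> * ip g (u - ?p)" by (rule ELY)
    have "Q g (e i) = 0" if i: "i \<in> I" for i
    proof -
      have "Q g (e i) = \<mu> i * ip (e i) g"
        using weak_eigD(2)[OF eig[OF i] gX] Q.sym[OF gX eX[OF i]] by simp
      then show ?thesis using gY[OF i] ipX.sym[OF gX eX[OF i]] by simp
    qed
    moreover have "Q g ?p = (\<Sum>i\<in>I. ip u (e i) * Q g (e i))" using eX by (rule Q.sum_right[OF gX])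
    moreover have "ip g ?p = (\<Sum>i\<in>I. ip u (e i) * ip g (e i))" using eX by (rule ipX.sum_right[OF gX])
    ultimately have "Q g ?p = 0" "ip g ?p = 0" using gY by simp_all
    then show ?thesis using 1 u gX pX by (simp add: Q.diff_right ipX.diff_right)
  qed
  then have "weak_eig \<nu> g" using gX by (simp add: weak_eig_def)
  then show thesis
    by (rule that[OF _ gg gY]) (auto intro!: Qge simp: Y_def)
qed

end

section \<open>Spectrum of the linearisation at the wave\<close>

text \<open>The weak derivative \<open>d\<close> and the bound \<open>C\<close> are parameters because they are only known to exist;
the bound comes from \<open>weak_deriv_bounded\<close>.\<close>

locale wave = dispersive +
  fixes \<omega> A :: real and \<phi> d :: "real \<Rightarrow> real" and C :: real
  assumes H: "hypothesis_H \<theta> m L \<omega> A \<phi>"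
    and wd: "weak_deriv L \<phi> d" and simple_d: "L0_simple_with \<theta> m L \<omega> \<phi> 0 d"
    and C0: "C \<ge> 0" and \<phi>_bound: "AE x in lborel. \<bar>\<phi> x\<bar> \<le> C"
begin

lemma \<omega>_nz: "\<omega> \<noteq> 0" and \<phi>_X: "\<phi> \<in> X" and wave_eq: "wave_solution \<theta> L \<omega> A \<phi>"
  and unique_neg: "\<exists>!\<mu>. \<mu> < 0 \<and> L0_eigenvalue \<theta> m L \<omega> \<phi> \<mu>"
  and simple_neg: "\<mu> < 0 \<Longrightarrow> L0_eigenvalue \<theta> m L \<omega> \<phi> \<mu> \<Longrightarrow> \<exists>\<eta>. L0_simple_with \<theta> m L \<omega> \<phi> \<mu> \<eta>"
  using H by (simp_all add: hypothesis_H_def H_per_eq)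

lemma \<phi>_L2: "\<phi> \<in> L2_per L" using \<phi>_X by (rule X_L2)

definition Wp :: "real \<Rightarrow> real" where "Wp x = \<omega> - 1 - \<phi> x"

lemma Wp_props: "Wp \<in> borel_measurable borel" "Wp (x + L) = Wp x" "AE x in lborel. \<bar>Wp x\<bar> \<le> \<bar>\<omega> - 1\<bar> + C"
proof -
  note [measurable] = L2_perD(1)[OF \<phi>_L2]
  show "Wp \<in> borel_measurable borel" unfolding Wp_def[abs_def] by measurable
  show "Wp (x + L) = Wp x" by (simp add: Wp_def L2_perD(3)[OF \<phi>_L2])
  show "AE x in lborel. \<bar>Wp x\<bar> \<le> \<bar>\<omega> - 1\<bar> + C" using \<phi>_bound by eventually_elim (simp add: Wp_def)
qed

sublocale op: schroedinger L \<theta> m \<omega> Wp "\<bar>\<omega> - 1\<bar> + C"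
  by unfold_locales (use \<omega>_nz Wp_props C0 in auto)

lemma eigenspace_iff: "g \<in> L0_eigenspace \<theta> m L \<omega> \<phi> \<mu> \<longleftrightarrow> op.weak_eig \<mu> g"
proof -
  have "(\<omega> * h x + (\<omega> - 1) * g x - \<phi> x * g x = \<mu> * g x) \<longleftrightarrow> (\<omega> * h x + Wp x * g x = \<mu> * g x)" for h x
    by (simp add: Wp_def algebra_simps)
  then show ?thesis by (simp add: op.weak_eig_iff_multiplier L0_eigenspace_def)
qed

lemma eigenvalueI: "op.weak_eig \<mu> g \<Longrightarrow> ip g g \<noteq> 0 \<Longrightarrow> L0_eigenvalue \<theta> m L \<omega> \<phi> \<mu>"
  using op.weak_eigD(1)[of \<mu> g] X_L2[of g] ip_zero_iff[of g]
  unfolding L0_eigenvalue_def L0_eigenfunction_def eigenspace_iff by blast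

lemma simple_withD:
  assumes "L0_simple_with \<theta> m L \<omega> \<phi> \<mu> \<eta>"
  shows "op.weak_eig \<mu> \<eta>" "ip \<eta> \<eta> > 0" "\<And>g. op.weak_eig \<mu> g \<Longrightarrow> ip g \<eta> = 0 \<Longrightarrow> ip g g = 0"
proof -
  show e: "op.weak_eig \<mu> \<eta>" using assms by (simp add: L0_simple_with_def L0_eigenfunction_def eigenspace_iff)
  have eL: "\<eta> \<in> L2_per L" using op.weak_eigD(1)[OF e] X_L2 by blast
  show "ip \<eta> \<eta> > 0"
    using assms ip_zero_iff[OF eL] ip.nonneg[OF eL] by (auto simp: L0_simple_with_def L0_eigenfunction_def)
  fix g assume g: "op.weak_eig \<mu> g" and o: "ip g \<eta> = 0"
  have gL: "g \<in> L2_per L" using op.weak_eigD(1)[OF g] X_L2 by blast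
  obtain b where b: "AE x in lborel. g x = b * \<eta> x"
    using assms g unfolding L0_simple_with_def eigenspace_iff[symmetric] by blast
  have "ip g g = ip g (b *\<^sub>R \<eta>)"
    by (rule ip_cong_AE) (use gL eL b in auto)
  then show "ip g g = 0" using o gL eL by (simp add: ip.scale_right)
qed

text \<open>If \<open>\<omega>\<close> were negative, the negative of the linearisation would be bounded below, and the variational
construction would produce arbitrarily many orthonormal eigenfunctions, all of whose eigenvalues
are at most \<open>K\<close>, as the linearisation has only one negative eigenvalue. But a bound on the form
forces a fixed part of the mass of each of them into the finitely many modes of \<open>?F\<close>, and by
Bessel's inequality each mode has only a bounded amount of mass to share among orthonormal
functions.\<close>

lemma \<omega>_pos: "\<omega> > 0"
proof (rule ccontr)
  assume "\<not> \<omega> > 0"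
  then have neg: "- \<omega> > 0" using \<omega>_nz by simp
  define Cw where "Cw = \<bar>\<omega> - 1\<bar> + C"
  interpret n: schroedinger L \<theta> m "- \<omega>" "\<lambda>x. - Wp x" Cw
    by unfold_locales (use \<omega>_nz Wp_props C0 in \<open>auto simp: Cw_def\<close>)
  have nQ: "n.Q u v = - op.Q u v" for u v
    unfolding n.Q_def op.Q_def n.V_def op.V_def ip_def n.Wm_def op.Wm_def by simp
  have neig: "op.weak_eig (- \<mu>) g" if "n.weak_eig \<mu> g" for \<mu> g
    using that unfolding n.weak_eig_def op.weak_eig_def nQ by auto
  obtain \<mu>0 where \<mu>0: "\<mu>0 < 0" "\<And>\<mu>. \<mu> < 0 \<Longrightarrow> L0_eigenvalue \<theta> m L \<omega> \<phi> \<mu> \<Longrightarrow> \<mu> = \<mu>0"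
    using unique_neg by blast
  define K where "K = - \<mu>0"
  have K: "K > 0" using \<mu>0 by (simp add: K_def)
  have nle: "\<mu> \<le> K" if "n.weak_eig \<mu> g" "ip g g = 1" for \<mu> g
  proof (cases "\<mu> \<le> 0")
    case False
    then have "- \<mu> = \<mu>0" using \<mu>0(2)[of "- \<mu>"] eigenvalueI[OF neig[OF that(1)]] that(2) by simp
    then show ?thesis by (simp add: K_def)
  qed (use K in simp)
  have seq: "\<exists>e \<mu>. (\<forall>i<n. n.weak_eig (\<mu> i) (e i)) \<and> (\<forall>i<n. \<forall>j<n. ip (e i) (e j) = (if i = j then 1 else 0))" for n :: nat
  proof (induction n)
    case (Suc n)
    then obtain e \<mu> where e: "\<And>i. i < n \<Longrightarrow> n.weak_eig (\<mu> i) (e i)"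
      "\<And>i j. i < n \<Longrightarrow> j < n \<Longrightarrow> ip (e i) (e j) = (if i = j then 1 else 0)" by blast
    obtain \<nu> g where g: "n.weak_eig \<nu> g" "ip g g = 1" "\<And>i. i \<in> {..<n} \<Longrightarrow> ip g (e i) = 0"
    proof (rule n.variational_eigenfunction[OF neg finite_lessThan, of n e \<mu>])
      fix i j assume "i \<in> {..<n}" "j \<in> {..<n}"
      then show "ip (e i) (e j) = (if i = j then 1 else 0)" using e(2) by simp
    next
      fix i assume "i \<in> {..<n}"
      then show "n.weak_eig (\<mu> i) (e i)" using e(1) by simp
    next
      fix \<nu> g
      assume "n.weak_eig \<nu> g" "ip g g = 1" "\<And>i. i \<in> {..<n} \<Longrightarrow> ip g (e i) = 0"
      then show thesis by (rule that)
    qed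
    have "ip (e i) g = 0" if "i < n" for i
      using g(3)[of i] that ipX.sym[OF n.weak_eigD(1)[OF e(1)[OF that]] n.weak_eigD(1)[OF g(1)]] by simp
    then show ?case using e g
      by (intro exI[of _ "e(n := g)"] exI[of _ "\<mu>(n := \<nu>)"]) (auto simp: less_Suc_eq)
  qed simp
  define D where "D = K + Cw"
  have D: "D > 0" using K C0 by (simp add: D_def Cw_def)
  obtain N where N: "\<And>k. k \<notin> modes N \<Longrightarrow> 2 * D / (- \<omega>) \<le> T k" using T_large by metis
  let ?F = "modes N"
  let ?n = "Suc (4 * (2 * N + 1))"
  obtain e \<mu> where e: "\<And>i. i < ?n \<Longrightarrow> n.weak_eig (\<mu> i) (e i)"
      "\<And>i j. i < ?n \<Longrightarrow> j < ?n \<Longrightarrow> ip (e i) (e j) = (if i = j then 1 else 0)" using seq[of ?n] by blast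
  have eX: "e i \<in> X" if "i < ?n" for i using n.weak_eigD(1)[OF e(1)[OF that]] .
  have half: "1 / 2 \<le> L * (\<Sum>k\<in>?F. (norm (c (e i) k))\<^sup>2)" if i: "i < ?n" for i
  proof -
    let ?e = "e i"
    have ee: "ip ?e ?e = 1" using e(2)[OF i i] by simp
    have BTe: "- \<omega> * B T ?e ?e \<le> D"
      using n.garding[OF eX[OF i]] n.weak_eigD(2)[OF e(1)[OF i] eX[OF i]] nle[OF e(1)[OF i] ee] ee
      by (simp add: D_def)
    have "2 * D * ip ?e ?e \<le> - \<omega> * B T ?e ?e + 2 * D * (L * (\<Sum>k\<in>?F. (norm (c ?e k))\<^sup>2))"
      by (rule low_mode_control[OF neg _ N eX[OF i]]) (use D in simp)
    then have "D * 1 \<le> D * (2 * (L * (\<Sum>k\<in>?F. (norm (c ?e k))\<^sup>2)))" using ee BTe by simp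
    then show ?thesis using D by simp
  qed
  have mode: "(\<Sum>i<?n. L * (norm (c (e i) k))\<^sup>2) \<le> 2" for k
  proof -
    have trig: "(\<Sum>i<?n. (L * Re (z * cnj (c (e i) k)))\<^sup>2) \<le> L" if z: "norm z = 1" for z
    proof -
      let ?t = "\<lambda>x. Re (z * ek k x)"
      have tX: "?t \<in> X" by (rule trig_Hw)
      have "(\<Sum>i<?n. (L * Re (z * cnj (c (e i) k)))\<^sup>2) = (\<Sum>i\<in>{..<?n}. (ip ?t (e i))\<^sup>2)"
        using ip_trig[OF X_L2[OF eX]] ipX.sym[OF tX eX] by (intro sum.cong) auto
      also have "\<dots> \<le> ip ?t ?t"
        by (rule n.bessel_orthonormal(1)) (use eX e(2) tX in auto)
      also have "\<dots> \<le> (\<integral>x. 1 \<partial>MP)"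
        unfolding ip_def
      proof (rule integral_mono[OF integrable_mult_L2[OF trig_L2 trig_L2]])
        fix x
        have "\<bar>?t x\<bar> \<le> 1" using abs_Re_le_cmod[of "z * ek k x"] z by (simp add: norm_mult)
        then have "\<bar>?t x\<bar> * \<bar>?t x\<bar> \<le> 1 * 1" by (intro mult_mono) auto
        then show "?t x * ?t x \<le> 1" by (simp flip: abs_mult)
      qed simp
      also have "\<dots> = L" by simp
      finally show ?thesis .
    qed
    have "(\<Sum>i<?n. L * (norm (c (e i) k))\<^sup>2) = ((\<Sum>i<?n. (L * Re (1 * cnj (c (e i) k)))\<^sup>2) + (\<Sum>i<?n. (L * Re (\<i> * cnj (c (e i) k)))\<^sup>2)) / L"
      unfolding sum.distrib[symmetric] sum_divide_distrib
      by (rule sum.cong[OF refl]) (use L_pos in \<open>simp add: cmod_power2 times_complex.sel power_mult_distrib power2_eq_square[of L] field_simps\<close>)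
    also have "\<dots> \<le> (L + L) / L"
      using trig[of 1] trig[of "\<i>"] L_pos by (intro divide_right_mono add_mono) auto
    finally show ?thesis using L_pos by simp
  qed
  have "real ?n / 2 = (\<Sum>i<?n. 1 / 2)" by simp
  also have "\<dots> \<le> (\<Sum>i<?n. L * (\<Sum>k\<in>?F. (norm (c (e i) k))\<^sup>2))"
    by (rule sum_mono) (use half in auto)
  also have "\<dots> = (\<Sum>k\<in>?F. \<Sum>i<?n. L * (norm (c (e i) k))\<^sup>2)"
    unfolding sum_distrib_left by (rule sum.swap)
  also have "\<dots> \<le> (\<Sum>k\<in>?F. 2)" by (rule sum_mono) (rule mode)
  also have "\<dots> = 2 * (2 * real N + 1)" by simp
  finally show False by simp
qed

text \<open>The minimum of the form over unit vectors orthogonal to \<open>\<eta>\<close> and \<open>d\<close> is an eigenvalue. It is neither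
negative nor zero: the corresponding eigenspaces are spanned by \<open>\<eta>\<close> and \<open>d\<close>.\<close>

lemma coercive_off_eigenvectors:
  obtains \<eta> \<nu> \<kappa> where "\<nu> > 0" "op.weak_eig (- \<nu>) \<eta>" "ip \<eta> \<eta> = 1" "\<kappa> > 0" "ip \<eta> d = 0"
    "\<And>r. r \<in> X \<Longrightarrow> ip r \<eta> = 0 \<Longrightarrow> ip r d = 0 \<Longrightarrow> \<kappa> * B (wt (m / 2)) r r \<le> op.Q r r"
proof -
  obtain \<mu>0 where \<mu>0: "\<mu>0 < 0" "L0_eigenvalue \<theta> m L \<omega> \<phi> \<mu>0"
    "\<And>\<mu>. \<mu> < 0 \<Longrightarrow> L0_eigenvalue \<theta> m L \<omega> \<phi> \<mu> \<Longrightarrow> \<mu> = \<mu>0"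
    using unique_neg by blast
  obtain \<eta>0 where s\<eta>: "L0_simple_with \<theta> m L \<omega> \<phi> \<mu>0 \<eta>0" using simple_neg \<mu>0 by blast
  note e0 = simple_withD[OF s\<eta>] and d0 = simple_withD[OF simple_d]
  have X: "\<eta>0 \<in> X" "d \<in> X" using op.weak_eigD(1) e0(1) d0(1) by auto
  have orth0: "ip \<eta>0 d = 0"
  proof -
    have "\<mu>0 * ip \<eta>0 d = 0 * ip d \<eta>0"
      using op.weak_eigD(2)[OF e0(1) X(2)] op.weak_eigD(2)[OF d0(1) X(1)] op.Q.sym[OF X] by simp
    then show ?thesis using \<mu>0(1) by simp
  qed
  define nrm where "nrm u = (1 / sqrt (ip u u)) *\<^sub>R u" for u :: "real \<Rightarrow> real"
  have eig_scale: "op.weak_eig \<mu> (b *\<^sub>R u)" if "op.weak_eig \<mu> u" for \<mu> b u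
    using that by (simp add: op.weak_eig_def op.Q.scale_left ipX.scale_left)
  define e where "e i = (if i = (0::nat) then nrm \<eta>0 else nrm d)" for i
  define \<mu> where "\<mu> i = (if i = (0::nat) then \<mu>0 else 0)" for i
  have on: "ip (e i) (e j) = (if i = j then 1 else 0)" if "i \<in> {0,1}" "j \<in> {0,1}" for i j
    using that X e0(2) d0(2) orth0 ipX.sym[OF X]
    by (auto simp: e_def nrm_def ipX.scale_left ipX.scale_right)
  have eig: "op.weak_eig (\<mu> i) (e i)" for i
    using e0(1) d0(1) by (simp add: e_def \<mu>_def nrm_def eig_scale)
  obtain l g where g: "op.weak_eig l g" "ip g g = 1" "\<And>i. i \<in> {0,1} \<Longrightarrow> ip g (e i) = 0"
    "\<And>v. v \<in> X \<Longrightarrow> (\<And>i. i \<in> {0,1} \<Longrightarrow> ip v (e i) = 0) \<Longrightarrow> l * ip v v \<le> op.Q v v"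
  proof (rule op.variational_eigenfunction[OF \<omega>_pos, of "{0,1}" e \<mu>])
    fix i j :: nat assume "i \<in> {0,1}" "j \<in> {0,1}"
    then show "ip (e i) (e j) = (if i = j then 1 else 0)" by (rule on)
  qed (use eig in simp_all)
  have gX: "g \<in> X" using op.weak_eigD(1)[OF g(1)] .
  have go: "ip g \<eta>0 = 0" "ip g d = 0"
    using g(3)[of 0] g(3)[of 1] gX X e0(2) d0(2) by (simp_all add: e_def nrm_def ipX.scale_right)
  have "l \<noteq> 0" using d0(3)[of g] g(1,2) go(2) by auto
  moreover have "\<not> l < 0"
  proof
    assume "l < 0"
    then have "l = \<mu>0" using \<mu>0(3) eigenvalueI[OF g(1)] g(2) by simp
    then show False using e0(3)[of g] g(1,2) go(1) by simp
  qed
  ultimately have l: "l > 0" by simp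
  obtain C1 where C1: "C1 > 0" "\<And>u. u \<in> X \<Longrightarrow> B (wt (m / 2)) u u \<le> C1 * (ip u u + B T u u)"
    using X_le_BT by metis
  define Cw where "Cw = \<bar>\<omega> - 1\<bar> + C"
  define K where "K = C1 * (1 / l + (1 + Cw / l) / \<omega>)"
  have Cw: "Cw \<ge> 0" using C0 by (simp add: Cw_def)
  have K: "K > 0" unfolding K_def using C1 l Cw \<omega>_pos by (intro mult_pos_pos add_pos_pos divide_pos_pos add_pos_nonneg) auto
  have coer: "1 / K * B (wt (m / 2)) r r \<le> op.Q r r"
    if r: "r \<in> X" "ip r (nrm \<eta>0) = 0" "ip r d = 0" for r
  proof -
    have "ip r (e i) = 0" if "i \<in> {0,1}" for i
      using that r X by (auto simp: e_def nrm_def ipX.scale_right)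
    then have 1: "ip r r \<le> op.Q r r / l" using g(4)[OF r(1)] l by (simp add: field_simps)
    have "\<omega> * B T r r \<le> op.Q r r + Cw * ip r r" using op.garding[OF r(1)] by (simp add: Cw_def)
    also have "\<dots> \<le> op.Q r r + Cw * (op.Q r r / l)" using mult_left_mono[OF 1 Cw] by simp
    finally have 2: "B T r r \<le> (op.Q r r + Cw * (op.Q r r / l)) / \<omega>" using \<omega>_pos by (simp add: field_simps)
    have "B (wt (m / 2)) r r \<le> C1 * (op.Q r r / l + (op.Q r r + Cw * (op.Q r r / l)) / \<omega>)"
      using C1(2)[OF r(1)] mult_left_mono[OF add_mono[OF 1 2], of C1] C1(1) by linarith
    also have "\<dots> = K * op.Q r r" by (simp add: K_def algebra_simps add_divide_distrib)
    finally show ?thesis using K by (simp add: field_simps)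
  qed
  show thesis
  proof (rule that[of "- \<mu>0" "nrm \<eta>0" "1 / K"])
    show "- \<mu>0 > 0" using \<mu>0(1) by simp
    show "op.weak_eig (- (- \<mu>0)) (nrm \<eta>0)" using e0(1) eig_scale by (simp add: nrm_def)
    show "ip (nrm \<eta>0) (nrm \<eta>0) = 1" using on[of 0 0] by (simp add: e_def)
    show "1 / K > 0" using K by simp
    show "ip (nrm \<eta>0) d = 0" using orth0 X by (simp add: nrm_def ipX.scale_left)
  qed (rule coer)
qed

section \<open>The direction \<open>1 + \<phi>\<close>\<close>

abbreviation one :: "real \<Rightarrow> real" where "one \<equiv> \<lambda>x. 1"

lemma one_X: "one \<in> X" using trig_Hw[of 1 0] by simp

lemma c_one: "c one k = (if k = 0 then 1 else 0)"
  using c_tp_single[of 1 0 k] by (cases "k = 0") auto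

lemma BT_one: "B T one v = 0"
proof -
  have "T k * Re (c one k * cnj (c v k)) = 0" for k by (simp add: c_one T_0)
  then show ?thesis unfolding B_def by (simp only: infsum_0 mult_zero_right)
qed

definition sq :: "real \<Rightarrow> real" where "sq x = (\<phi> x)\<^sup>2"

lemma sq_L2: "sq \<in> L2_per L"
proof -
  have "op.Wm \<phi> \<in> L2_per L" by (rule op.Wm_sq_le(1)[OF \<phi>_L2])
  then have "(\<omega> - 1) *\<^sub>R \<phi> - op.Wm \<phi> \<in> L2_per L" using \<phi>_L2 by (intro L2_closed)
  moreover have "(\<omega> - 1) *\<^sub>R \<phi> - op.Wm \<phi> = sq"
    by (simp add: fun_eq_iff op.Wm_def Wp_def sq_def power2_eq_square algebra_simps)
  ultimately show ?thesis by simp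
qed

text \<open>Smooth test functions suffice to determine the Fourier coefficients of the equation; all terms but
the first are square integrable because \<open>\<phi>\<close> is bounded, so Parseval's identity extends it to test
functions in the energy space.\<close>

lemma weak_wave:
  assumes v: "v \<in> X"
  shows "\<omega> * B T \<phi> v + (\<omega> - 1) * ip \<phi> v - 1/2 * ip sq v + A * ip one v = 0"
proof -
  define R where "R = (\<omega> - 1) *\<^sub>R \<phi> - (1/2) *\<^sub>R sq + A *\<^sub>R one"
  note L2 = \<phi>_L2 sq_L2 X_L2[OF one_X] X_L2[OF v]
  have RL: "R \<in> L2_per L" unfolding R_def using L2 by (intro L2_closed)
  have ipR: "ip R u = (\<omega> - 1) * ip \<phi> u - 1/2 * ip sq u + A * ip one u" if "u \<in> L2_per L" for u
    unfolding R_def using L2 that by (simp add: ip.bilin)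
  have cR: "c R k = - (\<omega> * T k) * c \<phi> k" for k
  proof -
    have "cnj (c R k) = - (\<omega> * T k) * cnj (c \<phi> k)"
    proof (rule Re_mult_eq_imp)
      fix z
      let ?e = "\<lambda>x. Re (z * ek k x)"
      have e: "?e \<in> X" "?e \<in> L2_per L" using trig_Hw trig_L2 by auto
      have "\<omega> * M_pair \<theta> L \<phi> ?e + (\<omega> - 1) * ip \<phi> ?e - 1/2 * ip sq ?e + A * ip one ?e = 0"
        using wave_eq test_fun_trig[of z k] unfolding wave_solution_def per_integral_eq ip_def sq_def by simp
      then have "ip R ?e = - \<omega> * B T \<phi> ?e"
        using ipR[OF e(2)] M_pair_eq[OF X_T[OF \<phi>_X] X_T[OF e(1)]] by simp
      then have "L * Re (z * cnj (c R k)) = L * (- \<omega> * T k * Re (z * cnj (c \<phi> k)))"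
        using RL X_T[OF \<phi>_X] by (simp add: ip_trig B_trig T_even)
      then have "Re (z * cnj (c R k)) = - \<omega> * T k * Re (z * cnj (c \<phi> k))" using L_pos mult_left_cancel[of L] by blast
      also have "\<dots> = Re (z * (- (\<omega> * T k) * cnj (c \<phi> k)))" by (simp add: times_complex.sel algebra_simps)
      finally show "Re (z * cnj (c R k)) = Re (z * (- (\<omega> * T k) * cnj (c \<phi> k)))" .
    qed
    then have "cnj (cnj (c R k)) = cnj (- (\<omega> * T k) * cnj (c \<phi> k))" by simp
    then show ?thesis by simp
  qed
  have "B (\<lambda>_. 1) R v = L * (\<Sum>\<^sub>\<infinity>k. - \<omega> * (T k * Re (c \<phi> k * cnj (c v k))))"
    unfolding B_def cR by (simp add: times_complex.sel algebra_simps)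
  also have "\<dots> = - \<omega> * B T \<phi> v" unfolding B_def infsum_cmult_right' by simp
  finally have "ip R v = - \<omega> * B T \<phi> v" using RL L2 by (simp add: parseval)
  then show ?thesis using ipR[OF L2(4)] by simp
qed

definition \<Upsilon> :: "real \<Rightarrow> real" where "\<Upsilon> = one + \<phi>"

lemma \<Upsilon>_X: "\<Upsilon> \<in> X" unfolding \<Upsilon>_def using one_X \<phi>_X by simp

text \<open>The linearisation maps \<open>1\<close> to \<open>\<omega> - 1 - \<phi>\<close> and, by the wave equation, \<open>\<phi>\<close> to
\<open>- \<omega> (\<phi> + \<M>\<phi>) + \<phi> - 2 A\<close>. In the sum the terms \<open>\<phi>\<close> cancel, and what remains is a combination of the
derivatives \<open>\<phi> + \<M>\<phi>\<close> and \<open>1\<close> of the conserved quantities \<open>F\<close> and \<open>M\<close>.\<close>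

lemma Q_\<Upsilon>:
  assumes v: "v \<in> X"
  shows "op.Q \<Upsilon> v = - \<omega> * (B T \<phi> v + ip \<phi> v) + (\<omega> - 1 - 2 * A) * ip one v"
proof -
  note L2 = \<phi>_L2 sq_L2 X_L2[OF one_X] X_L2[OF v]
  have "op.Wm one = (\<omega> - 1) *\<^sub>R one - \<phi>" by (simp add: fun_eq_iff op.Wm_def Wp_def)
  then have 1: "op.Q one v = (\<omega> - 1) * ip one v - ip \<phi> v"
    using L2 by (simp add: op.Q_def op.V_def BT_one ip.bilin)
  have "op.Wm \<phi> = (\<omega> - 1) *\<^sub>R \<phi> - sq"
    by (simp add: fun_eq_iff op.Wm_def Wp_def sq_def power2_eq_square algebra_simps)
  then have 2: "op.Q \<phi> v = \<omega> * B T \<phi> v + (\<omega> - 1) * ip \<phi> v - ip sq v"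
    using L2 by (simp add: op.Q_def op.V_def ip.bilin)
  show ?thesis unfolding \<Upsilon>_def
    using op.Q.add_left[OF one_X \<phi>_X v] 1 2 weak_wave[OF v] by (simp add: algebra_simps)
qed

lemma ip_one_one: "ip one one = L" by (simp add: ip_def)

text \<open>The wave equation tested against \<open>1\<close> eliminates the integral of \<open>\<phi>\<^sup>2\<close>.\<close>

lemma Q_\<Upsilon>_\<Upsilon>: "op.Q \<Upsilon> \<Upsilon> = - s_fun \<theta> L \<omega> A \<phi>"
proof -
  define I where "I = ip \<phi> one"
  define b where "b = B T \<phi> \<phi>"
  have BT1: "B T \<phi> one = 0" using BT_one[of \<phi>] BT.sym[OF one_X \<phi>_X] by simp
  have "ip sq one = ip \<phi> \<phi>" by (simp add: ip_def sq_def power2_eq_square)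
  then have p: "ip \<phi> \<phi> = 2 * (\<omega> - 1) * I + 2 * A * L"
    using weak_wave[OF one_X] BT1 ip_one_one by (simp add: I_def algebra_simps)
  have "op.Q \<Upsilon> \<Upsilon> = - \<omega> * (b + I + ip \<phi> \<phi>) + (\<omega> - 1 - 2 * A) * (L + I)"
    using Q_\<Upsilon>[OF \<Upsilon>_X] one_X \<phi>_X BT1 ip_one_one ipX.sym[OF one_X \<phi>_X]
    by (simp add: \<Upsilon>_def BT.add_right ipX.add_right I_def b_def)
  also have "\<dots> = - ((2 * \<omega> * (\<omega> - 1) + 2 * A + 1) * I + \<omega> * b + (2 * A * (\<omega> + 1) - \<omega> + 1) * L)"
    unfolding p by (simp add: algebra_simps)
  also have "I = set_lebesgue_integral lborel {0..L} \<phi>" by (simp add: I_def ip_def per_integral_eq)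
  also have "b = M_pair \<theta> L \<phi> \<phi>" using M_pair_eq[OF X_T[OF \<phi>_X] X_T[OF \<phi>_X]] by (simp add: b_def)
  finally show ?thesis by (simp add: s_fun_def)
qed

lemma d_X: "d \<in> X" using op.weak_eigD(1)[OF simple_withD(1)[OF simple_d]] .

theorem coercivity:
  assumes s: "s_fun \<theta> L \<omega> A \<phi> > 0"
  obtains \<kappa> where "\<kappa> > 0" "\<And>v. v \<in> X \<Longrightarrow> B (wt (m / 2)) v d = 0 \<Longrightarrow>
    \<kappa> * B (wt (m / 2)) v v \<le> op.Q v v + 2 / s_fun \<theta> L \<omega> A \<phi> * (op.Q \<Upsilon> v)\<^sup>2"
proof -
  obtain \<eta> \<nu> \<kappa> where *: "\<nu> > 0" "op.weak_eig (- \<nu>) \<eta>" "ip \<eta> \<eta> = 1" "\<kappa> > 0" "ip \<eta> d = 0"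
    and coer: "\<And>r. r \<in> X \<Longrightarrow> ip r \<eta> = 0 \<Longrightarrow> ip r d = 0 \<Longrightarrow> \<kappa> * B (wt (m / 2)) r r \<le> op.Q r r"
    using coercive_off_eigenvectors by metis
  note d0 = simple_withD[OF simple_d]
  define \<psi> where "\<psi> = (1 / sqrt (ip d d)) *\<^sub>R d"
  have \<psi>X: "\<psi> \<in> X" using d_X by (simp add: \<psi>_def)
  have \<eta>X: "\<eta> \<in> X" using op.weak_eigD(1)[OF *(2)] .
  have "\<exists>c>0. \<forall>v\<in>X. B (wt (m / 2)) v \<psi> = 0 \<longrightarrow>
      c * B (wt (m / 2)) v v \<le> op.Q v v + 2 / s_fun \<theta> L \<omega> A \<phi> * (op.Q \<Upsilon> v)\<^sup>2"
  proof (rule index_one_coercive[where ip = ip and \<nu> = \<nu> and \<kappa> = \<kappa> and \<eta> = \<eta>])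
    show "form X op.Q" by (rule op.form_Q)
    show "form X ip" by (rule ipX.form_axioms)
    show "psd_form X (B (wt (m / 2)))" by (rule BX.psd_form_axioms)
    show "ip \<psi> \<psi> = 1" using d0(2) d_X by (simp add: \<psi>_def ipX.quad_scale power_divide)
    show "ip \<eta> \<psi> = 0" using *(5) \<eta>X d_X by (simp add: \<psi>_def ipX.scale_right)
    show "op.Q \<eta> v = - \<nu> * ip \<eta> v" if "v \<in> X" for v using op.weak_eigD(2)[OF *(2) that] .
    show "op.Q \<psi> v = 0" if "v \<in> X" for v
      using op.weak_eigD(2)[OF d0(1) that] d_X that by (simp add: \<psi>_def op.Q.scale_left)
    show "\<kappa> * B (wt (m / 2)) r r \<le> op.Q r r" if "r \<in> X" "ip r \<eta> = 0" "ip r \<psi> = 0" for r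
      using coer[OF that(1,2)] that(1,3) d_X d0(2) by (simp add: \<psi>_def ipX.scale_right)
  qed (use * s Q_\<Upsilon>_\<Upsilon> \<eta>X \<psi>X \<Upsilon>_X in simp_all)
  then obtain c where c: "c > 0" "\<And>v. v \<in> X \<Longrightarrow> B (wt (m / 2)) v \<psi> = 0 \<Longrightarrow>
      c * B (wt (m / 2)) v v \<le> op.Q v v + 2 / s_fun \<theta> L \<omega> A \<phi> * (op.Q \<Upsilon> v)\<^sup>2"
    by blast
  show thesis
    by (rule that[OF c(1)]) (use c(2) d_X in \<open>simp add: \<psi>_def BX.scale_right\<close>)
qed

end

section \<open>The nearest translate\<close>

lemma infsum_dominated_to_0:
  fixes f :: "'b \<Rightarrow> 'a \<Rightarrow> real" and g :: "'a \<Rightarrow> real"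
  assumes g: "g summable_on UNIV" and b: "\<And>y k. 0 \<le> f y k" "\<And>y k. f y k \<le> g k"
    and lim: "\<And>k. ((\<lambda>y. f y k) \<longlongrightarrow> 0) F"
  shows "((\<lambda>y. \<Sum>\<^sub>\<infinity>k. f y k) \<longlongrightarrow> 0) F"
proof (rule tendstoI)
  fix e :: real assume e: "e > 0"
  have g0: "0 \<le> g k" for k using b order_trans by blast
  have sf: "f y summable_on UNIV" for y
    by (rule summable_on_comparison_test[OF g]) (use b in auto)
  obtain G where G: "finite G" "infsum g UNIV - e / 3 < sum g G"
  proof -
    have "\<forall>\<^sub>F G in finite_subsets_at_top UNIV. infsum g UNIV - e / 3 < sum g G"
      using has_sum_infsum[OF g] e unfolding has_sum_def by (intro order_tendstoD(1)) auto
    then show thesis using that by (auto simp: eventually_finite_subsets_at_top)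
  qed
  have "((\<lambda>y. \<Sum>k\<in>G. f y k) \<longlongrightarrow> (\<Sum>k\<in>G. 0)) F" by (intro tendsto_sum lim)
  then have "\<forall>\<^sub>F y in F. (\<Sum>k\<in>G. f y k) < e / 3" using e by (intro order_tendstoD(2)) auto
  then show "\<forall>\<^sub>F y in F. dist (\<Sum>\<^sub>\<infinity>k. f y k) 0 < e"
  proof eventually_elim
    case (elim y)
    have "(\<Sum>\<^sub>\<infinity>k. f y k) \<le> 2 * e / 3"
    proof (rule infsum_le_finite_sums[OF sf])
      fix E :: "'a set" assume E: "finite E"
      have "sum (f y) E \<le> sum (f y) (E \<union> G)" using E G b by (intro sum_mono2) auto
      also have "\<dots> = sum (f y) G + sum (f y) (E - G)"
      proof -
        have "sum (f y) (G \<union> (E - G)) = sum (f y) G + sum (f y) (E - G)"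
          by (rule sum.union_disjoint) (use E G in auto)
        then show ?thesis by (simp add: Un_commute)
      qed
      also have "sum (f y) (E - G) \<le> sum g (E - G)" by (intro sum_mono b)
      also have "sum g (E - G) = sum g (G \<union> (E - G)) - sum g G"
        using E G by (subst sum.union_disjoint) auto
      also have "sum g (G \<union> (E - G)) \<le> infsum g UNIV"
        using E G g0 by (intro finite_sum_le_infsum g) auto
      finally show "sum (f y) E \<le> 2 * e / 3" using elim G(2) by linarith
    qed
    moreover have "0 \<le> (\<Sum>\<^sub>\<infinity>k. f y k)" using b by (intro infsum_nonneg)
    ultimately show ?case using e by (simp add: dist_norm)
  qed
qed

context wave
begin

abbreviation w :: "int \<Rightarrow> real" where "w \<equiv> wt (m / 2)"

definition nX :: "(real \<Rightarrow> real) \<Rightarrow> real" where "nX v = sqrt (B w v v)"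

lemma nX_nonneg [simp]: "v \<in> X \<Longrightarrow> 0 \<le> nX v" using BX.nonneg[of v] by (simp add: nX_def)

lemma nX_sq: "v \<in> X \<Longrightarrow> (nX v)\<^sup>2 = B w v v" using BX.nonneg[of v] by (simp add: nX_def)

lemma H_norm_diff: "H_norm L (m / 2) (\<lambda>x. u x - v x) = nX (u - v)"
  by (simp add: H_norm_eq nX_def fun_diff_def)

definition dist_orbit :: "(real \<Rightarrow> real) \<Rightarrow> real" where "dist_orbit u = orbit_dist m L u \<phi>"

lemma dist_orbit_eq: "dist_orbit u = (INF y. nX (u - shift y \<phi>))"
  unfolding dist_orbit_def orbit_dist_def using H_norm_diff[of u "shift _ \<phi>"] by (simp add: shift_def)

text \<open>The difference quotients of the translates converge to the derivative in the energy norm, by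
dominated convergence of the Fourier series: \<open>q k h\<close> is the squared error of the difference quotient
of the exponential \<open>k\<close> and is at most four times its squared frequency, which is summable against
\<open>\<phi>\<close> because the derivative of \<open>\<phi>\<close>, an eigenfunction, lies in the energy space.\<close>

lemma translate_derivative:
  assumes u: "u \<in> X"
  shows "((\<lambda>y. B w u (shift y \<phi>)) has_real_derivative B w u (shift y d)) (at y)"
proof -
  define R where "R h = shift h \<phi> - \<phi> - h *\<^sub>R d" for h
  have RX: "R h \<in> X" for h unfolding R_def using \<phi>_X d_X by (intro BX.closed shift_Hw)
  have cd: "c d k = \<i> * freq k * c \<phi> k" for k by (rule weak_deriv_c[OF \<phi>_L2 wd])
  define q where "q k h = (norm ((cis (freq k * h) - 1) / complex_of_real h - \<i> * freq k))\<^sup>2" for k h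
  have cR: "c (R h) k = (cis (freq k * h) - 1 - \<i> * freq k * h) * c \<phi> k" for h k
  proof -
    have "c (R h) k = c (shift h \<phi> - \<phi>) k - c (h *\<^sub>R d) k" unfolding R_def
      using X_L2[OF d_X] \<phi>_L2 by (intro c_diff) auto
    also have "c (shift h \<phi> - \<phi>) k = c (shift h \<phi>) k - c \<phi> k" using \<phi>_L2 by (intro c_diff) auto
    also have "c (h *\<^sub>R d) k = complex_of_real h * c d k" by (rule c_scale)
    also have "c (shift h \<phi>) k = cis (freq k * h) * c \<phi> k"
      using \<phi>_L2 by (simp add: c_shift ek_def freq_def mult.commute)
    finally show ?thesis by (simp add: cd algebra_simps)
  qed
  have quot: "B w (R h) (R h) / h\<^sup>2 = L * (\<Sum>\<^sub>\<infinity>k. w k * (q k h * (norm (c \<phi> k))\<^sup>2))" if "h \<noteq> 0" for h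
  proof -
    have "(norm (c (R h) k))\<^sup>2 = h\<^sup>2 * (q k h * (norm (c \<phi> k))\<^sup>2)" for k
    proof -
      have "cis (freq k * h) - 1 - \<i> * freq k * h = complex_of_real h * ((cis (freq k * h) - 1) / complex_of_real h - \<i> * freq k)"
        using that by (simp add: field_simps)
      then show ?thesis by (simp add: cR q_def norm_mult power_mult_distrib)
    qed
    then have "B w (R h) (R h) = L * (\<Sum>\<^sub>\<infinity>k. h\<^sup>2 * (w k * (q k h * (norm (c \<phi> k))\<^sup>2)))"
      unfolding B_self by (simp add: mult.left_commute)
    then show ?thesis using that by (simp add: infsum_cmult_right')
  qed
  have q4: "q k h \<le> 4 * (freq k)\<^sup>2" for k h
  proof -
    have "norm (cis (freq k * h) - 1) \<le> \<bar>freq k * h\<bar>"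
    proof -
      have "(norm (cis t - 1))\<^sup>2 \<le> t\<^sup>2" for t :: real
      proof -
        have "(norm (cis t - 1))\<^sup>2 = 2 - 2 * cos t"
          using sin_cos_squared_add[of t] by (simp add: cmod_power2 power2_diff)
        also have "\<dots> = 4 * (sin (t / 2))\<^sup>2" using cos_double_sin[of "t / 2"] by simp
        also have "\<dots> \<le> 4 * (t / 2)\<^sup>2"
          using abs_sin_x_le_abs_x[of "t / 2"] unfolding abs_le_square_iff by (intro mult_left_mono) auto
        finally show ?thesis by (simp add: power_divide)
      qed
      from this[of "freq k * h"] show ?thesis by (intro power2_le_imp_le[OF _ abs_ge_zero]) (simp only: power2_abs)
    qed
    then have "norm ((cis (freq k * h) - 1) / complex_of_real h) \<le> \<bar>freq k\<bar>"
      by (cases "h = 0") (auto simp: norm_divide abs_mult field_simps)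
    then have "norm ((cis (freq k * h) - 1) / complex_of_real h - \<i> * freq k) \<le> \<bar>freq k\<bar> + \<bar>freq k\<bar>"
      by (intro order_trans[OF norm_triangle_ineq4] add_mono) (auto simp: norm_mult)
    then have "q k h \<le> (2 * \<bar>freq k\<bar>)\<^sup>2" unfolding q_def by (intro power_mono) auto
    then show ?thesis by (simp add: power_mult_distrib)
  qed
  have q0: "((\<lambda>h. q k h) \<longlongrightarrow> 0) (at 0)" for k
  proof -
    have "((\<lambda>z. exp (\<i> * freq k * z)) has_field_derivative \<i> * freq k) (at 0)"
      by (auto intro!: derivative_eq_intros)
    then have 1: "((\<lambda>z. (exp (\<i> * freq k * z) - 1) / z) \<longlongrightarrow> \<i> * freq k) (at 0)"
      by (simp add: DERIV_def)
    have "filterlim complex_of_real (at 0) (at 0)"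
      unfolding filterlim_at using tendsto_of_real[OF tendsto_ident_at[of "0 :: real" UNIV], where 'a = complex]
      by (auto simp: eventually_at_filter)
    from filterlim_compose[OF 1 this]
    have "((\<lambda>h. (cis (freq k * h) - 1) / complex_of_real h) \<longlongrightarrow> \<i> * freq k) (at 0)"
      by (simp add: cis_conv_exp mult.assoc)
    then have "((\<lambda>h. (norm ((cis (freq k * h) - 1) / complex_of_real h - \<i> * freq k))\<^sup>2) \<longlongrightarrow> (norm (\<i> * freq k - \<i> * freq k))\<^sup>2) (at 0)"
      by (intro tendsto_intros)
    then show ?thesis by (simp add: q_def)
  qed
  have "((\<lambda>h. \<Sum>\<^sub>\<infinity>k. w k * (q k h * (norm (c \<phi> k))\<^sup>2)) \<longlongrightarrow> 0) (at 0)"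
  proof (rule infsum_dominated_to_0)
    show "(\<lambda>k. 4 * (w k * (norm (c d k))\<^sup>2)) summable_on UNIV"
      using d_X by (intro summable_on_cmult_right) (simp add: Hw_def)
    fix h k
    show "0 \<le> w k * (q k h * (norm (c \<phi> k))\<^sup>2)" by (simp add: q_def)
    have "w k * (q k h * (norm (c \<phi> k))\<^sup>2) \<le> w k * (4 * (freq k)\<^sup>2 * (norm (c \<phi> k))\<^sup>2)"
      using q4 by (intro mult_left_mono mult_right_mono) auto
    then show "w k * (q k h * (norm (c \<phi> k))\<^sup>2) \<le> 4 * (w k * (norm (c d k))\<^sup>2)"
      by (simp add: cd norm_mult power_mult_distrib)
  next
    fix k
    show "((\<lambda>h. w k * (q k h * (norm (c \<phi> k))\<^sup>2)) \<longlongrightarrow> 0) (at 0)"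
      using tendsto_mult[OF tendsto_const[of "w k"] tendsto_mult[OF q0[of k] tendsto_const[of "(norm (c \<phi> k))\<^sup>2"]]] by simp
  qed
  then have "((\<lambda>h. L * (\<Sum>\<^sub>\<infinity>k. w k * (q k h * (norm (c \<phi> k))\<^sup>2))) \<longlongrightarrow> L * 0) (at 0)"
    by (intro tendsto_mult tendsto_const)
  then have "((\<lambda>h. B w (R h) (R h) / h\<^sup>2) \<longlongrightarrow> 0) (at 0)"
    unfolding mult_zero_right
    by (rule Lim_transform_eventually) (simp add: eventually_at_filter quot)
  from tendsto_real_sqrt[OF this]
  have sq: "((\<lambda>h. nX u * (nX (R h) / \<bar>h\<bar>)) \<longlongrightarrow> 0) (at 0)"
    using tendsto_mult[OF tendsto_const[of "nX u"], of "\<lambda>h. sqrt (B w (R h) (R h) / h\<^sup>2)" 0]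
    by (simp add: nX_def real_sqrt_divide)
  have "((\<lambda>h. (B w u (shift (y + h) \<phi>) - B w u (shift y \<phi>)) / h) \<longlongrightarrow> B w u (shift y d)) (at 0)"
  proof (rule LIM_zero_cancel, rule Lim_null_comparison[OF _ sq])
    show "\<forall>\<^sub>F h in at 0. norm ((B w u (shift (y + h) \<phi>) - B w u (shift y \<phi>)) / h - B w u (shift y d)) \<le> nX u * (nX (R h) / \<bar>h\<bar>)"
      unfolding eventually_at_filter
    proof (intro always_eventually allI impI)
      fix h :: real assume h: "h \<noteq> 0"
      have sR: "shift y (R h) = shift (y + h) \<phi> - shift y \<phi> - h *\<^sub>R shift y d"
        by (simp add: fun_eq_iff R_def shift_def add.assoc add.commute[of h])
      have e: "B w u (shift y (R h)) = B w u (shift (y + h) \<phi>) - B w u (shift y \<phi>) - h * B w u (shift y d)"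
        unfolding sR using u \<phi>_X d_X by (simp add: BX.diff_right BX.scale_right)
      have "\<bar>B w u (shift y (R h))\<bar> \<le> nX u * nX (shift y (R h))"
        unfolding nX_def using u RX by (intro BX.abs_le) auto
      also have "nX (shift y (R h)) = nX (R h)" using RX X_L2 by (simp add: nX_def B_shift)
      finally have "\<bar>B w u (shift y (R h))\<bar> / \<bar>h\<bar> \<le> nX u * nX (R h) / \<bar>h\<bar>" by (intro divide_right_mono) auto
      moreover have "(B w u (shift (y + h) \<phi>) - B w u (shift y \<phi>)) / h - B w u (shift y d) = B w u (shift y (R h)) / h"
        using h by (simp add: e field_simps)
      ultimately show "norm ((B w u (shift (y + h) \<phi>) - B w u (shift y \<phi>)) / h - B w u (shift y d)) \<le> nX u * (nX (R h) / \<bar>h\<bar>)"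
        by simp
    qed
  qed
  then show ?thesis by (simp add: DERIV_def)
qed

lemma B_\<phi>_d: "B w \<phi> d = 0"
proof -
  have "w k * Re (c \<phi> k * cnj (c d k)) = 0" for k
    by (simp add: weak_deriv_c[OF \<phi>_L2 wd] times_complex.sel)
  then show ?thesis unfolding B_def by (simp only: infsum_0 mult_zero_right)
qed

text \<open>All translates have the same norm, so the nearest one maximises the inner product with \<open>u\<close>, a
periodic differentiable function of the translation. At the maximum its derivative vanishes, which
is the orthogonality to the derivative of the wave.\<close>

lemma nearest_translate:
  assumes u: "u \<in> X"
  shows "\<exists>y. dist_orbit u = nX (u - shift y \<phi>) \<and> B w (shift (- y) u - \<phi>) d = 0"
    and "dist_orbit u \<le> nX (u - shift z \<phi>)"
proof -
  let ?b = "\<lambda>y. B w u (shift y \<phi>)"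
  note der = translate_derivative[OF u]
  have "continuous_on {0..L} ?b"
    using der by (meson DERIV_isCont continuous_at_imp_continuous_on)
  then obtain y where y: "y \<in> {0..L}" "\<And>z. z \<in> {0..L} \<Longrightarrow> ?b z \<le> ?b y"
    using continuous_attains_sup[of "{0..L}" ?b] L_pos by auto
  have per: "?b (z + L) = ?b z" for z
  proof -
    have "shift (z + L) \<phi> = shift z \<phi>"
      using L2_perD(3)[OF \<phi>_L2] by (simp add: fun_eq_iff shift_def add.assoc[symmetric])
    then show ?thesis by simp
  qed
  have max: "?b z \<le> ?b y" for z
  proof -
    define n where "n = - \<lfloor>z / L\<rfloor>"
    have "z + of_int n * L \<in> {0..L}"
      using L_pos floor_divide_lower[of L z] floor_divide_upper[of L z] by (auto simp: n_def algebra_simps)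
    then show ?thesis using y(2) periodic_int[of ?b z n, OF per] by metis
  qed
  have d0: "B w u (shift y d) = 0" by (rule DERIV_local_max[OF der, of 1]) (use max in auto)
  have dist: "(nX (u - shift z \<phi>))\<^sup>2 = B w u u - 2 * ?b z + B w \<phi> \<phi>" for z
    using u \<phi>_X \<phi>_L2 by (simp add: nX_sq BX.quad_diff B_shift)
  have le: "nX (u - shift y \<phi>) \<le> nX (u - shift z \<phi>)" for z
    by (rule power2_le_imp_le) (use dist max[of z] u \<phi>_X in auto)
  have bdd: "bdd_below (range (\<lambda>y. nX (u - shift y \<phi>)))"
    by (rule bdd_belowI[of _ 0]) (use u \<phi>_X in auto)
  have eq: "dist_orbit u = nX (u - shift y \<phi>)"
    unfolding dist_orbit_eq
    by (intro antisym cINF_lower[OF bdd] cINF_greatest le) auto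
  have "B w (u - shift y \<phi>) (shift y d) = 0"
    using u \<phi>_X d_X d0 X_L2[OF \<phi>_X] X_L2[OF d_X] B_\<phi>_d by (simp add: BX.diff_left B_shift)
  moreover have "B w (shift (- y) (u - shift y \<phi>)) (shift (- y) (shift y d)) = B w (u - shift y \<phi>) (shift y d)"
    using u \<phi>_X d_X X_L2 by (intro B_shift L2_closed shift_L2) auto
  ultimately have "B w (shift (- y) u - \<phi>) d = 0" by (simp add: shift_diff)
  then show "\<exists>y. dist_orbit u = nX (u - shift y \<phi>) \<and> B w (shift (- y) u - \<phi>) d = 0"
    using eq by blast
  show "dist_orbit u \<le> nX (u - shift z \<phi>)" unfolding eq by (rule le)
qed

lemma nX_shift: "u \<in> X \<Longrightarrow> nX (shift y u) = nX u"
  by (simp add: nX_def B_shift X_L2)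

lemma dist_orbit_lipschitz:
  assumes "u \<in> X" "v \<in> X"
  shows "dist_orbit u \<le> nX (u - v) + dist_orbit v"
proof -
  obtain y where y: "dist_orbit v = nX (v - shift y \<phi>)" using nearest_translate(1)[OF assms(2)] by blast
  have "dist_orbit u \<le> nX (u - shift y \<phi>)" by (rule nearest_translate(2)[OF assms(1)])
  also have "u - shift y \<phi> = (u - v) + (v - shift y \<phi>)" by simp
  also have "nX ((u - v) + (v - shift y \<phi>)) \<le> nX (u - v) + nX (v - shift y \<phi>)"
    unfolding nX_def using assms \<phi>_X by (intro BX.triangle) auto
  finally show ?thesis using y by simp
qed

section \<open>The conserved quantities near the wave\<close>

definition cub :: "(real \<Rightarrow> real) \<Rightarrow> real" where "cub u = (\<integral>x. (u x) ^ 3 \<partial>MP)"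

lemma cub_bound:
  obtains K where "K > 0" "\<And>u. u \<in> X \<Longrightarrow> integrable MP (\<lambda>x. (u x) ^ 3)"
    "\<And>u. u \<in> X \<Longrightarrow> \<bar>cub u\<bar> \<le> K * nX u ^ 3"
proof -
  obtain K where K: "K > 0" "\<And>u. u \<in> X \<Longrightarrow> integrable MP (\<lambda>x. \<bar>u x\<bar> ^ 3)"
    "\<And>u. u \<in> X \<Longrightarrow> (\<integral>x. \<bar>u x\<bar> ^ 3 \<partial>MP) \<le> K * sqrt (B w u u) ^ 3"
  proof (rule sobolev_L3[of "m / 2"])
    show "1 / 6 < m / 2" using m_pos by simp
  qed (rule that)
  have int: "integrable MP (\<lambda>x. (u x) ^ 3)" if u: "u \<in> X" for u
  proof (rule Bochner_Integration.integrable_bound[OF K(2)[OF u]])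
    have [measurable]: "u \<in> borel_measurable borel" using X_L2[OF u] by (rule L2_perD)
    show "(\<lambda>x. (u x) ^ 3) \<in> borel_measurable MP" by (rule measurable_MP) measurable
  qed (simp add: power_abs)
  have "\<bar>cub u\<bar> \<le> K * nX u ^ 3" if u: "u \<in> X" for u
  proof -
    have "\<bar>cub u\<bar> \<le> (\<integral>x. \<bar>u x\<bar> ^ 3 \<partial>MP)"
      using integral_abs_bound[of MP "\<lambda>x. (u x) ^ 3"] by (simp add: cub_def power_abs)
    then show ?thesis using K(3)[OF u] by (simp add: nX_def)
  qed
  then show thesis using that K(1) int by blast
qed

lemma integrable_cube: "u \<in> X \<Longrightarrow> integrable MP (\<lambda>x. (u x) ^ 3)"
  using cub_bound by metis

text \<open>The wave is a critical point of \<open>G\<close>, and its second variation there is the linearisation. The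
derivative of \<open>N\<close> at the wave is the image of \<open>1 + \<phi>\<close> under the linearisation.\<close>

definition G :: "(real \<Rightarrow> real) \<Rightarrow> real" where
  "G u = P_fun \<theta> L u + (\<omega> - 1) * F_fun \<theta> L u + A * M_fun L u"

definition N :: "(real \<Rightarrow> real) \<Rightarrow> real" where
  "N u = - \<omega> * F_fun \<theta> L u + (\<omega> - 1 - 2 * A) * M_fun L u"

lemma ip_one: "ip one u = (\<integral>x. u x \<partial>MP)" by (simp add: ip_def)

lemma G_eq: "u \<in> X \<Longrightarrow> G u = \<omega> / 2 * B T u u + (\<omega> - 1) / 2 * ip u u - cub u / 6 + A * ip one u"
  by (simp add: G_def P_fun_def F_fun_def M_fun_def M_pair_eq X_T per_integral_eq cub_def ip_one)
     (simp add: ip_def power2_eq_square algebra_simps add_divide_distrib diff_divide_distrib)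

lemma N_eq: "u \<in> X \<Longrightarrow> N u = - \<omega> / 2 * (B T u u + ip u u) + (\<omega> - 1 - 2 * A) * ip one u"
  by (simp add: N_def F_fun_def M_fun_def M_pair_eq X_T per_integral_eq ip_one)
     (simp add: ip_def power2_eq_square algebra_simps)

lemma cub_expand:
  assumes v: "v \<in> X"
  shows "cub (\<phi> + v) = cub \<phi> + 3 * ip sq v + 3 * ((\<omega> - 1) * ip v v - op.V v v) + cub v"
proof -
  define pv where "pv = (\<omega> - 1) *\<^sub>R v - op.Wm v"
  have vL: "v \<in> L2_per L" using v X_L2 by blast
  have pvL: "pv \<in> L2_per L" unfolding pv_def using op.Wm_sq_le(1)[OF vL] vL by (intro L2_closed)
  have pv: "pv x = \<phi> x * v x" for x by (simp add: pv_def op.Wm_def Wp_def algebra_simps)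
  have e: "((\<phi> + v) x) ^ 3 = (\<phi> x) ^ 3 + (3 * (sq x * v x) + (3 * (pv x * v x) + (v x) ^ 3))" for x
    by (simp add: pv sq_def power3_eq_cube power2_eq_square algebra_simps)
  have "cub (\<phi> + v) = cub \<phi> + (3 * ip sq v + (3 * ip pv v + cub v))"
    unfolding cub_def e ip_def
    using integrable_cube[OF \<phi>_X] integrable_cube[OF v] integrable_mult_L2[OF sq_L2 vL] integrable_mult_L2[OF pvL vL]
    by simp
  also have "ip pv v = (\<omega> - 1) * ip v v - op.V v v"
    unfolding pv_def op.V_def using vL op.Wm_sq_le(1)[OF vL] by (simp add: ip.bilin)
  finally show ?thesis by (simp only: add.assoc)
qed

lemma G_expand:
  assumes v: "v \<in> X"
  shows "G (\<phi> + v) - G \<phi> = op.Q v v / 2 - cub v / 6"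
proof -
  have pv: "\<phi> + v \<in> X" using \<phi>_X v by simp
  show ?thesis
    using weak_wave[OF v]
    unfolding G_eq[OF pv] G_eq[OF \<phi>_X] BT.quad_add[OF \<phi>_X v] ipX.quad_add[OF \<phi>_X v]
      ipX.add_right[OF \<phi>_X v one_X] cub_expand[OF v] op.Q_def
    by (simp add: algebra_simps add_divide_distrib diff_divide_distrib)
qed

lemma N_expand:
  assumes v: "v \<in> X"
  shows "N (\<phi> + v) - N \<phi> = op.Q \<Upsilon> v - \<omega> / 2 * (B T v v + ip v v)"
proof -
  have pv: "\<phi> + v \<in> X" using \<phi>_X v by simp
  show ?thesis unfolding N_eq[OF pv] N_eq[OF \<phi>_X] Q_\<Upsilon>[OF v] BT.quad_add[OF \<phi>_X v]
      ipX.quad_add[OF \<phi>_X v] ipX.add_right[OF \<phi>_X v one_X]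
    by (simp add: algebra_simps)
qed

lemma shift_invariant:
  assumes u: "u \<in> X"
  shows "G (shift y u) = G u" "N (shift y u) = N u"
proof -
  have uL: "u \<in> L2_per L" using u X_L2 by blast
  note [measurable] = L2_perD(1)[OF uL]
  have "cub (shift y u) = cub u" unfolding cub_def shift_def
    by (rule shift_integral(2)) (use integrable_cube[OF u] L2_perD(3)[OF uL] in auto)
  moreover have "ip (shift y u) (shift y u) = ip u u" using uL by (simp add: parseval B_shift)
  moreover have "ip one (shift y u) = ip one u"
    unfolding ip_one shift_def by (rule shift_integral(2)) (use integrable_L2[OF uL] L2_perD[OF uL] in auto)
  ultimately show "G (shift y u) = G u" "N (shift y u) = N u"
    using u uL by (simp_all add: G_eq N_eq B_shift)
qed

lemma Q_bounded: obtains K where "K > 0" "\<And>u v. u \<in> X \<Longrightarrow> v \<in> X \<Longrightarrow> \<bar>op.Q u v\<bar> \<le> K * (nX u * nX v)"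
proof -
  obtain C1 where C1: "C1 > 0" "\<And>u. u \<in> X \<Longrightarrow> B T u u \<le> C1 * B w u u" using BT_le_X by metis
  define Cw where "Cw = \<bar>\<omega> - 1\<bar> + C"
  have Cw: "0 \<le> Cw" using C0 by (simp add: Cw_def)
  have "\<bar>op.Q u v\<bar> \<le> (\<omega> * C1 + Cw) * (nX u * nX v)" if u: "u \<in> X" and v: "v \<in> X" for u v
  proof -
    have s: "sqrt (B T x x) \<le> sqrt C1 * nX x" "sqrt (ip x x) \<le> nX x" if "x \<in> X" for x
      using C1(2)[OF that] ip_le_X[OF that] by (simp_all add: nX_def real_sqrt_mult[symmetric])
    have "\<bar>B T u v\<bar> \<le> sqrt (B T u u) * sqrt (B T v v)" using u v by (rule BT.abs_le)
    also have "\<dots> \<le> (sqrt C1 * nX u) * (sqrt C1 * nX v)"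
      using s u v BT.nonneg[OF v] C1(1) by (intro mult_mono) auto
    also have "\<dots> = C1 * (nX u * nX v)" using C1(1) by simp
    finally have 1: "\<bar>B T u v\<bar> \<le> C1 * (nX u * nX v)" .
    have "\<bar>op.V u v\<bar> \<le> Cw * (sqrt (ip u u) * sqrt (ip v v))"
      unfolding Cw_def using u v X_L2 by (intro op.V_bound) auto
    also have "\<dots> \<le> Cw * (nX u * nX v)"
      using s u v ipX.nonneg[OF v] Cw by (intro mult_left_mono mult_mono) auto
    finally have 2: "\<bar>op.V u v\<bar> \<le> Cw * (nX u * nX v)" .
    have "\<bar>op.Q u v\<bar> \<le> \<omega> * \<bar>B T u v\<bar> + \<bar>op.V u v\<bar>"
      unfolding op.Q_def using abs_triangle_ineq[of "\<omega> * B T u v" "op.V u v"] \<omega>_pos by (simp add: abs_mult)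
    also have "\<dots> \<le> \<omega> * (C1 * (nX u * nX v)) + Cw * (nX u * nX v)"
      using 1 2 \<omega>_pos by (intro add_mono mult_left_mono) auto
    finally show ?thesis by (simp add: algebra_simps)
  qed
  moreover have "\<omega> * C1 + Cw > 0" using \<omega>_pos C1 Cw by (intro add_pos_nonneg) auto
  ultimately show thesis using that by blast
qed

text \<open>Along the nearest translate \<open>u = \<phi> + v\<close>, up to higher order terms \<open>Ly\<close> is
\<open>Q v v / 2 + (2 / s) (Q \<Upsilon> v)\<^sup>2\<close>. The factor of the square is twice the one that coercivity of
\<open>Q v v / 2\<close> asks for: half of it is given up to split off the quadratic remainder of \<open>N\<close> by
\<open>(x - y)\<^sup>2 \<ge> x\<^sup>2 / 2 - y\<^sup>2\<close>. The cubic term of \<open>G\<close> and the square of that remainder are of higher order.\<close>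

lemma lyapunov:
  assumes s: "s_fun \<theta> L \<omega> A \<phi> > 0"
  defines "Ly \<equiv> \<lambda>u. G u - G \<phi> + 2 / s_fun \<theta> L \<omega> A \<phi> * (N u - N \<phi>)\<^sup>2"
  obtains \<kappa> r0 K where "\<kappa> > 0" "r0 > 0" "K > 0"
    "\<And>u. u \<in> X \<Longrightarrow> dist_orbit u < r0 \<Longrightarrow> \<kappa> * (dist_orbit u)\<^sup>2 \<le> Ly u"
    "\<And>u. u \<in> X \<Longrightarrow> nX (u - \<phi>) \<le> 1 \<Longrightarrow> Ly u \<le> K * (nX (u - \<phi>))\<^sup>2"
proof -
  let ?s = "s_fun \<theta> L \<omega> A \<phi>"
  obtain \<kappa> where \<kappa>: "\<kappa> > 0" "\<And>v. v \<in> X \<Longrightarrow> B w v d = 0 \<Longrightarrow>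
    \<kappa> * B w v v \<le> op.Q v v + 2 / ?s * (op.Q \<Upsilon> v)\<^sup>2" using coercivity[OF s] by metis
  obtain K3 where K3: "K3 > 0" "\<And>u. u \<in> X \<Longrightarrow> \<bar>cub u\<bar> \<le> K3 * nX u ^ 3" using cub_bound by metis
  obtain KQ where KQ: "KQ > 0" "\<And>u v. u \<in> X \<Longrightarrow> v \<in> X \<Longrightarrow> \<bar>op.Q u v\<bar> \<le> KQ * (nX u * nX v)"
    using Q_bounded by metis
  obtain C1 where C1: "C1 > 0" "\<And>u. u \<in> X \<Longrightarrow> B T u u \<le> C1 * B w u u" using BT_le_X by metis
  define Kr where "Kr = \<omega> / 2 * (C1 + 1)"
  have Kr0: "Kr > 0" using \<omega>_pos C1 by (simp add: Kr_def)
  define rem where "rem v = \<omega> / 2 * (B T v v + ip v v)" for v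
  have rem: "0 \<le> rem v" "rem v \<le> Kr * (nX v)\<^sup>2" if v: "v \<in> X" for v
  proof -
    show "0 \<le> rem v" unfolding rem_def using v \<omega>_pos BT.nonneg ipX.nonneg by simp
    have "B T v v + ip v v \<le> C1 * (nX v)\<^sup>2 + (nX v)\<^sup>2"
      using C1(2)[OF v] ip_le_X[OF v] v by (intro add_mono) (auto simp: nX_sq)
    then have "rem v \<le> \<omega> / 2 * (C1 * (nX v)\<^sup>2 + (nX v)\<^sup>2)"
      unfolding rem_def using \<omega>_pos by (intro mult_left_mono) auto
    then show "rem v \<le> Kr * (nX v)\<^sup>2" by (simp add: Kr_def algebra_simps)
  qed
  have Ly: "Ly (\<phi> + v) = op.Q v v / 2 - cub v / 6 + 2 / ?s * (op.Q \<Upsilon> v - rem v)\<^sup>2" if "v \<in> X" for v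
    unfolding Ly_def G_expand[OF that] N_expand[OF that] rem_def ..
  define E where "E = K3 / 6 + 2 / ?s * Kr\<^sup>2"
  have E: "E > 0" using K3(1) s by (simp add: E_def add_pos_nonneg)
  define r0 where "r0 = min 1 (\<kappa> / (4 * E))"
  have r0: "r0 > 0" "r0 \<le> 1" "E * r0 \<le> \<kappa> / 4"
  proof -
    show "r0 > 0" "r0 \<le> 1" using \<kappa> E by (simp_all add: r0_def)
    have "E * r0 \<le> E * (\<kappa> / (4 * E))" using E by (intro mult_left_mono) (auto simp: r0_def)
    then show "E * r0 \<le> \<kappa> / 4" using E by simp
  qed
  have lower: "\<kappa> / 4 * (nX v)\<^sup>2 \<le> Ly (\<phi> + v)" if v: "v \<in> X" "B w v d = 0" "nX v < r0" for v
  proof -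
    define n where "n = nX v"
    define x where "x = op.Q \<Upsilon> v"
    have n: "0 \<le> n" "n < r0" using v by (auto simp: n_def)
    have c: "cub v \<le> K3 * n ^ 3" using K3(2)[OF v(1)] by (simp add: n_def)
    have coer: "\<kappa> * n\<^sup>2 \<le> op.Q v v + 2 / ?s * x\<^sup>2" using \<kappa>(2)[OF v(1,2)] v(1) by (simp add: n_def x_def nX_sq)
    have "0 \<le> (x - 2 * rem v)\<^sup>2" by simp
    then have "x\<^sup>2 / 2 - (rem v)\<^sup>2 \<le> (x - rem v)\<^sup>2" by (simp add: power2_eq_square algebra_simps)
    then have a: "2 / ?s * (x\<^sup>2 / 2 - (rem v)\<^sup>2) \<le> 2 / ?s * (x - rem v)\<^sup>2" using s by (intro mult_left_mono) auto
    have "(rem v)\<^sup>2 \<le> (Kr * n\<^sup>2)\<^sup>2" using rem[OF v(1)] by (intro power_mono) (auto simp: n_def)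
    also have "\<dots> = Kr\<^sup>2 * n ^ 4" by (simp add: power_mult_distrib flip: power_mult)
    also have "\<dots> \<le> Kr\<^sup>2 * n ^ 3" using n r0 by (intro mult_left_mono power_decreasing) auto
    finally have b: "2 / ?s * (rem v)\<^sup>2 \<le> 2 / ?s * (Kr\<^sup>2 * n ^ 3)" using s by (intro mult_left_mono) auto
    have "E * n ^ 3 = (E * n) * n\<^sup>2" by (simp add: power3_eq_cube power2_eq_square)
    also have "\<dots> \<le> (\<kappa> / 4) * n\<^sup>2"
    proof (rule mult_right_mono)
      have "E * n \<le> E * r0" using n E by (intro mult_left_mono) auto
      then show "E * n \<le> \<kappa> / 4" using r0 by linarith
    qed simp
    finally have e: "E * n ^ 3 \<le> \<kappa> / 4 * n\<^sup>2" .
    have E3: "E * n ^ 3 = K3 * n ^ 3 / 6 + 2 / ?s * (Kr\<^sup>2 * n ^ 3)" by (simp add: E_def algebra_simps)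
    have split: "2 / ?s * (x\<^sup>2 / 2 - (rem v)\<^sup>2) = (2 / ?s * x\<^sup>2) / 2 - 2 / ?s * (rem v)\<^sup>2"
      by (simp add: algebra_simps)
    have lin: "k \<le> q / 2 - c' / 6 + Y"
      if "c' \<le> t" "4 * k \<le> q + Z" "Z / 2 - R \<le> Y" "R \<le> R'" "t / 6 + R' \<le> k"
      for k q c' Y t Z R R' :: real using that by linarith
    show ?thesis unfolding Ly[OF v(1)] x_def[symmetric] n_def[symmetric]
    proof (rule lin[OF c _ _ b])
      show "4 * (\<kappa> / 4 * n\<^sup>2) \<le> op.Q v v + 2 / ?s * x\<^sup>2" using coer by simp
      show "2 / ?s * x\<^sup>2 / 2 - 2 / ?s * (rem v)\<^sup>2 \<le> 2 / ?s * (x - rem v)\<^sup>2" using a split by metis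
      show "K3 * n ^ 3 / 6 + 2 / ?s * (Kr\<^sup>2 * n ^ 3) \<le> \<kappa> / 4 * n\<^sup>2" using e E3 by metis
    qed
  qed
  have one: "\<kappa> / 4 * (dist_orbit u)\<^sup>2 \<le> Ly u" if u: "u \<in> X" "dist_orbit u < r0" for u
  proof -
    obtain y where y: "dist_orbit u = nX (u - shift y \<phi>)" "B w (shift (- y) u - \<phi>) d = 0"
      using nearest_translate(1)[OF u(1)] by blast
    define v where "v = shift (- y) u - \<phi>"
    have vX: "v \<in> X" unfolding v_def using u \<phi>_X by auto
    have "v = shift (- y) (u - shift y \<phi>)" by (simp add: v_def shift_diff)
    then have nv: "nX v = dist_orbit u" using y(1) u \<phi>_X by (simp add: nX_shift)
    have "\<phi> + v = shift (- y) u" by (simp add: v_def)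
    then have "Ly (\<phi> + v) = Ly u" unfolding Ly_def using shift_invariant[OF u(1)] by simp
    then show ?thesis using lower[OF vX] y(2) u(2) nv by (simp add: v_def)
  qed
  define K where "K = KQ / 2 + K3 / 6 + 2 / ?s * (KQ * nX \<Upsilon> + Kr)\<^sup>2"
  have K: "K > 0" unfolding K_def using KQ(1) K3(1) s by (intro add_pos_nonneg) auto
  have two: "Ly u \<le> K * (nX (u - \<phi>))\<^sup>2" if u: "u \<in> X" "nX (u - \<phi>) \<le> 1" for u
  proof -
    define v where "v = u - \<phi>"
    define n where "n = nX v"
    have vX: "v \<in> X" unfolding v_def using u \<phi>_X by auto
    have n: "0 \<le> n" "n \<le> 1" using u vX by (auto simp: n_def v_def)
    have n2: "n\<^sup>2 \<le> n" using n by (simp add: power2_eq_square mult_left_le)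
    have q: "op.Q v v \<le> KQ * n\<^sup>2" using KQ(2)[OF vX vX] by (simp add: n_def power2_eq_square)
    have "K3 * n ^ 3 \<le> K3 * n\<^sup>2" using n K3(1) by (intro mult_left_mono power_decreasing) auto
    then have c: "- cub v \<le> K3 * n\<^sup>2" using K3(2)[OF vX] by (simp add: n_def)
    have "\<bar>op.Q \<Upsilon> v - rem v\<bar> \<le> \<bar>op.Q \<Upsilon> v\<bar> + rem v" using rem(1)[OF vX] by linarith
    also have "\<dots> \<le> KQ * (nX \<Upsilon> * n) + Kr * n\<^sup>2"
      using KQ(2)[OF \<Upsilon>_X vX] rem(2)[OF vX] by (simp add: n_def)
    also have "\<dots> \<le> KQ * (nX \<Upsilon> * n) + Kr * n" using n2 Kr0 by (intro add_left_mono mult_left_mono) auto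
    also have "\<dots> = (KQ * nX \<Upsilon> + Kr) * n" by (simp add: algebra_simps)
    finally have "(op.Q \<Upsilon> v - rem v)\<^sup>2 \<le> ((KQ * nX \<Upsilon> + Kr) * n)\<^sup>2"
      by (metis abs_ge_zero power2_abs power_mono)
    then have x: "2 / ?s * (op.Q \<Upsilon> v - rem v)\<^sup>2 \<le> 2 / ?s * ((KQ * nX \<Upsilon> + Kr)\<^sup>2 * n\<^sup>2)"
      using s by (intro mult_left_mono) (auto simp: power_mult_distrib)
    have "K * n\<^sup>2 = (KQ * n\<^sup>2) / 2 + (K3 * n\<^sup>2) / 6 + 2 / ?s * ((KQ * nX \<Upsilon> + Kr)\<^sup>2 * n\<^sup>2)"
      by (simp add: K_def algebra_simps)
    moreover have "u = \<phi> + v" by (simp add: v_def)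
    ultimately show ?thesis using Ly[OF vX] q c x by (simp add: n_def v_def[symmetric])
  qed
  show thesis by (rule that[of "\<kappa> / 4" r0 K]) (use \<kappa>(1) r0 K one two in auto)
qed

section \<open>Orbital stability\<close>

text \<open>The Lyapunov function is constant along solutions and small initially. Near the orbit it dominates
the squared distance to the orbit, and that distance is continuous in time, so it cannot grow past
\<open>\<epsilon>'\<close> without taking the value \<open>\<epsilon>'\<close>, where the bound would be violated.\<close>

theorem stability:
  assumes s: "s_fun \<theta> L \<omega> A \<phi> > 0"
    and wp: "globally_well_posed \<theta> m L"
    and P: "conserved \<theta> m L (P_fun \<theta> L)" and F: "conserved \<theta> m L (F_fun \<theta> L)"
    and M: "conserved \<theta> m L (M_fun L)"
  shows "orbitally_stable \<theta> m L \<phi>"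
proof -
  define Ly where "Ly u = G u - G \<phi> + 2 / s_fun \<theta> L \<omega> A \<phi> * (N u - N \<phi>)\<^sup>2" for u
  obtain \<kappa> r0 K where k: "\<kappa> > 0" "r0 > 0" "K > 0"
    and low: "\<And>u. u \<in> X \<Longrightarrow> dist_orbit u < r0 \<Longrightarrow> \<kappa> * (dist_orbit u)\<^sup>2 \<le> Ly u"
    and up: "\<And>u. u \<in> X \<Longrightarrow> nX (u - \<phi>) \<le> 1 \<Longrightarrow> Ly u \<le> K * (nX (u - \<phi>))\<^sup>2"
    using lyapunov[OF s] unfolding Ly_def by metis
  show ?thesis unfolding orbitally_stable_def
  proof (intro allI impI)
    fix \<epsilon> :: real assume \<epsilon>: "\<epsilon> > 0"
    define \<epsilon>' where "\<epsilon>' = min \<epsilon> r0 / 2"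
    have \<epsilon>': "0 < \<epsilon>'" "\<epsilon>' < \<epsilon>" "\<epsilon>' < r0" using \<epsilon> k by (auto simp: \<epsilon>'_def min_def)
    define \<delta> where "\<delta> = min (min 1 \<epsilon>') (\<epsilon>' * sqrt (\<kappa> / K))"
    have \<delta>: "0 < \<delta>" "\<delta> \<le> 1" "\<delta> \<le> \<epsilon>'" "\<delta> \<le> \<epsilon>' * sqrt (\<kappa> / K)" using \<epsilon>' k by (simp_all add: \<delta>_def)
    show "\<exists>\<delta>>0. \<forall>u0\<in>H_per L (m / 2). H_norm L (m / 2) (\<lambda>x. u0 x - \<phi> x) < \<delta> \<longrightarrow>
           (\<exists>u. global_solution \<theta> m L u0 u) \<and>
           (\<forall>u. global_solution \<theta> m L u0 u \<longrightarrow> (\<forall>t\<ge>0. orbit_dist m L (u t) \<phi> < \<epsilon>))"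
    proof (intro exI[of _ \<delta>] conjI ballI impI allI)
      show "\<delta> > 0" by (rule \<delta>)
      fix u0 assume u0': "u0 \<in> H_per L (m / 2)" and close: "H_norm L (m / 2) (\<lambda>x. u0 x - \<phi> x) < \<delta>"
      show "\<exists>u. global_solution \<theta> m L u0 u" using wp u0' by (auto simp: globally_well_posed_def)
      fix u t assume sol: "global_solution \<theta> m L u0 u" and t: "0 \<le> (t :: real)"
      have u0: "u0 \<in> X" using u0' by (simp add: H_per_eq)
      have n0: "nX (u0 - \<phi>) < \<delta>" using close by (simp add: H_norm_diff)
      have uX: "u \<tau> \<in> X" if "\<tau> \<ge> 0" for \<tau> using sol that by (simp add: global_solution_def H_per_eq)
      have cons: "Ly (u \<tau>) = Ly u0" if "\<tau> \<ge> 0" for \<tau>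
      proof -
        have "P_fun \<theta> L (u \<tau>) = P_fun \<theta> L u0" "F_fun \<theta> L (u \<tau>) = F_fun \<theta> L u0" "M_fun L (u \<tau>) = M_fun L u0"
          using P F M sol u0' that unfolding conserved_def by blast+
        then show ?thesis by (simp add: Ly_def G_def N_def)
      qed
      have small: "Ly u0 < \<kappa> * \<epsilon>'\<^sup>2"
      proof -
        have "Ly u0 \<le> K * (nX (u0 - \<phi>))\<^sup>2" using up[OF u0] n0 \<delta> by simp
        also have "\<dots> < K * \<delta>\<^sup>2"
          using n0 k u0 \<phi>_X by (intro mult_strict_left_mono power_strict_mono) auto
        also have "\<dots> \<le> K * (\<epsilon>' * sqrt (\<kappa> / K))\<^sup>2" using k \<delta> by (intro mult_left_mono power_mono) auto
        also have "\<dots> = \<kappa> * \<epsilon>'\<^sup>2" using k by (simp add: power_mult_distrib)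
        finally show ?thesis .
      qed
      let ?\<rho> = "\<lambda>\<tau>. dist_orbit (u \<tau>)"
      have start: "?\<rho> 0 < \<epsilon>'"
      proof -
        have eq: "c (u 0) k = c u0 k" for k
          by (rule c_cong_AE) (use uX[of 0] u0 X_L2 sol in \<open>auto simp: global_solution_def\<close>)
        have "c (u 0 - \<phi>) k = c (u0 - \<phi>) k" for k
          using eq[of k] X_L2[OF uX[of 0]] X_L2[OF u0] \<phi>_L2 by (simp add: c_diff)
        then have "nX (u 0 - \<phi>) = nX (u0 - \<phi>)" unfolding nX_def using B_cong by metis
        moreover have "?\<rho> 0 \<le> nX (u 0 - shift 0 \<phi>)" by (rule nearest_translate(2)[OF uX]) simp
        ultimately show ?thesis using n0 \<delta> by simp
      qed
      have cont: "continuous_on {0..t} ?\<rho>"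
        unfolding continuous_on_def
      proof
        fix \<tau> assume \<tau>: "\<tau> \<in> {0..t}"
        have l0: "((\<lambda>s. nX (u s - u \<tau>)) \<longlongrightarrow> 0) (at \<tau> within {0..})"
          using sol \<tau> by (simp add: global_solution_def H_norm_diff)
        have l: "((\<lambda>s. nX (u s - u \<tau>)) \<longlongrightarrow> 0) (at \<tau> within {0..t})"
          by (rule tendsto_within_subset[OF l0]) auto
        show "(?\<rho> \<longlongrightarrow> ?\<rho> \<tau>) (at \<tau> within {0..t})"
        proof (rule LIM_zero_cancel, rule Lim_null_comparison[OF _ l])
          have "norm (?\<rho> s - ?\<rho> \<tau>) \<le> nX (u s - u \<tau>)" if "s \<in> {0..t}" for s
          proof -
            have X: "u s \<in> X" "u \<tau> \<in> X" using uX that \<tau> by auto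
            have "nX (u \<tau> - u s) = nX (u s - u \<tau>)"
              unfolding nX_def using X BX.sym[OF X] by (simp add: BX.quad_diff)
            then show ?thesis using dist_orbit_lipschitz[OF X] dist_orbit_lipschitz[OF X(2,1)] by simp
          qed
          then show "\<forall>\<^sub>F s in at \<tau> within {0..t}. norm (?\<rho> s - ?\<rho> \<tau>) \<le> nX (u s - u \<tau>)"
            by (auto simp: eventually_at_filter)
        qed
      qed
      have "?\<rho> t < \<epsilon>'"
      proof (rule ccontr)
        assume "\<not> ?\<rho> t < \<epsilon>'"
        then obtain \<tau> where \<tau>: "0 \<le> \<tau>" "?\<rho> \<tau> = \<epsilon>'"
          using IVT'[of ?\<rho> 0 \<epsilon>' t, OF _ _ t cont] start by auto
        have "\<kappa> * \<epsilon>'\<^sup>2 \<le> Ly (u \<tau>)" using low[OF uX[OF \<tau>(1)]] \<tau>(2) \<epsilon>'(3) by simp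
        then show False using cons[OF \<tau>(1)] small by simp
      qed
      then show "orbit_dist m L (u t) \<phi> < \<epsilon>" using \<epsilon>'(2) by (simp add: dist_orbit_def)
    qed
  qed
qed

end

theorem theorem1p1:
  fixes L0 m1 \<omega>0 A0 :: real and \<theta> \<phi> :: "real \<Rightarrow> real"
  assumes "L0 > 0"
    and "admissible_symbol \<theta> m1"
    and "hypothesis_H \<theta> m1 L0 \<omega>0 A0 \<phi>"
    and "globally_well_posed \<theta> m1 L0"
    and "conserved \<theta> m1 L0 (P_fun \<theta> L0)"
    and "conserved \<theta> m1 L0 (F_fun \<theta> L0)"
    and "conserved \<theta> m1 L0 (M_fun L0)"
    and "\<omega>0 - 1 - 2 * A0 \<noteq> 0"
    and "s_fun \<theta> L0 \<omega>0 A0 \<phi> > 0"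
  shows "orbitally_stable \<theta> m1 L0 \<phi>"
proof -
  interpret D: dispersive L0 \<theta> m1 by unfold_locales (use assms in auto)
  obtain d where d: "weak_deriv L0 \<phi> d" "L0_simple_with \<theta> m1 L0 \<omega>0 \<phi> 0 d" and \<phi>: "\<phi> \<in> D.X"
    using assms(3) by (auto simp: hypothesis_H_def D.H_per_eq)
  obtain C where C: "C > 0" "AE x in lborel. \<bar>\<phi> x\<bar> \<le> C"
    using D.weak_deriv_bounded[OF D.X_L2[OF \<phi>] d(1)] by metis
  interpret wave L0 \<theta> m1 \<omega>0 A0 \<phi> d C
    by unfold_locales (use assms(3) d C in auto)
  show ?thesis by (rule stability) (use assms in auto)
qed

end
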